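(* Let $\Sigma^2$ be an oriented $2$-manifold, $(M^3,g)$ an oriented Riemannian $3$-manifold, $f:\Sigma^2\to(M^3,g)$ a frontal, and $p$ a non-degenerate singular point of the second kind of $f$. Then the normalized product curvature $\mu_\Pi=\kappa_\nu\mu_c$ at $p$ is an intrinsic invariant. Moreover, the Gaussian curvature $K$ of $f$ is rationally bounded at $p$ if and only if $\mu_\Pi(p)=0$.
   Context: All manifolds and maps are $C^\infty$. Write $\langle\cdot,\cdot\rangle=g$, $|\cdot|$ for the norm, $\nabla$ for the Levi-Civita connection and $\det_g$ for the Riemannian volume form; $f_u=df(\partial_u)$, $f_{uv}=\nabla_{\partial_v}f_u$, $f_{uu}=\nabla_{\partial_u}f_u$, $\nu_u=\nabla_{\partial_u}\nu$, etc. The product $\times_g$ is defined by $\langle a\times_g b,c\rangle=\det_g(a,b,c)$. Frontals: a singular point of $f$ is a point where $f$ is not an immersion; other points are regular. $f$ is a frontal if around each point there is a unit vector field $\nu$ along $f$ with $\nu\perp df(a)$ for all tangent vectors $a$. A unit normal $\nu$ is fixed near $p$. Singular points: with $\lambda=\det_g(f_u,f_v,\nu)$ for a local coordinate system $(u,v)$, a singular point $p$ is non-degenerate if $d\lambda(p)\neq0$. Then $df(p)$ has rank one and near $p$ the singular set is a regular curve $\gamma(t)$, $\gamma(0)=p$. A null vector field along $\gamma$ is a nowhere vanishing field $\eta(t)$ along $\gamma$ with $df(\eta(t))=0$. A non-degenerate singular point $p$ is of the second kind if $\eta(0)$ is proportional to $\gamma'(0)$. Limiting normal curvature: for a singular point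 $p$ at which $df(p)$ has rank one, take positively oriented coordinates $(x,y)$ centered at $p$ with $f_y(p)=0$; then $\kappa_\nu(p):=\langle f_{xx}(p),\nu(p)\rangle/|f_x(p)|^2$, independent of the choice of such coordinates. Adapted coordinates (second kind): a positively oriented coordinate system $(u,v)$ centered at $p$ with $f_u(p)=0$, with the singular set equal to the $u$-axis, and with $|f_v(p)|=1$. Normalized cuspidal curvature: computed in an adapted coordinate system, $$\mu_c(p)=\frac{-\langle f_{uv}(p),\nu_u(p)\rangle}{|f_{uv}(p)\times_g f_v(p)|^2};$$ equivalently, $\mu_c(p)$ is the value at $p$ of the smooth extension of $2vH$, where $H$ is the mean curvature of $f$. The normalized product curvature is $\mu_\Pi(p):=\kappa_\nu(p)\mu_c(p)$. Intrinsic invariant: a quantity at $p$ whose value does not depend on the choice of adapted coordinate system used to compute it and is determined by the first fundamental form $f^*g$ alone. Gaussian curvature: $K$ is the Gaussian curvature of $f^*g$ on the set of regular points. Rational boundedness: on $\mathbb R\times S^1$ ($S^1=\mathbb R/2\pi\mathbb Z$) let $(r,\theta)\sim(-r,\theta+\pi)$, let $\mathcal M$ be the quotient and $\pi$ the projection, and let $\Phi:\mathcal M\to\mathbb R^2$ be the map with $\Phi(\pi(r,\theta))=(r\cos\theta,r\sin\theta)$. Transplanting by a local coordinate system centered at $p$ gives the blow up $\Phi:\hat\Sigma^2_p\to\Sigma^2$ at $p$ (independent of the coordinates). Let $W$ be a neighborhood of $p$ and $\mathcal O$ an open dense subset of $W$. A $C^\infty$ function $\varphi:\mathcal O\to\mathbb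 R$ is rationally bounded at $p$ if there is a $C^\infty$ function $\rho:\Phi^{-1}(W)\to\mathbb R$ such that (a) $\Phi^{-1}(\mathcal O\setminus\{p\})=\Phi^{-1}(W\setminus\{p\})\cap\rho^{-1}(\mathbb R\setminus\{0\})$; (b) $\rho^{-1}(0)\cap\Phi^{-1}(p)$ is a finite set; (c) there is a $C^\infty$ function $\psi:\Phi^{-1}(W)\to\mathbb R$ with $\psi(q)=\rho(q)\,\varphi(\Phi(q))$ for $q\in\Phi^{-1}(\mathcal O)$. For $\varphi=K$, one takes $W$ a sufficiently small neighborhood of $p$ and $\mathcal O$ the set of regular points of $f$ in $W$.
   Formalization: The value of μ_Π is independent of the adapted coordinate system only up to sign: replacing (u,v) by (-u,-v) reverses it, so the formal claim is equality up to the sign of ∂v'/∂v at p; in given adapted coordinates it depends on f^*g alone. *)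

theory Defs
  imports "HOL-Analysis.Analysis"
begin

subsection \<open>Smooth maps on open subsets of Euclidean spaces\<close>

text \<open>Only used for open sets, where the derivative taken within the whole space is the right one.\<close>

primrec Ck_on ::
  "nat \<Rightarrow> 'a set \<Rightarrow> ('a::real_normed_vector \<Rightarrow> 'b::real_normed_vector) \<Rightarrow> bool" where
  "Ck_on 0 X F \<longleftrightarrow> continuous_on X F"
| "Ck_on (Suc k) X F \<longleftrightarrow> (\<forall>x\<in>X. F differentiable (at x)) \<and>
     (\<forall>v. Ck_on k X (\<lambda>x. frechet_derivative F (at x) v))"

definition smooth_on ::
  "'a set \<Rightarrow> ('a::real_normed_vector \<Rightarrow> 'b::real_normed_vector) \<Rightarrow> bool" where
  "smooth_on X F \<longleftrightarrow> (\<forall>k. Ck_on k X F)"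

definition pd :: "'n::finite \<Rightarrow> (real^'n \<Rightarrow> 'b::real_normed_vector) \<Rightarrow> real^'n \<Rightarrow> 'b" where
  "pd i F z = frechet_derivative F (at z) (axis i 1)"


subsection \<open>Oriented manifolds\<close>

text \<open>The manifold is the whole type \<open>'a\<close> (Hausdorff and second countable by its type class) with an
  atlas. A chart is a pair of its domain and its coordinate map; the map is irrelevant outside
  of the domain.\<close>

type_synonym ('a, 'e) chart = "'a set \<times> ('a \<Rightarrow> 'e)"

abbreviation chart_inv :: "('a, 'e) chart \<Rightarrow> 'e \<Rightarrow> 'a" where
  "chart_inv x \<equiv> inv_into (fst x) (snd x)"

abbreviation chart_image :: "('a, 'e) chart \<Rightarrow> 'e set" where
  "chart_image x \<equiv> snd x ` fst x"

definition is_chart :: "('a::topological_space, real^'n) chart \<Rightarrow> bool" where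
  "is_chart x \<longleftrightarrow> open (fst x) \<and> open (chart_image x) \<and>
     homeomorphism (fst x) (chart_image x) (snd x) (chart_inv x)"

definition transition :: "('a, 'e) chart \<Rightarrow> ('a, 'e) chart \<Rightarrow> 'e \<Rightarrow> 'e" where
  "transition x y = snd y \<circ> chart_inv x"

definition smoothly_compatible ::
  "('a, real^'n) chart \<Rightarrow> ('a, real^'n) chart \<Rightarrow> bool" where
  "smoothly_compatible x y \<longleftrightarrow>
     smooth_on (snd x ` (fst x \<inter> fst y)) (transition x y) \<and>
     smooth_on (snd y ` (fst x \<inter> fst y)) (transition y x)"

definition coordinate_systems ::
  "('a::topological_space, real^'n) chart set \<Rightarrow> ('a, real^'n) chart set" where
  "coordinate_systems A = {x. is_chart x \<and> (\<forall>y\<in>A. smoothly_compatible x y)}"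

definition positive_coordinate_systems ::
  "('a::topological_space, real^'n) chart set \<Rightarrow> ('a, real^'n) chart set" where
  "positive_coordinate_systems A = {x \<in> coordinate_systems A. \<forall>y\<in>A.
     \<forall>z \<in> snd x ` (fst x \<inter> fst y).
       0 < det (matrix (frechet_derivative (transition x y) (at z)))}"

definition oriented_manifold ::
  "('a::{t2_space,second_countable_topology}, real^'n) chart set \<Rightarrow> bool" where
  "oriented_manifold A \<longleftrightarrow>
     (\<Union>x\<in>A. fst x) = UNIV \<and> A \<subseteq> positive_coordinate_systems A"

definition local_rep :: "('b, 'd) chart \<Rightarrow> ('a \<Rightarrow> 'b) \<Rightarrow> ('a, 'e) chart \<Rightarrow> 'e \<Rightarrow> 'd" where
  "local_rep c f x = snd c \<circ> f \<circ> chart_inv x"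

definition smooth_map ::
  "('a::topological_space, real^'n) chart set \<Rightarrow> ('b::topological_space, real^'m) chart set
    \<Rightarrow> ('a \<Rightarrow> 'b) \<Rightarrow> bool" where
  "smooth_map S M f \<longleftrightarrow> continuous_on UNIV f \<and>
     (\<forall>x\<in>S. \<forall>c\<in>M. smooth_on (snd x ` (fst x \<inter> f -` fst c)) (local_rep c f x))"

definition smooth_function_on ::
  "('a, real^'n) chart set \<Rightarrow> 'a set \<Rightarrow> ('a \<Rightarrow> 'b::real_normed_vector) \<Rightarrow> bool" where
  "smooth_function_on S U h \<longleftrightarrow> (\<forall>x\<in>S. smooth_on (snd x ` (fst x \<inter> U)) (h \<circ> chart_inv x))"


subsection \<open>Riemannian metrics in coordinates\<close>

definition ip :: "real^'n^'n \<Rightarrow> real^'n \<Rightarrow> real^'n \<Rightarrow> real" where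
  "ip G a b = a \<bullet> (G *v b)"

definition gnorm :: "real^'n^'n \<Rightarrow> real^'n \<Rightarrow> real" where
  "gnorm G a = sqrt (ip G a a)"

text \<open>A metric assigns to each chart \<open>c\<close> its component matrix as a function on the image of \<open>c\<close>.
  The last clause is the transformation law of a covariant 2-tensor.\<close>

type_synonym ('a, 'n) metric = "('a, real^'n) chart \<Rightarrow> real^'n \<Rightarrow> real^'n^'n"

definition riemannian_metric ::
  "('a, real^'n) chart set \<Rightarrow> ('a, 'n::finite) metric \<Rightarrow> bool" where
  "riemannian_metric M g \<longleftrightarrow>
     (\<forall>c\<in>M. smooth_on (chart_image c) (g c) \<and>
        (\<forall>y\<in>chart_image c. transpose (g c y) = g c y \<and> (\<forall>a. a \<noteq> 0 \<longrightarrow> 0 < ip (g c y) a a))) \<and>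
     (\<forall>c\<in>M. \<forall>d\<in>M. \<forall>y \<in> snd c ` (fst c \<inter> fst d). \<forall>a b.
        ip (g d (transition c d y)) (frechet_derivative (transition c d) (at y) a)
           (frechet_derivative (transition c d) (at y) b) = ip (g c y) a b)"

text \<open>\<open>christoffel h y k i j\<close> is the symbol with upper index \<open>k\<close>, for a matrix field \<open>h\<close>.\<close>

definition christoffel ::
  "(real^'n \<Rightarrow> real^'n^'n) \<Rightarrow> real^'n \<Rightarrow> 'n::finite \<Rightarrow> 'n \<Rightarrow> 'n \<Rightarrow> real" where
  "christoffel h y k i j = 1/2 * (\<Sum>l\<in>UNIV. matrix_inv (h y) $ k $ l *
     (pd i (\<lambda>y. h y $ j $ l) y + pd j (\<lambda>y. h y $ i $ l) y - pd l (\<lambda>y. h y $ i $ j) y))"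

text \<open>Levi-Civita derivative, in the direction of the \<open>i\<close>-th coordinate field, of a vector field \<open>X\<close>
  along the map \<open>F\<close>.\<close>

definition covd ::
  "(real^'n \<Rightarrow> real^'n^'n) \<Rightarrow> (real^'m \<Rightarrow> real^'n) \<Rightarrow> 'm::finite \<Rightarrow> (real^'m \<Rightarrow> real^'n::finite)
    \<Rightarrow> real^'m \<Rightarrow> real^'n" where
  "covd h F i X z = pd i X z +
     (\<chi> k. \<Sum>a\<in>UNIV. \<Sum>b\<in>UNIV. christoffel h (F z) k a b * pd i F z $ a * X z $ b)"

definition vol :: "real^3^3 \<Rightarrow> real^3 \<Rightarrow> real^3 \<Rightarrow> real^3 \<Rightarrow> real" where
  "vol G a b c = sqrt (det G) * det (vector [a, b, c] :: real^3^3)"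

definition cross_g :: "real^3^3 \<Rightarrow> real^3 \<Rightarrow> real^3 \<Rightarrow> real^3" where
  "cross_g G a b = (THE w. \<forall>c. ip G w c = vol G a b c)"

text \<open>Gaussian curvature \<open>\<langle>R(\<partial>\<^sub>1,\<partial>\<^sub>2)\<partial>\<^sub>2,\<partial>\<^sub>1\<rangle> / det h\<close> of a 2-dimensional metric, with
  \<open>R(X,Y) = [\<nabla>\<^sub>X,\<nabla>\<^sub>Y]\<close> for coordinate fields \<open>X, Y\<close>.\<close>

definition gauss_curvature :: "(real^2 \<Rightarrow> real^2^2) \<Rightarrow> real^2 \<Rightarrow> real" where
  "gauss_curvature h z =
     (\<Sum>l\<in>UNIV. h z $ l $ 1 *
        (pd 1 (\<lambda>z. christoffel h z l 2 2) z - pd 2 (\<lambda>z. christoffel h z l 1 2) z +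
         (\<Sum>m\<in>UNIV. christoffel h z m 2 2 * christoffel h z l 1 m
                   - christoffel h z m 1 2 * christoffel h z l 2 m)))
     / det (h z)"


subsection \<open>Frontals\<close>

text \<open>The unit normal on \<open>U\<close> is given by its components \<open>N\<close> in one chart \<open>c\<close> whose domain contains
  \<open>f ` U\<close>.\<close>

definition unit_normal ::
  "('s::topological_space, real^2) chart set \<Rightarrow> ('m, 3) metric \<Rightarrow> ('s \<Rightarrow> 'm)
    \<Rightarrow> ('m, real^3) chart \<Rightarrow> 's set \<Rightarrow> ('s \<Rightarrow> real^3) \<Rightarrow> bool" where
  "unit_normal S g f c U N \<longleftrightarrow>
     open U \<and> f ` U \<subseteq> fst c \<and> smooth_function_on S U N \<and>
     (\<forall>q\<in>U. gnorm (g c (snd c (f q))) (N q) = 1 \<and>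
        (\<forall>x\<in>S. q \<in> fst x \<longrightarrow> (\<forall>a.
           ip (g c (snd c (f q))) (N q)
              (frechet_derivative (local_rep c f x) (at (snd x q)) a) = 0)))"

definition frontal ::
  "('s::topological_space, real^2) chart set \<Rightarrow> ('m::topological_space, real^3) chart set
    \<Rightarrow> ('m, 3) metric \<Rightarrow> ('s \<Rightarrow> 'm) \<Rightarrow> bool" where
  "frontal S M g f \<longleftrightarrow> smooth_map S M f \<and>
     (\<forall>q. \<exists>c\<in>M. \<exists>U N. q \<in> U \<and> unit_normal S g f c U N)"

definition singular_point ::
  "('s, real^2) chart set \<Rightarrow> ('m, real^3) chart set \<Rightarrow> ('s \<Rightarrow> 'm) \<Rightarrow> 's \<Rightarrow> bool" where
  "singular_point S M f q \<longleftrightarrow> (\<exists>x\<in>S. \<exists>c\<in>M. q \<in> fst x \<and> f q \<in> fst c \<and>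
     \<not> inj (frechet_derivative (local_rep c f x) (at (snd x q))))"

definition signed_area_density ::
  "('m, 3) metric \<Rightarrow> ('s \<Rightarrow> 'm) \<Rightarrow> ('m, real^3) chart \<Rightarrow> ('s \<Rightarrow> real^3) \<Rightarrow> ('s, real^2) chart
    \<Rightarrow> real^2 \<Rightarrow> real" where
  "signed_area_density g f c N x z =
     (let F = local_rep c f x in
      vol (g c (F z)) (pd 1 F z) (pd 2 F z) (N (chart_inv x z)))"

definition nondegenerate_singular_point ::
  "('s, real^2) chart set \<Rightarrow> ('m, real^3) chart set \<Rightarrow> ('m, 3) metric \<Rightarrow> ('s \<Rightarrow> 'm)
    \<Rightarrow> ('m, real^3) chart \<Rightarrow> ('s \<Rightarrow> real^3) \<Rightarrow> 's \<Rightarrow> bool" where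
  "nondegenerate_singular_point S M g f c N p \<longleftrightarrow> singular_point S M f p \<and>
     (\<exists>x\<in>S. p \<in> fst x \<and>
        frechet_derivative (signed_area_density g f c N x) (at (snd x p)) \<noteq> (\<lambda>a. 0))"

text \<open>The singular curve \<open>\<gamma>\<close> and the null vector field \<open>\<eta>\<close> are written in a chart around \<open>p\<close>.\<close>

definition of_second_kind ::
  "('s, real^2) chart set \<Rightarrow> ('m, real^3) chart set \<Rightarrow> ('s \<Rightarrow> 'm) \<Rightarrow> 's \<Rightarrow> bool" where
  "of_second_kind S M f p \<longleftrightarrow>
     (\<exists>x\<in>S. \<exists>c\<in>M. p \<in> fst x \<and> f p \<in> fst c \<and>
       (\<exists>V e \<gamma> \<eta>. open V \<and> snd x p \<in> V \<and> V \<subseteq> snd x ` (fst x \<inter> f -` fst c) \<and> 0 < (e::real) \<and>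
          smooth_on {-e<..<e} \<gamma> \<and> \<gamma> 0 = snd x p \<and>
          (\<forall>t\<in>{-e<..<e}. vector_derivative \<gamma> (at t) \<noteq> 0) \<and>
          {z\<in>V. singular_point S M f (chart_inv x z)} = \<gamma> ` {-e<..<e} \<and>
          smooth_on {-e<..<e} \<eta> \<and>
          (\<forall>t\<in>{-e<..<e}. \<eta> t \<noteq> 0 \<and>
             frechet_derivative (local_rep c f x) (at (\<gamma> t)) (\<eta> t) = 0) \<and>
          (\<exists>k. \<eta> 0 = k *\<^sub>R vector_derivative \<gamma> (at 0))))"

definition first_form ::
  "('m, 3) metric \<Rightarrow> ('s \<Rightarrow> 'm) \<Rightarrow> ('m, real^3) chart \<Rightarrow> ('s, real^2) chart
    \<Rightarrow> real^2 \<Rightarrow> real^2^2" where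
  "first_form g f c x z =
     (let F = local_rep c f x in \<chi> i j. ip (g c (F z)) (pd i F z) (pd j F z))"

definition same_first_form_near ::
  "('s::topological_space, real^2) chart set \<Rightarrow>
   ('m, real^3) chart set \<Rightarrow> ('m, 3) metric \<Rightarrow> ('s \<Rightarrow> 'm) \<Rightarrow>
   ('n, real^3) chart set \<Rightarrow> ('n, 3) metric \<Rightarrow> ('s \<Rightarrow> 'n) \<Rightarrow> 's \<Rightarrow> bool" where
  "same_first_form_near S M g f M' g' f' p \<longleftrightarrow>
     (\<exists>V. open V \<and> p \<in> V \<and> (\<forall>q\<in>V. \<forall>x\<in>S. \<forall>c\<in>M. \<forall>c'\<in>M'.
        q \<in> fst x \<and> f q \<in> fst c \<and> f' q \<in> fst c' \<longrightarrow>
        first_form g f c x (snd x q) = first_form g' f' c' x (snd x q)))"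


subsection \<open>Invariants at singular points of the second kind\<close>

definition kappa_coordinates ::
  "('s::topological_space, real^2) chart set \<Rightarrow> ('s \<Rightarrow> 'm) \<Rightarrow> ('m, real^3) chart \<Rightarrow> 's
    \<Rightarrow> ('s, real^2) chart set" where
  "kappa_coordinates S f c p = {xy \<in> positive_coordinate_systems S.
     p \<in> fst xy \<and> snd xy p = 0 \<and> pd 2 (local_rep c f xy) 0 = 0}"

definition limiting_normal_curvature ::
  "('m, 3) metric \<Rightarrow> ('s \<Rightarrow> 'm) \<Rightarrow> ('m, real^3) chart \<Rightarrow> ('s \<Rightarrow> real^3) \<Rightarrow> ('s, real^2) chart
    \<Rightarrow> 's \<Rightarrow> real" where
  "limiting_normal_curvature g f c N xy p =
     (let F = local_rep c f xy; G = g c (snd c (f p)) in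
      ip G (covd (g c) F 1 (pd 1 F) 0) (N p) / (gnorm G (pd 1 F 0))\<^sup>2)"

definition adapted_coordinates ::
  "('s::topological_space, real^2) chart set \<Rightarrow> ('m, real^3) chart set \<Rightarrow> ('m, 3) metric
    \<Rightarrow> ('s \<Rightarrow> 'm) \<Rightarrow> ('m, real^3) chart \<Rightarrow> 's \<Rightarrow> ('s, real^2) chart set" where
  "adapted_coordinates S M g f c p = {uv \<in> positive_coordinate_systems S.
     p \<in> fst uv \<and> snd uv p = 0 \<and>
     pd 1 (local_rep c f uv) 0 = 0 \<and>
     (\<forall>q\<in>fst uv. singular_point S M f q \<longleftrightarrow> snd uv q $ 2 = 0) \<and>
     gnorm (g c (snd c (f p))) (pd 2 (local_rep c f uv) 0) = 1}"

definition cuspidal_curvature ::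
  "('m, 3) metric \<Rightarrow> ('s \<Rightarrow> 'm) \<Rightarrow> ('m, real^3) chart \<Rightarrow> ('s \<Rightarrow> real^3) \<Rightarrow> ('s, real^2) chart
    \<Rightarrow> 's \<Rightarrow> real" where
  "cuspidal_curvature g f c N uv p =
     (let F = local_rep c f uv; G = g c (snd c (f p));
          f_uv = covd (g c) F 2 (pd 1 F) 0;
          nu_u = covd (g c) F 1 (N \<circ> chart_inv uv) 0 in
      - ip G f_uv nu_u / (gnorm G (cross_g G f_uv (pd 2 F 0)))\<^sup>2)"

definition product_curvature ::
  "('m, 3) metric \<Rightarrow> ('s \<Rightarrow> 'm) \<Rightarrow> ('m, real^3) chart \<Rightarrow> ('s \<Rightarrow> real^3)
    \<Rightarrow> ('s, real^2) chart \<Rightarrow> ('s, real^2) chart \<Rightarrow> 's \<Rightarrow> real" where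
  "product_curvature g f c N xy uv p =
     limiting_normal_curvature g f c N xy p * cuspidal_curvature g f c N uv p"

text \<open>Replacing adapted coordinates \<open>(u,v)\<close> by the adapted, equally oriented coordinates \<open>(-u,-v)\<close>
  reverses the sign of the normalized cuspidal curvature (and of \<open>2vH\<close>) for a fixed unit normal.
  The following sign records whether two adapted systems agree on the side \<open>v > 0\<close> of the
  singular curve; it is the sign of \<open>\<partial>v'/\<partial>v\<close> at \<open>p\<close>.\<close>

definition side_sign :: "('s, real^2) chart \<Rightarrow> ('s, real^2) chart \<Rightarrow> real" where
  "side_sign uv uv' = sgn (pd 2 (\<lambda>z. transition uv uv' z $ 2) 0)"


subsection \<open>Rational boundedness\<close>

text \<open>The quotient surface \<open>\<M>\<close> is the range of \<open>blowup_proj\<close>: its points are the classes of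
  \<open>\<real> \<times> \<real>\<close> under the group generated by \<open>(r,\<theta>) \<mapsto> (-r,\<theta>+\<pi>)\<close>, whose square is
  \<open>(r,\<theta>) \<mapsto> (r,\<theta>+2\<pi>)\<close>. As \<open>blowup_proj\<close> is a covering, a function on an open subset of \<open>\<M>\<close> is
  smooth iff its composition with \<open>blowup_proj\<close> is, and \<open>polar = \<Phi> \<circ> blowup_proj\<close>.\<close>

definition blowup_proj :: "real \<times> real \<Rightarrow> (real \<times> real) set" where
  "blowup_proj w = {w'. \<exists>k::int. w' = ((-1) powi k * fst w, snd w + of_int k * pi)}"

definition polar :: "real \<times> real \<Rightarrow> real^2" where
  "polar w = vector [fst w * cos (snd w), fst w * sin (snd w)]"

definition rationally_bounded :: "(real^2) set \<Rightarrow> (real^2) set \<Rightarrow> (real^2 \<Rightarrow> real) \<Rightarrow> bool" where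
  "rationally_bounded W D \<phi> \<longleftrightarrow>
     open W \<and> 0 \<in> W \<and> open D \<and> D \<subseteq> W \<and> W \<subseteq> closure D \<and> smooth_on D \<phi> \<and>
     (\<exists>\<rho> \<psi> :: (real \<times> real) set \<Rightarrow> real.
        smooth_on (polar -` W) (\<rho> \<circ> blowup_proj) \<and>
        smooth_on (polar -` W) (\<psi> \<circ> blowup_proj) \<and>
        blowup_proj ` (polar -` (D - {0})) =
          blowup_proj ` (polar -` (W - {0})) \<inter> {q. \<rho> q \<noteq> 0} \<and>
        finite ({q. \<rho> q = 0} \<inter> blowup_proj ` (polar -` {0})) \<and>
        (\<forall>w \<in> polar -` D. \<psi> (blowup_proj w) = \<rho> (blowup_proj w) * \<phi> (polar w)))"

text \<open>Everything is transplanted to the plane by the coordinate system \<open>x\<close> centered at the point.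
  Rational boundedness on one \<open>W\<close> restricts to all smaller ones, so ``for \<open>W\<close> sufficiently small''
  means ``for some \<open>W\<close>''.\<close>

definition gauss_curvature_rationally_bounded ::
  "('s, real^2) chart set \<Rightarrow> ('m, real^3) chart set \<Rightarrow> ('m, 3) metric \<Rightarrow> ('s \<Rightarrow> 'm)
    \<Rightarrow> ('m, real^3) chart \<Rightarrow> ('s, real^2) chart \<Rightarrow> bool" where
  "gauss_curvature_rationally_bounded S M g f c x \<longleftrightarrow>
     (\<exists>W. W \<subseteq> snd x ` (fst x \<inter> f -` fst c) \<and>
        rationally_bounded W {z\<in>W. \<not> singular_point S M f (chart_inv x z)}
          (gauss_curvature (first_form g f c x)))"

end

(*
In coordinates, the Gauss equation reads det(h) K = L N - M^2 + A, where h is the first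
fundamental form and A = <R(f_1, f_2) f_2, f_1> is smooth across the singular set.  At a singular
point f_1 and f_2 are dependent, so A vanishes to second order there.  In adapted coordinates
L = M = 0 and dL = mu_c |f_uv x f_v|^2 dv at p, while N = kappa_nu; hence Q = det(h) K satisfies
Q = 0 and dQ = mu_Pi |f_uv x f_v|^2 dv at p.  Since det(h) = lambda^2 with lambda vanishing
to first order along v = 0 and (lambda_v)^2 = |f_uv x f_v|^2 at p, this writes mu_Pi in terms of
h alone.

For rational boundedness, divide by powers of r on the blow up: lambda = r P and, if dQ = 0, also
Q = r^2 T, so K = T / P^2.  If dQ <> 0, then rho Q = psi lambda^2 with Q of order r and
lambda^2 of order r^2 forces rho = 0 on almost all of the exceptional circle.
*)

theory Submission
  imports Defs
begin

section \<open>Smooth maps\<close>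

text \<open>The intrinsic curvature formula contains the inverse of the first fundamental form, so
  it has no meaning on the singular curve. Lowering the indices of the Christoffel symbols removes
  the inverse, because the lowered symbols <D_i f_j, f_k> stay smooth there. Two frontals with the
  same first fundamental form therefore share Q off the curve, and their v-derivatives at p are
  compared by approaching p along the v-axis. The term A vanishes to second order for two reasons:
  where f_1 = r f_2, the vector R(f_1, f_2) f_2 is zero, and since it is orthogonal to f_2 it may be
  paired with f_1 - r f_2, which is zero as well. The first form determines \<lambda>^2 but not
  \<lambda>. Passing from (u, v) to (-u, -v) reverses mu_c, so independence of the coordinates holds
  up to the sign of dv'/dv; the criterion for K only asks whether mu_Pi vanishes. On the blow up, P
  changes sign under (r, \<theta>) -> (-r, \<theta> + pi) and does not descend to the quotient,
  whereas P^2 and T do.\<close>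

lemma Ck_on_subset: "Ck_on k X F \<Longrightarrow> Y \<subseteq> X \<Longrightarrow> Ck_on k Y F"
  by (induction k arbitrary: F) (auto intro: continuous_on_subset)

lemma frechet_derivative_cong_open:
  assumes "open X" "x \<in> X" "\<And>y. y \<in> X \<Longrightarrow> F y = G y"
  shows "frechet_derivative F (at x) = frechet_derivative G (at x)"
proof -
  have "(F has_derivative D) (at x) \<longleftrightarrow> (G has_derivative D) (at x)" for D
    using assms has_derivative_transform_within_open[of F D x UNIV X G]
      has_derivative_transform_within_open[of G D x UNIV X F] by auto
  then show ?thesis by (simp add: frechet_derivative_def)
qed

lemma differentiable_cong_open:
  assumes "open X" "x \<in> X" "\<And>y. y \<in> X \<Longrightarrow> F y = G y"
  shows "F differentiable (at x) \<longleftrightarrow> G differentiable (at x)"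
  using assms has_derivative_transform_within_open[of F _ x UNIV X G]
      has_derivative_transform_within_open[of G _ x UNIV X F] 
  unfolding differentiable_def by metis

lemma Ck_on_cong:
  assumes "open X" "\<And>x. x \<in> X \<Longrightarrow> F x = G x"
  shows "Ck_on k X F \<longleftrightarrow> Ck_on k X G"
  using assms(2)
proof (induction k arbitrary: F G)
  case 0
  then show ?case by (simp cong: continuous_on_cong)
next
  case (Suc k)
  have "Ck_on k X (\<lambda>x. frechet_derivative F (at x) v) \<longleftrightarrow>
      Ck_on k X (\<lambda>x. frechet_derivative G (at x) v)" for v
    using frechet_derivative_cong_open[OF assms(1) _ Suc.prems]
    by (intro Suc.IH) simp
  moreover have "F differentiable (at x) \<longleftrightarrow> G differentiable (at x)" if "x \<in> X" for x
    using differentiable_cong_open[OF assms(1) that Suc.prems] .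
  ultimately show ?case by simp
qed

lemma Ck_on_SucD: "Ck_on (Suc k) X F \<Longrightarrow> Ck_on k X F"
proof (induction k arbitrary: F)
  case 0
  then show ?case
    by (simp add: continuous_at_imp_continuous_on differentiable_imp_continuous_within)
next
  case (Suc k)
  have "\<forall>x\<in>X. F differentiable (at x)" "\<And>v. Ck_on (Suc k) X (\<lambda>x. frechet_derivative F (at x) v)"
    using Suc.prems unfolding Ck_on.simps(2)[of "Suc k"] by blast+
  then show ?case using Suc.IH by simp
qed

lemma Ck_on_local:
  assumes "\<And>x. x \<in> X \<Longrightarrow> \<exists>V. open V \<and> x \<in> V \<and> Ck_on k V F"
  shows "Ck_on k X F"
  using assms
proof (induction k arbitrary: F)
  case 0
  then have "isCont F x" if "x \<in> X" for x
    using that continuous_on_eq_continuous_at by (metis Ck_on.simps(1))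
  then show ?case by (simp add: continuous_at_imp_continuous_on)
next
  case (Suc k)
  have "Ck_on k X (\<lambda>x. frechet_derivative F (at x) v)" for v
    using Suc.prems by (intro Suc.IH) fastforce
  then show ?case using Suc.prems by fastforce
qed

lemma Ck_on_const: "Ck_on k X (\<lambda>x. c)"
  by (induction k arbitrary: c) auto

text \<open>Uniqueness of derivatives lets an explicit formula \<open>D\<close> replace the chosen
  \<open>frechet_derivative\<close>, so an induction on \<open>k\<close> can run on the
  formula.\<close>

lemma Ck_on_SucI:
  assumes "open X" "\<And>x. x \<in> X \<Longrightarrow> (F has_derivative D x) (at x)"
    and "\<And>v. Ck_on k X (\<lambda>x. D x v)"
  shows "Ck_on (Suc k) X F"
proof -
  have "frechet_derivative F (at x) = D x" if "x \<in> X" for x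
    using assms(2)[OF that] by (metis frechet_derivative_at)
  then have "Ck_on k X (\<lambda>x. frechet_derivative F (at x) v) \<longleftrightarrow> Ck_on k X (\<lambda>x. D x v)" for v
    by (intro Ck_on_cong assms) auto
  then show ?thesis using assms by (auto simp: differentiable_def)
qed

lemma Ck_on_Suc_has_derivative:
  assumes "Ck_on (Suc k) X F" "x \<in> X"
  shows "(F has_derivative frechet_derivative F (at x)) (at x)"
  using assms by (simp add: frechet_derivative_works)

section \<open>Stability of k-fold differentiability under sums, products and composition\<close>

lemma Ck_on_bounded_linear:
  assumes "bounded_linear F" "open X"
  shows "Ck_on k X F"
proof (cases k)
  case 0
  then show ?thesis
    using assms linear_continuous_on by auto
next
  case (Suc m)
  show ?thesis unfolding Suc using assms
    by (intro Ck_on_SucI[of _ _ "\<lambda>_. F"]) (auto intro: bounded_linear_imp_has_derivative Ck_on_const)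
qed

lemma Ck_on_add:
  assumes "open X"
  shows "Ck_on k X F \<Longrightarrow> Ck_on k X G \<Longrightarrow> Ck_on k X (\<lambda>x. F x + G x)"
proof (induction k arbitrary: F G)
  case 0
  then show ?case by (simp add: continuous_on_add)
next
  case (Suc k)
  note D = Ck_on_Suc_has_derivative[OF Suc.prems(1)] Ck_on_Suc_has_derivative[OF Suc.prems(2)]
  show ?case
  proof (rule Ck_on_SucI[OF assms has_derivative_add[OF D]])
    show "Ck_on k X (\<lambda>x. frechet_derivative F (at x) v + frechet_derivative G (at x) v)" for v
      using Suc.prems by (intro Suc.IH) auto
  qed
qed

lemma Ck_on_bilinear:
  assumes "open X" "bounded_bilinear B"
  shows "Ck_on k X F \<Longrightarrow> Ck_on k X G \<Longrightarrow> Ck_on k X (\<lambda>x. B (F x) (G x))"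
proof (induction k arbitrary: F G)
  case 0
  then show ?case using assms(2) by (simp add: bounded_bilinear.continuous_on)
next
  case (Suc k)
  note D = Ck_on_Suc_has_derivative[OF Suc.prems(1)] Ck_on_Suc_has_derivative[OF Suc.prems(2)]
  show ?case
  proof (rule Ck_on_SucI[OF assms(1) bounded_bilinear.FDERIV[OF assms(2) D]])
    have "Ck_on k X F" "Ck_on k X G" using Suc.prems Ck_on_SucD by blast+
    moreover have "Ck_on k X (\<lambda>x. frechet_derivative F (at x) v)"
      "Ck_on k X (\<lambda>x. frechet_derivative G (at x) v)" for v using Suc.prems by auto
    ultimately show "Ck_on k X (\<lambda>x. B (F x) (frechet_derivative G (at x) v) + B (frechet_derivative F (at x) v) (G x))" for v
      by (intro Ck_on_add assms(1) Suc.IH)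
  qed
qed

lemma Ck_on_sum:
  assumes "open X" "\<And>i. i \<in> I \<Longrightarrow> Ck_on k X (F i)"
  shows "Ck_on k X (\<lambda>x. \<Sum>i\<in>I. F i x)"
  using assms(2)
  by (induction I rule: infinite_finite_induct) (auto intro: Ck_on_const Ck_on_add assms(1))

text \<open>The derivative of \<open>F\<close> at \<open>G x\<close> is applied to a direction that
  varies with \<open>x\<close>, while the hypothesis controls fixed directions. Expanding the
  direction in \<open>Basis\<close> separates the two dependences, whence the Euclidean domain of
  \<open>F\<close>.\<close>

lemma Ck_on_compose:
  fixes F :: "'b::euclidean_space \<Rightarrow> 'c::real_normed_vector"
  assumes "open X" and GX: "G ` X \<subseteq> Y"
  shows "Ck_on k X G \<Longrightarrow> Ck_on k Y F \<Longrightarrow> Ck_on k X (\<lambda>x. F (G x))"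
proof (induction k arbitrary: F)
  case 0
  then show ?case using GX continuous_on_compose2 by auto
next
  case (Suc k)
  let ?D = "\<lambda>x v. frechet_derivative F (at (G x)) (frechet_derivative G (at x) v)"
  have G: "(G has_derivative frechet_derivative G (at x)) (at x)"
    and F: "(F has_derivative frechet_derivative F (at (G x))) (at (G x))" if "x \<in> X" for x
    using Ck_on_Suc_has_derivative[OF Suc.prems(1) that]
      Ck_on_Suc_has_derivative[OF Suc.prems(2), of "G x"] GX that by blast+
  show ?case
  proof (rule Ck_on_SucI[OF assms(1)])
    show "((\<lambda>x. F (G x)) has_derivative ?D x) (at x)" if "x \<in> X" for x
      using has_derivative_compose[OF G F] that by blast
    fix v
    have eq: "?D x v = (\<Sum>b\<in>Basis. (frechet_derivative G (at x) v \<bullet> b) *\<^sub>R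
        frechet_derivative F (at (G x)) b)" if "x \<in> X" for x
    proof -
      have "linear (frechet_derivative F (at (G x)))"
        using F[OF that] has_derivative_linear by blast
      then have "frechet_derivative F (at (G x)) (\<Sum>b\<in>Basis. (w \<bullet> b) *\<^sub>R b)
          = (\<Sum>b\<in>Basis. (w \<bullet> b) *\<^sub>R frechet_derivative F (at (G x)) b)" for w
        by (simp add: linear_sum linear_cmul)
      from this[of "frechet_derivative G (at x) v"] show ?thesis
        by (simp only: euclidean_representation)
    qed
    have "Ck_on k X (\<lambda>x. \<Sum>b\<in>Basis. (frechet_derivative G (at x) v \<bullet> b) *\<^sub>R
        frechet_derivative F (at (G x)) b)"
    proof (intro Ck_on_sum assms(1))
      have "Ck_on k X G" "Ck_on k X (\<lambda>x. frechet_derivative G (at x) v)"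
        using Suc.prems(1) Ck_on_SucD[OF Suc.prems(1)] by auto
      moreover have "Ck_on k Y (\<lambda>y. frechet_derivative F (at y) b)" for b
        using Suc.prems(2) by simp
      ultimately have *: "Ck_on k X (\<lambda>x. frechet_derivative G (at x) v)"
        "Ck_on k X (\<lambda>x. frechet_derivative F (at (G x)) b)" for b
        using Suc.IH[of "\<lambda>y. frechet_derivative F (at y) b"] by blast+
      show "Ck_on k X (\<lambda>x. (frechet_derivative G (at x) v \<bullet> b) *\<^sub>R
          frechet_derivative F (at (G x)) b)" for b
        by (rule Ck_on_bilinear[OF assms(1) bounded_bilinear_scaleR
              Ck_on_bilinear[OF assms(1) bounded_bilinear_inner *(1) Ck_on_const] *(2)])
    qed
    then show "Ck_on k X (\<lambda>x. ?D x v)" 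
      by (subst Ck_on_cong[OF assms(1) eq])
  qed
qed

lemma Ck_on_inverse: "Ck_on k {x::real. x \<noteq> 0} inverse"
proof (induction k)
  case 0
  then show ?case by (simp add: continuous_on_inverse)
next
  case (Suc k)
  have op: "open {x::real. x \<noteq> 0}" by (intro open_Collect_neq continuous_intros)
  show ?case
  proof (rule Ck_on_SucI[OF op])
    show "(inverse has_derivative (\<lambda>v. - (inverse x * v * inverse x))) (at x)"
      if "x \<in> {x::real. x \<noteq> 0}" for x
      using has_derivative_inverse'[of x UNIV] that by simp
    have "Ck_on k {x::real. x \<noteq> 0} (\<lambda>x. (- v) * (inverse x * inverse x))" for v
      by (intro Ck_on_bilinear[OF op bounded_bilinear_mult] Suc Ck_on_const)
    then show "Ck_on k {x::real. x \<noteq> 0} (\<lambda>x. - (inverse x * v * inverse x))" for v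
      by (simp add: mult_ac)
  qed
qed

lemma has_real_derivative_imp_has_derivative: "(f has_real_derivative c) F \<Longrightarrow> (f has_derivative (\<lambda>v. v * c)) F"
  unfolding has_field_derivative_def by (erule has_derivative_eq_rhs) (simp add: fun_eq_iff)

lemma Ck_on_sqrt: "Ck_on k {x::real. 0 < x} sqrt"
proof (induction k)
  case 0
  then show ?case by (simp add: continuous_on_real_sqrt)
next
  case (Suc k)
  have op: "open {x::real. 0 < x}" by (simp add: open_Collect_less)
  show ?case
  proof (rule Ck_on_SucI[OF op])
    show "(sqrt has_derivative (\<lambda>v. v * (inverse (sqrt x) / 2))) (at x)"
      if "x \<in> {x::real. 0 < x}" for x
      using DERIV_real_sqrt[of x] that by (intro has_real_derivative_imp_has_derivative) auto
    have "Ck_on k {x::real. 0 < x} (\<lambda>x. (v / 2) * inverse (sqrt x))" for v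
      by (intro Ck_on_bilinear[OF op bounded_bilinear_mult] Ck_on_const
           Ck_on_compose[OF op _ Suc Ck_on_inverse]) auto
    then show "Ck_on k {x::real. 0 < x} (\<lambda>x. v * (inverse (sqrt x) / 2))" for v
      by (simp add: mult_ac)
  qed
qed

lemma Ck_on_sin_cos: "Ck_on k UNIV (sin :: real \<Rightarrow> real) \<and> Ck_on k UNIV (cos :: real \<Rightarrow> real)"
proof (induction k)
  case 0
  then show ?case by (simp add: continuous_on_sin continuous_on_cos)
next
  case (Suc k)
  have "Ck_on (Suc k) UNIV (sin :: real \<Rightarrow> real)"
  proof (rule Ck_on_SucI)
    show "(sin has_derivative (\<lambda>v. v * cos x)) (at x)" for x :: real
      using DERIV_sin[of x] by (intro has_real_derivative_imp_has_derivative) auto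
    show "Ck_on k UNIV (\<lambda>x. v * cos x)" for v :: real
      using Suc by (intro Ck_on_bilinear[OF _ bounded_bilinear_mult] Ck_on_const) auto
  qed auto
  moreover have "Ck_on (Suc k) UNIV (cos :: real \<Rightarrow> real)"
  proof (rule Ck_on_SucI)
    show "(cos has_derivative (\<lambda>v. (- v) * sin x)) (at x)" for x :: real
      using has_real_derivative_imp_has_derivative[OF DERIV_cos[of x]] by simp
    show "Ck_on k UNIV (\<lambda>x. (- v) * sin x)" for v :: real
      using Suc by (intro Ck_on_bilinear[OF _ bounded_bilinear_mult] Ck_on_const) auto
  qed auto
  ultimately show ?case by blast
qed

section \<open>Calculus of infinitely differentiable maps\<close>

lemma smooth_on_subset: "smooth_on X F \<Longrightarrow> Y \<subseteq> X \<Longrightarrow> smooth_on Y F"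
  unfolding smooth_on_def using Ck_on_subset by blast

lemma smooth_on_cong:
  assumes "open X" "\<And>x. x \<in> X \<Longrightarrow> F x = G x"
  shows "smooth_on X F \<longleftrightarrow> smooth_on X G"
  unfolding smooth_on_def using Ck_on_cong[OF assms] by simp

lemma smooth_on_local:
  assumes "\<And>x. x \<in> X \<Longrightarrow> \<exists>V. open V \<and> x \<in> V \<and> smooth_on V F"
  shows "smooth_on X F"
  unfolding smooth_on_def by (metis assms smooth_on_def Ck_on_local)

lemma smooth_on_has_derivative:
  assumes "smooth_on X F" "x \<in> X"
  shows "(F has_derivative frechet_derivative F (at x)) (at x)"
  using assms Ck_on_Suc_has_derivative unfolding smooth_on_def by blast

lemma smooth_on_differentiable: "smooth_on X F \<Longrightarrow> x \<in> X \<Longrightarrow> F differentiable (at x)"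
  using smooth_on_has_derivative differentiable_def by blast

lemma smooth_on_continuous: "smooth_on X F \<Longrightarrow> continuous_on X F"
  unfolding smooth_on_def by (metis Ck_on.simps(1))

lemma smooth_on_frechet:
  "smooth_on X F \<Longrightarrow> smooth_on X (\<lambda>x. frechet_derivative F (at x) v)"
  unfolding smooth_on_def by (metis Ck_on.simps(2))

lemma smooth_on_pd: "smooth_on X F \<Longrightarrow> smooth_on X (pd i F)"
  using smooth_on_frechet[of X F "axis i 1"] unfolding pd_def[abs_def] .

lemma smooth_on_const: "smooth_on X (\<lambda>x. c)"
  by (simp add: smooth_on_def Ck_on_const)

lemma smooth_on_bounded_linear: "bounded_linear F \<Longrightarrow> open X \<Longrightarrow> smooth_on X F"
  by (simp add: smooth_on_def Ck_on_bounded_linear)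

lemma smooth_on_bilinear:
  "open X \<Longrightarrow> bounded_bilinear B \<Longrightarrow> smooth_on X F \<Longrightarrow> smooth_on X G \<Longrightarrow> smooth_on X (\<lambda>x. B (F x) (G x))"
  by (simp add: smooth_on_def Ck_on_bilinear)

lemma smooth_on_compose:
  fixes F :: "'b::euclidean_space \<Rightarrow> 'c::real_normed_vector"
  assumes "smooth_on Y F" "smooth_on X G" "open X" "G ` X \<subseteq> Y"
  shows "smooth_on X (\<lambda>x. F (G x))"
  using assms Ck_on_compose unfolding smooth_on_def by blast

lemma smooth_on_add:
  "open X \<Longrightarrow> smooth_on X F \<Longrightarrow> smooth_on X G \<Longrightarrow> smooth_on X (\<lambda>x. F x + G x)"
  by (simp add: smooth_on_def Ck_on_add)

lemma smooth_on_sum: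
  "open X \<Longrightarrow> (\<And>i. i \<in> I \<Longrightarrow> smooth_on X (F i)) \<Longrightarrow> smooth_on X (\<lambda>x. \<Sum>i\<in>I. F i x)"
  by (simp add: smooth_on_def Ck_on_sum)

lemma smooth_on_scaleR:
  "open X \<Longrightarrow> smooth_on X F \<Longrightarrow> smooth_on X G \<Longrightarrow> smooth_on X (\<lambda>x. F x *\<^sub>R G x)"
  using smooth_on_bilinear bounded_bilinear_scaleR by blast

lemma smooth_on_mult:
  fixes F :: "_ \<Rightarrow> real"
  shows "open X \<Longrightarrow> smooth_on X F \<Longrightarrow> smooth_on X G \<Longrightarrow> smooth_on X (\<lambda>x. F x * G x)"
  using smooth_on_bilinear bounded_bilinear_mult by blast

lemma smooth_on_power:
  fixes F :: "_ \<Rightarrow> real"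
  shows "open X \<Longrightarrow> smooth_on X F \<Longrightarrow> smooth_on X (\<lambda>x. F x ^ m)"
  by (induction m) (auto intro: smooth_on_const smooth_on_mult)

text \<open>A linear map is a bilinear one with the scalar 1 in the other slot; unlike
  \<open>smooth_on_compose\<close>, this route does not ask for a Euclidean intermediate
  space.\<close>

lemma smooth_on_linear_compose:
  assumes "bounded_linear L" "open X" "smooth_on X F"
  shows "smooth_on X (\<lambda>x. L (F x))"
proof -
  have "bounded_bilinear (\<lambda>(r::real) y. r *\<^sub>R L y)"
    using bounded_bilinear.comp[OF bounded_bilinear_scaleR bounded_linear_ident assms(1)] .
  from smooth_on_bilinear[OF assms(2) this smooth_on_const[of _ 1] assms(3)]
  show ?thesis by simp
qed

lemma smooth_on_minus:
  "open X \<Longrightarrow> smooth_on X F \<Longrightarrow> smooth_on X (\<lambda>x. - F x)"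
  by (rule smooth_on_linear_compose[OF bounded_linear_minus[OF bounded_linear_ident]])

lemma smooth_on_diff:
  "open X \<Longrightarrow> smooth_on X F \<Longrightarrow> smooth_on X G \<Longrightarrow> smooth_on X (\<lambda>x. F x - G x)"
  using smooth_on_add[OF _ _ smooth_on_minus, of X F G] by simp

lemma smooth_on_nth:
  "open X \<Longrightarrow> smooth_on X F \<Longrightarrow> smooth_on X (\<lambda>x. F x $ i)"
  by (rule smooth_on_linear_compose[OF bounded_linear_vec_nth])

lemma smooth_on_vec:
  fixes F :: "_ \<Rightarrow> 'n::finite \<Rightarrow> 'b::real_normed_vector"
  assumes "open X" "\<And>i. smooth_on X (\<lambda>x. F x i)"
  shows "smooth_on X (\<lambda>x. \<chi> i. F x i)"
proof -
  have bl: "bounded_linear (axis i :: 'b \<Rightarrow> 'b^'n)" for i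
  proof (rule bounded_linear_intro[of _ 1])
    show "norm (axis i x :: 'b^'n) \<le> norm x * 1" for x
    proof -
      have "L2_set (\<lambda>j. norm ((axis i x :: 'b^'n) $ j)) UNIV
          \<le> (\<Sum>j\<in>UNIV. norm ((axis i x :: 'b^'n) $ j))"
        by (intro L2_set_le_sum) auto
      also have "\<dots> = norm x"
        by (simp add: axis_def if_distrib[of norm] cong: if_cong)
      finally show ?thesis by (simp add: norm_vec_def)
    qed
  qed (auto simp: axis_def vec_eq_iff)
  have "(\<chi> i. F x i) = (\<Sum>i\<in>UNIV. axis i (F x i))" for x
    by (simp add: vec_eq_iff axis_def)
  then show ?thesis
    using smooth_on_sum[OF assms(1), of UNIV "\<lambda>i x. axis i (F x i)"]
      smooth_on_linear_compose[OF bl assms(1) assms(2)] by simp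
qed

lemma smooth_on_prod:
  fixes F :: "_ \<Rightarrow> _ \<Rightarrow> real"
  shows "open X \<Longrightarrow> (\<And>i. i \<in> I \<Longrightarrow> smooth_on X (F i)) \<Longrightarrow> smooth_on X (\<lambda>x. \<Prod>i\<in>I. F i x)"
  by (induction I rule: infinite_finite_induct) (auto intro: smooth_on_const smooth_on_mult)

lemma smooth_on_inverse:
  fixes F :: "_ \<Rightarrow> real"
  assumes "open X" "smooth_on X F" "\<And>x. x \<in> X \<Longrightarrow> F x \<noteq> 0"
  shows "smooth_on X (\<lambda>x. inverse (F x))"
proof -
  have "smooth_on {x::real. x \<noteq> 0} inverse" by (simp add: smooth_on_def Ck_on_inverse)
  then show ?thesis by (rule smooth_on_compose[OF _ assms(2,1)]) (use assms(3) in auto)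
qed

lemma smooth_on_divide:
  fixes F :: "_ \<Rightarrow> real"
  assumes "open X" "smooth_on X F" "smooth_on X G" "\<And>x. x \<in> X \<Longrightarrow> G x \<noteq> 0"
  shows "smooth_on X (\<lambda>x. F x / G x)"
  using smooth_on_mult[OF assms(1,2) smooth_on_inverse[OF assms(1,3,4)]] by (simp only: divide_inverse)

lemma smooth_on_sqrt:
  assumes "open X" "smooth_on X F" "\<And>x. x \<in> X \<Longrightarrow> 0 < F x"
  shows "smooth_on X (\<lambda>x. sqrt (F x))"
proof -
  have "smooth_on {x::real. 0 < x} sqrt" by (simp add: smooth_on_def Ck_on_sqrt)
  then show ?thesis by (rule smooth_on_compose[OF _ assms(2,1)]) (use assms(3) in auto)
qed

lemma smooth_on_sin: "open X \<Longrightarrow> smooth_on X F \<Longrightarrow> smooth_on X (\<lambda>x. sin (F x :: real))"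
  using smooth_on_compose[of UNIV sin X F] by (simp add: smooth_on_def Ck_on_sin_cos)

lemma smooth_on_cos: "open X \<Longrightarrow> smooth_on X F \<Longrightarrow> smooth_on X (\<lambda>x. cos (F x :: real))"
  using smooth_on_compose[of UNIV cos X F] by (simp add: smooth_on_def Ck_on_sin_cos)

lemma smooth_on_det:
  assumes "open X" "\<And>i j. smooth_on X (\<lambda>x. A x $ i $ j)"
  shows "smooth_on X (\<lambda>x. det (A x :: real^'n^'n))"
  unfolding det_def by (intro smooth_on_sum smooth_on_mult smooth_on_const smooth_on_prod assms)

lemma smooth_on_inner:
  "open X \<Longrightarrow> smooth_on X F \<Longrightarrow> smooth_on X G \<Longrightarrow> smooth_on X (\<lambda>x. F x \<bullet> G x)"
  using smooth_on_bilinear bounded_bilinear_inner by blast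

lemma smooth_on_ip:
  assumes "open X" "smooth_on X G" "smooth_on X F" "smooth_on X H"
  shows "smooth_on X (\<lambda>x. ip (G x) (F x) (H x))"
  unfolding ip_def matrix_vector_mult_def
  by (intro smooth_on_inner smooth_on_vec smooth_on_sum smooth_on_mult smooth_on_nth assms)

section \<open>Inverse matrices\<close>

lemma matrix_inv_mult:
  fixes A :: "real^'n^'n"
  assumes "det A \<noteq> 0"
  shows "A ** matrix_inv A = mat 1" "matrix_inv A ** A = mat 1"
proof -
  have "\<exists>A'. A ** A' = mat 1 \<and> A' ** A = mat 1"
    using assms invertible_det_nz invertible_def by blast
  then have "A ** matrix_inv A = mat 1 \<and> matrix_inv A ** A = mat 1"
    unfolding matrix_inv_def by (rule someI_ex)
  then show "A ** matrix_inv A = mat 1" "matrix_inv A ** A = mat 1" by auto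
qed

text \<open>Cramer's rule for the \<open>l\<close>-th column of the inverse. It shows each entry as
  a quotient of polynomials in the entries of \<open>A\<close>, which gives smoothness.\<close>

lemma matrix_inv_nth:
  fixes A :: "real^'n^'n"
  assumes "det A \<noteq> 0"
  shows "matrix_inv A $ k $ l =
    det (\<chi> i j. if j = k then axis l 1 $ i else A $ i $ j) / det A"
proof -
  have "A *v (matrix_inv A *v axis l 1) = axis l 1"
    by (simp add: matrix_vector_mul_assoc matrix_inv_mult[OF assms])
  then have "matrix_inv A *v axis l 1 =
      (\<chi> k. det (\<chi> i j. if j = k then axis l 1 $ i else A $ i $ j) / det A)"
    using cramer[OF assms] by blast
  then show ?thesis
    by (simp add: matrix_vector_mult_basis column_def vec_eq_iff)
qed

lemma smooth_on_matrix_inv: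
  fixes A :: "_ \<Rightarrow> real^'n^'n"
  assumes "open X" "smooth_on X A" "\<And>x. x \<in> X \<Longrightarrow> det (A x) \<noteq> 0"
  shows "smooth_on X (\<lambda>x. matrix_inv (A x) $ k $ l)"
proof -
  have "smooth_on X (\<lambda>x. (\<chi> i j. if j = k then axis l 1 $ i else A x $ i $ j) $ i $ j)" for i j
    using smooth_on_nth[OF assms(1) smooth_on_nth[OF assms(1,2)]]
    by (cases "j = k") (simp_all add: smooth_on_const)
  then have "smooth_on X (\<lambda>x. det (\<chi> i j. if j = k then axis l 1 $ i else A x $ i $ j) / det (A x))"
    by (rule smooth_on_divide[OF assms(1) smooth_on_det[OF assms(1)]
        smooth_on_det[OF assms(1) smooth_on_nth[OF assms(1) smooth_on_nth[OF assms(1,2)]]] assms(3)])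
  then show ?thesis
    by (subst smooth_on_cong[OF assms(1) matrix_inv_nth[OF assms(3)]])
qed

section \<open>Partial derivatives\<close>

lemma pd_eqI: "(F has_derivative D) (at z) \<Longrightarrow> pd i F z = D (axis i 1)"
  unfolding pd_def by (metis frechet_derivative_at)

lemma pd_has_derivative:
  fixes F :: "real^'n \<Rightarrow> 'b::real_normed_vector"
  assumes "F differentiable (at z)"
  shows "(F has_derivative (\<lambda>w. \<Sum>i\<in>UNIV. w $ i *\<^sub>R pd i F z)) (at z)"
proof -
  let ?D = "frechet_derivative F (at z)"
  have D: "(F has_derivative ?D) (at z)" using assms frechet_derivative_works by blast
  then have lin: "linear ?D" using has_derivative_linear by blast
  have "?D w = (\<Sum>i\<in>UNIV. w $ i *\<^sub>R pd i F z)" for w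
  proof -
    have "?D (\<Sum>i\<in>UNIV. w $ i *\<^sub>R axis i 1) = (\<Sum>i\<in>UNIV. w $ i *\<^sub>R ?D (axis i 1))"
      using lin by (simp add: linear_sum linear_cmul)
    moreover have "(\<Sum>i\<in>UNIV. w $ i *\<^sub>R axis i 1) = w"
      using basis_expansion[of w] by (simp add: scalar_mult_eq_scaleR)
    ultimately show ?thesis by (simp add: pd_def)
  qed
  then have "?D = (\<lambda>w. \<Sum>i\<in>UNIV. w $ i *\<^sub>R pd i F z)" by (rule ext)
  with D show ?thesis by (simp only:)
qed

lemma frechet_derivative_pd:
  fixes F :: "real^'n \<Rightarrow> 'b::real_normed_vector"
  assumes "F differentiable (at z)"
  shows "frechet_derivative F (at z) w = (\<Sum>i\<in>UNIV. w $ i *\<^sub>R pd i F z)"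
  using fun_cong[OF frechet_derivative_at[OF pd_has_derivative[OF assms]], of w] by simp

lemma pd_cong:
  assumes "open X" "z \<in> X" "\<And>y. y \<in> X \<Longrightarrow> F y = G y"
  shows "pd i F z = pd i G z"
  unfolding pd_def using frechet_derivative_cong_open[OF assms] by simp

lemma pd_const: "pd i (\<lambda>z. c) z = 0"
  by (rule pd_eqI) (rule has_derivative_const)

lemma pd_bilinear:
  assumes "bounded_bilinear B" "F differentiable (at z)" "G differentiable (at z)"
  shows "pd i (\<lambda>z. B (F z) (G z)) z = B (F z) (pd i G z) + B (pd i F z) (G z)"
  using pd_eqI[OF bounded_bilinear.FDERIV[OF assms(1)
    assms(2)[unfolded frechet_derivative_works] assms(3)[unfolded frechet_derivative_works]]]
  by (simp add: pd_def)

lemma pd_linear: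
  assumes "bounded_linear L" "F differentiable (at z)"
  shows "pd i (\<lambda>z. L (F z)) z = L (pd i F z)"
  using pd_eqI[OF bounded_linear.has_derivative[OF assms(1)
    assms(2)[unfolded frechet_derivative_works]]]
  by (simp add: pd_def)

lemma pd_add:
  assumes "F differentiable (at z)" "G differentiable (at z)"
  shows "pd i (\<lambda>z. F z + G z) z = pd i F z + pd i G z"
  using pd_eqI[OF has_derivative_add[OF 
    assms(1)[unfolded frechet_derivative_works] assms(2)[unfolded frechet_derivative_works]]]
  by (simp add: pd_def)

lemma pd_minus:
  assumes "F differentiable (at z)"
  shows "pd i (\<lambda>z. - F z) z = - pd i F z"
  by (rule pd_linear[OF bounded_linear_minus[OF bounded_linear_ident] assms])

lemma pd_diff:
  assumes "F differentiable (at z)" "G differentiable (at z)"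
  shows "pd i (\<lambda>z. F z - G z) z = pd i F z - pd i G z"
  using pd_eqI[OF has_derivative_diff[OF 
    assms(1)[unfolded frechet_derivative_works] assms(2)[unfolded frechet_derivative_works]]]
  by (simp add: pd_def)

lemma pd_sum:
  assumes "\<And>k. k \<in> K \<Longrightarrow> F k differentiable (at z)"
  shows "pd i (\<lambda>z. \<Sum>k\<in>K. F k z) z = (\<Sum>k\<in>K. pd i (F k) z)"
  using pd_eqI[OF has_derivative_sum[of K F "\<lambda>k. frechet_derivative (F k) (at z)" "at z"]]
    assms[unfolded frechet_derivative_works]
  by (simp add: pd_def)

lemmas pd_scaleR = pd_bilinear[OF bounded_bilinear_scaleR]
lemmas pd_mult = pd_bilinear[OF bounded_bilinear_mult]
lemmas pd_nth = pd_linear[OF bounded_linear_vec_nth]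

lemma pd_compose:
  fixes F :: "real^'n \<Rightarrow> 'c::real_normed_vector" and G :: "real^'m \<Rightarrow> real^'n"
  assumes "F differentiable (at (G z))" "G differentiable (at z)"
  shows "pd i (\<lambda>z. F (G z)) z = (\<Sum>k\<in>UNIV. pd i G z $ k *\<^sub>R pd k F (G z))"
proof -
  have "pd i (\<lambda>z. F (G z)) z = (\<Sum>k\<in>UNIV. frechet_derivative G (at z) (axis i 1) $ k *\<^sub>R pd k F (G z))"
    by (rule pd_eqI[OF has_derivative_compose[OF assms(2)[unfolded frechet_derivative_works]
        pd_has_derivative[OF assms(1)]]])
  then show ?thesis by (simp add: pd_def)
qed

section \<open>The scalar product \<open>ip\<close> and its derivative\<close>

lemma bounded_bilinear_ip_right: "bounded_bilinear (\<lambda>A b. (A :: real^'n^'n) *v b)"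
proof -
  have "bilinear (\<lambda>A b. (A :: real^'n^'n) *v b)"
    unfolding bilinear_def
    by (auto intro!: linearI simp: matrix_vector_right_distrib matrix_vector_mult_add_rdistrib
        matrix_vector_mult_scaleR scaleR_matrix_vector_assoc)
  then show ?thesis using bilinear_conv_bounded_bilinear by blast
qed

lemma ip_distrib: 
  "ip G (a + b) c = ip G a c + ip G b c" "ip G a (b + c) = ip G a b + ip G a c"
  "ip G (a - b) c = ip G a c - ip G b c" "ip G a (b - c) = ip G a b - ip G a c"
  "ip G (r *\<^sub>R a) c = r * ip G a c" "ip G a (r *\<^sub>R c) = r * ip G a c"
  "ip G 0 a = 0" "ip G a 0 = 0"
  by (simp_all add: ip_def inner_add_left inner_add_right inner_diff_left inner_diff_right
      matrix_vector_right_distrib matrix_vector_mult_diff_distrib matrix_vector_mult_scaleR)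

lemma ip_sum: "ip G (sum f A) c = (\<Sum>i\<in>A. ip G (f i) c)" "ip G c (sum f A) = (\<Sum>i\<in>A. ip G c (f i))"
  by (induction A rule: infinite_finite_induct) (simp_all add: ip_distrib)

lemma ip_commute: "transpose G = G \<Longrightarrow> ip G a b = ip G b a"
  unfolding ip_def by (metis dot_lmul_matrix inner_commute vector_transpose_matrix)

lemma differentiable_bilinear:
  "bounded_bilinear B \<Longrightarrow> F differentiable (at z) \<Longrightarrow> G differentiable (at z) \<Longrightarrow>
    (\<lambda>z. B (F z) (G z)) differentiable (at z)"
  unfolding differentiable_def using bounded_bilinear.FDERIV by blast

lemma pd_ip:
  assumes "A differentiable (at z)" "a differentiable (at z)" "b differentiable (at z)"
  shows "pd i (\<lambda>z. ip (A z) (a z) (b z)) z =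
    ip (pd i A z) (a z) (b z) + ip (A z) (pd i a z) (b z) + ip (A z) (a z) (pd i b z)"
  unfolding ip_def
  by (simp add: pd_bilinear[OF bounded_bilinear_inner] pd_bilinear[OF bounded_bilinear_ip_right] assms
      differentiable_bilinear[OF bounded_bilinear_ip_right] inner_add_right)

subsection \<open>Symmetry of second derivatives\<close>

lemma DERIV_pd_line:
  fixes F :: "real^'n \<Rightarrow> real"
  assumes "F differentiable (at (y + s *\<^sub>R axis i 1))"
  shows "((\<lambda>s. F (y + s *\<^sub>R axis i 1)) has_real_derivative pd i F (y + s *\<^sub>R axis i 1)) (at s)"
proof -
  have "((\<lambda>s. y + s *\<^sub>R axis i 1) has_derivative (\<lambda>t. t *\<^sub>R axis i 1)) (at s)"
    by (auto intro!: derivative_eq_intros)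
  from has_derivative_compose[OF this pd_has_derivative[OF assms]]
  have "((\<lambda>s. F (y + s *\<^sub>R axis i 1)) has_derivative
      (\<lambda>t. \<Sum>k\<in>UNIV. (t *\<^sub>R axis i 1) $ k *\<^sub>R pd k F (y + s *\<^sub>R axis i 1))) (at s)" .
  moreover have "(\<Sum>k\<in>UNIV. (t *\<^sub>R axis i 1) $ k *\<^sub>R pd k F (y + s *\<^sub>R axis i 1))
      = pd i F (y + s *\<^sub>R axis i 1) * t" for t
  proof -
    have "(\<Sum>k\<in>UNIV. (t *\<^sub>R axis i 1) $ k *\<^sub>R pd k F (y + s *\<^sub>R axis i 1))
      = (\<Sum>k\<in>UNIV. if k = i then pd k F (y + s *\<^sub>R axis i 1) * t else 0)"
      by (rule sum.cong) (auto simp: axis_def)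
    then show ?thesis by simp
  qed
  ultimately show ?thesis by (simp add: has_field_derivative_def)
qed

text \<open>The mean value theorem is used twice: on the difference of \<open>F\<close> between two
  parallel segments in direction \<open>i\<close>, then on \<open>pd i F\<close> in direction
  \<open>j\<close>.\<close>

lemma second_difference:
  fixes F :: "real^'n \<Rightarrow> real"
  assumes "smooth_on (ball z r) F" "0 < h" "2 * h < r"
  shows "\<exists>y. dist z y \<le> 2 * h \<and>
    F (z + h *\<^sub>R axis i 1 + h *\<^sub>R axis j 1) - F (z + h *\<^sub>R axis i 1)
      - (F (z + h *\<^sub>R axis j 1) - F z) = h * h * pd j (pd i F) y"
proof -
  have near: "dist z (z + s *\<^sub>R axis i 1 + t *\<^sub>R axis j 1) \<le> 2 * h"
    if "0 \<le> s" "s \<le> h" "0 \<le> t" "t \<le> h" for s t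
  proof -
    have "norm (s *\<^sub>R axis i (1::real) + t *\<^sub>R axis j 1) \<le> norm (s *\<^sub>R axis i (1::real)) + norm (t *\<^sub>R axis j (1::real))"
      by (rule norm_triangle_ineq)
    also have "\<dots> = s + t" using that by (simp add: norm_axis_1)
    also have "\<dots> \<le> 2 * h" using that by simp
    finally show ?thesis by (subst dist_commute) (simp add: dist_norm add.assoc)
  qed
  have inb: "z + s *\<^sub>R axis i 1 + t *\<^sub>R axis j 1 \<in> ball z r"
    if "0 \<le> s" "s \<le> h" "0 \<le> t" "t \<le> h" for s t
    using near[OF that] assms by (simp add: mem_ball)
  define g where "g s = F (z + h *\<^sub>R axis j 1 + s *\<^sub>R axis i 1) - F (z + s *\<^sub>R axis i 1)" for s
  define g' where "g' s = pd i F (z + h *\<^sub>R axis j 1 + s *\<^sub>R axis i 1) - pd i F (z + s *\<^sub>R axis i 1)" for s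
  have "DERIV g s :> g' s" if "0 \<le> s" "s \<le> h" for s
    unfolding g_def g'_def
  proof (intro DERIV_diff DERIV_pd_line)
    show "F differentiable (at (z + h *\<^sub>R axis j 1 + s *\<^sub>R axis i 1))"
      using smooth_on_differentiable[OF assms(1) inb[OF that, of h]] assms(2) by (simp add: add_ac)
    show "F differentiable (at (z + s *\<^sub>R axis i 1))"
      using smooth_on_differentiable[OF assms(1) inb[OF that, of 0]] assms(2) by simp
  qed
  from MVT2[OF assms(2) this] obtain s where s: "0 < s" "s < h" "g h - g 0 = h * g' s" by auto
  have "DERIV (\<lambda>t. pd i F (z + s *\<^sub>R axis i 1 + t *\<^sub>R axis j 1)) t :> pd j (pd i F) (z + s *\<^sub>R axis i 1 + t *\<^sub>R axis j 1)"
    if "0 \<le> t" "t \<le> h" for t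
    using smooth_on_differentiable[OF smooth_on_pd[OF assms(1)] inb[of s t]] s that
    by (intro DERIV_pd_line) auto
  from MVT2[OF assms(2) this] obtain t where t: "0 < t" "t < h"
    "pd i F (z + s *\<^sub>R axis i 1 + h *\<^sub>R axis j 1) - pd i F (z + s *\<^sub>R axis i 1 + 0 *\<^sub>R axis j 1)
      = h * pd j (pd i F) (z + s *\<^sub>R axis i 1 + t *\<^sub>R axis j 1)" by auto
  have "g h - g 0 = h * h * pd j (pd i F) (z + s *\<^sub>R axis i 1 + t *\<^sub>R axis j 1)"
    using s(3) t(3) unfolding g'_def by (simp add: add_ac)
  then show ?thesis
    using near[of s t] s t unfolding g_def 
    by (intro exI[of _ "z + s *\<^sub>R axis i 1 + t *\<^sub>R axis j 1"]) (simp add: add_ac)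
qed

text \<open>The second difference is symmetric in \<open>i\<close> and \<open>j\<close>, so it
  equals \<open>h * h\<close> times either mixed derivative at suitable points near
  \<open>z\<close>; continuity of both then excludes a gap.\<close>

lemma pd_pd_commute_real:
  fixes F :: "real^'n \<Rightarrow> real"
  assumes "smooth_on X F" "open X" "z \<in> X"
  shows "pd i (pd j F) z = pd j (pd i F) z"
proof (rule ccontr)
  assume ne: "pd i (pd j F) z \<noteq> pd j (pd i F) z"
  define e where "e = \<bar>pd i (pd j F) z - pd j (pd i F) z\<bar> / 2"
  have e: "e > 0" using ne unfolding e_def by auto
  obtain r where r: "r > 0" "ball z r \<subseteq> X" using assms openE by blast
  have sm: "smooth_on (ball z r) F" using smooth_on_subset[OF assms(1) r(2)] .
  have "isCont (pd i (pd j F)) z" "isCont (pd j (pd i F)) z"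
    using smooth_on_continuous[OF smooth_on_pd[OF smooth_on_pd[OF assms(1)]]] assms(2,3)
    by (auto simp: continuous_on_eq_continuous_at)
  then obtain d1 d2 where d: "d1 > 0" "d2 > 0"
    "\<And>y. dist y z < d1 \<Longrightarrow> dist (pd i (pd j F) y) (pd i (pd j F) z) < e"
    "\<And>y. dist y z < d2 \<Longrightarrow> dist (pd j (pd i F) y) (pd j (pd i F) z) < e"
    using e unfolding continuous_at_eps_delta by metis
  \<comment> \<open>A third of the least radius keeps \<open>2 * h\<close>, the distance bound of
    \<open>second_difference\<close>, below all three.\<close>
  define h where "h = min (min d1 d2) r / 3"
  have h: "h > 0" "2 * h < r" "2 * h < d1" "2 * h < d2"
    using d(1,2) r(1) unfolding h_def by auto
  obtain y where y: "dist z y \<le> 2 * h"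
    "F (z + h *\<^sub>R axis i 1 + h *\<^sub>R axis j 1) - F (z + h *\<^sub>R axis i 1)
      - (F (z + h *\<^sub>R axis j 1) - F z) = h * h * pd j (pd i F) y"
    using second_difference[OF sm h(1,2)] by blast
  obtain y' where y': "dist z y' \<le> 2 * h"
    "F (z + h *\<^sub>R axis j 1 + h *\<^sub>R axis i 1) - F (z + h *\<^sub>R axis j 1)
      - (F (z + h *\<^sub>R axis i 1) - F z) = h * h * pd i (pd j F) y'"
    using second_difference[OF sm h(1,2)] by blast
  have "z + h *\<^sub>R axis j 1 + h *\<^sub>R axis i 1 = z + h *\<^sub>R axis i 1 + h *\<^sub>R axis j (1::real)"
    by (simp add: add_ac)
  then have "h * h * pd j (pd i F) y = h * h * pd i (pd j F) y'"
    using y(2) y'(2) by (simp add: algebra_simps)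
  then have "pd j (pd i F) y = pd i (pd j F) y'" using h(1) by simp
  moreover have "\<bar>pd j (pd i F) y - pd j (pd i F) z\<bar> < e"
    using d(4)[of y] y(1) h by (simp add: dist_commute dist_real_def)
  moreover have "\<bar>pd i (pd j F) y' - pd i (pd j F) z\<bar> < e"
    using d(3)[of y'] y'(1) h by (simp add: dist_commute dist_real_def)
  ultimately show False unfolding e_def by (smt (verit) field_sum_of_halves)
qed

lemma pd_pd_commute:
  fixes F :: "real^'n \<Rightarrow> real^'m"
  assumes "smooth_on X F" "open X" "z \<in> X"
  shows "pd i (pd j F) z = pd j (pd i F) z"
proof (rule vec_eq_iff[THEN iffD2], rule allI)
  fix k
  have *: "pd i (pd j F) z $ k = pd i (pd j (\<lambda>y. F y $ k)) z" for i j
  proof -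
    have "pd i (pd j F) z $ k = pd i (\<lambda>y. pd j F y $ k) z"
      using pd_nth[OF smooth_on_differentiable[OF smooth_on_pd[OF assms(1)] assms(3)]] by metis
    also have "\<dots> = pd i (pd j (\<lambda>y. F y $ k)) z"
      by (rule pd_cong[OF assms(2,3)]) (metis pd_nth smooth_on_differentiable[OF assms(1)])
    finally show ?thesis .
  qed
  show "pd i (pd j F) z $ k = pd j (pd i F) z $ k"
    unfolding * by (rule pd_pd_commute_real[OF smooth_on_nth[OF assms(2,1)] assms(2,3)])
qed

subsection \<open>Hadamard's lemma\<close>

text \<open>Differentiation under the integral replaces \<open>P\<close> by a directional derivative
  and brings down a factor \<open>t\<close>. With the weight \<open>t ^ m\<close> carried along, the
  derivative has the same shape and the induction closes.\<close>

lemma Ck_on_moment_integral: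
  fixes P :: "real^'n \<Rightarrow> real"
  assumes "smooth_on (ball 0 R) P"
  shows "Ck_on k (ball 0 R) (\<lambda>z. integral {0..1} (\<lambda>t. t ^ m * P (t *\<^sub>R z)))"
  using assms
proof (induction k arbitrary: m P)
  have inb: "t *\<^sub>R z \<in> ball 0 R" if "z \<in> ball 0 R" "t \<in> {0..1}" for z :: "real^'n" and t :: real
  proof -
    have "\<bar>t\<bar> * norm z \<le> 1 * norm z" using that by (intro mult_right_mono) auto
    then show ?thesis using that by simp
  qed
  have cont: "continuous_on (ball 0 R \<times> {0..1}) (\<lambda>(z, t). t ^ m * P (t *\<^sub>R z))"
    if "smooth_on (ball 0 R) P" for P :: "real^'n \<Rightarrow> real" and m
    unfolding split_def
    by (intro continuous_intros continuous_on_compose2[OF smooth_on_continuous[OF that]])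
      (use inb in auto)
  {
    case 0
    then show ?case
      using integral_continuous_on_param[of "ball 0 R" 0 1 "\<lambda>z t. t ^ m * P (t *\<^sub>R z)"] cont[OF 0]
      by (simp add: box_real)
  next
    case (Suc k)
    let ?D = "\<lambda>z t v. t ^ Suc m * frechet_derivative P (at (t *\<^sub>R z)) v"
    have hd: "((\<lambda>z. t ^ m * P (t *\<^sub>R z)) has_derivative ?D z t) (at z)"
      if "z \<in> ball 0 R" "t \<in> {0..1}" for z t
    proof -
      have P: "(P has_derivative frechet_derivative P (at (t *\<^sub>R z))) (at (t *\<^sub>R z))"
        using smooth_on_has_derivative[OF Suc.prems inb[OF that]] .
      have "((\<lambda>z. t *\<^sub>R z) has_derivative (\<lambda>v. t *\<^sub>R v)) (at z)"
        by (auto intro!: derivative_eq_intros)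
      from has_derivative_mult_right[OF has_derivative_compose[OF this P], of "t ^ m"]
      have "((\<lambda>z. t ^ m * P (t *\<^sub>R z)) has_derivative
          (\<lambda>v. t ^ m * frechet_derivative P (at (t *\<^sub>R z)) (t *\<^sub>R v))) (at z)" .
      moreover have "frechet_derivative P (at (t *\<^sub>R z)) (t *\<^sub>R v) = t * frechet_derivative P (at (t *\<^sub>R z)) v" for v
        using linear_cmul[OF has_derivative_linear[OF P]] by simp
      ultimately show ?thesis by (simp add: mult_ac)
    qed
    \<comment> \<open>The Leibniz rule integrates derivatives as bounded linear functions, so the
      directional formula is packed into \<open>Blinfun\<close>; continuity is then checked one
      direction at a time.\<close>
    define fx where "fx z t = Blinfun (?D z t)" for z t
    have fx: "blinfun_apply (fx z t) = ?D z t" if "z \<in> ball 0 R" "t \<in> {0..1}" for z t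
      unfolding fx_def 
      by (rule bounded_linear_Blinfun_apply[OF has_derivative_bounded_linear[OF hd[OF that]]])
    have contD: "continuous_on (ball 0 R \<times> {0..1}) (\<lambda>(z, t). ?D z t v)" for v
      using cont[OF smooth_on_frechet[OF Suc.prems, of v], of "Suc m"] .
    have contfx: "continuous_on (ball 0 R \<times> cbox 0 1) (\<lambda>(z, t). fx z t)"
    proof (rule continuous_on_blinfun_componentwise)
      fix v :: "real^'n"
      show "continuous_on (ball 0 R \<times> cbox 0 1) (\<lambda>x. blinfun_apply (case x of (z, t) \<Rightarrow> fx z t) v)"
        by (rule continuous_on_eq[OF contD[of v, folded box_real]]) (auto simp: fx box_real)
    qed
    have slice: "continuous_on {0..1} (\<lambda>t. t ^ m * P (t *\<^sub>R z))" if "z \<in> ball 0 R" for z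
    proof -
      have "continuous_on {0..1} (Pair z)" "Pair z ` {0..1} \<subseteq> ball 0 R \<times> {0..1}"
        using that by (auto intro!: continuous_intros)
      from continuous_on_compose2[OF cont[OF Suc.prems, of m] this] show ?thesis by simp
    qed
    have slicefx: "fx z integrable_on cbox 0 1" if "z \<in> ball 0 R" for z
    proof -
      have "continuous_on (cbox 0 1) (Pair z)" "Pair z ` cbox 0 1 \<subseteq> ball 0 R \<times> cbox 0 1"
        using that by (auto intro!: continuous_intros)
      from continuous_on_compose2[OF contfx this] show ?thesis
        by (intro integrable_continuous) simp
    qed
    show ?case
    proof (rule Ck_on_SucI[OF open_ball])
      fix z :: "real^'n" assume z: "z \<in> ball 0 R"
      have "((\<lambda>z. integral (cbox 0 1) (\<lambda>t. t ^ m * P (t *\<^sub>R z))) has_derivative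
          blinfun_apply (integral (cbox 0 1) (fx z))) (at z within ball 0 R)"
      proof (rule leibniz_rule[OF _ _ contfx z convex_ball])
        fix x :: "real^'n" and t :: real assume x: "x \<in> ball 0 R" "t \<in> cbox 0 1"
        show "((\<lambda>x. t ^ m * P (t *\<^sub>R x)) has_derivative blinfun_apply (fx x t)) (at x within ball 0 R)"
          using hd[of x t] fx[of x t] x by (auto simp: box_real intro: has_derivative_at_withinI)
      next
        fix x :: "real^'n" assume x: "x \<in> ball 0 R"
        show "(\<lambda>t. t ^ m * P (t *\<^sub>R x)) integrable_on cbox 0 1"
          using slice[OF x] by (intro integrable_continuous) (simp add: box_real)
      qed
      moreover have "blinfun_apply (integral (cbox 0 1) (fx z)) = (\<lambda>v. integral {0..1} (\<lambda>t. ?D z t v))"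
      proof
        fix v
        show "blinfun_apply (integral (cbox 0 1) (fx z)) v = integral {0..1} (\<lambda>t. ?D z t v)"
          by (subst blinfun_apply_integral[OF slicefx[OF z]], unfold box_real, rule integral_cong)
            (simp add: fx[OF z])
      qed
      ultimately show "((\<lambda>z. integral {0..1} (\<lambda>t. t ^ m * P (t *\<^sub>R z))) has_derivative
          (\<lambda>v. integral {0..1} (\<lambda>t. ?D z t v))) (at z)"
        using at_within_open[OF z open_ball] by (simp add: box_real)
    next
      show "Ck_on k (ball 0 R) (\<lambda>z. integral {0..1} (\<lambda>t. ?D z t v))" for v
        using Suc.IH[OF smooth_on_frechet[OF Suc.prems, of v], of "Suc m"] .
    qed
  }
qed

text \<open>The fundamental theorem of calculus on the segment from 0 to \<open>z\<close>; the
  coefficients are the averages of the partial derivatives along it.\<close>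

lemma hadamard:
  fixes F :: "real^'n \<Rightarrow> real"
  assumes "smooth_on (ball 0 R) F" "F 0 = 0"
  obtains A where "\<And>i. smooth_on (ball 0 R) (A i)"
    "\<And>z. z \<in> ball 0 R \<Longrightarrow> F z = (\<Sum>i\<in>UNIV. z $ i * A i z)" "\<And>i. 0 < R \<Longrightarrow> A i 0 = pd i F 0"
proof
  \<comment> \<open>The factor \<open>t ^ 0\<close> brings the integrand into the form of
    \<open>Ck_on_moment_integral\<close>.\<close>
  define A where "A i z = integral {0..1} (\<lambda>t. t ^ 0 * pd i F (t *\<^sub>R z))" for i z
  show "smooth_on (ball 0 R) (A i)" for i
    unfolding smooth_on_def A_def
    by (intro allI Ck_on_moment_integral[OF smooth_on_pd[OF assms(1), of i], of _ 0])
  show "A i 0 = pd i F 0" for i by (simp add: A_def)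
  show "F z = (\<Sum>i\<in>UNIV. z $ i * A i z)" if z: "z \<in> ball 0 R" for z
  proof -
    have inb: "t *\<^sub>R z \<in> ball 0 R" if "t \<in> {0..1}" for t :: real
    proof -
      have "\<bar>t\<bar> * norm z \<le> 1 * norm z" using that by (intro mult_right_mono) auto
      then show ?thesis using z by simp
    qed
    have "((\<lambda>t. F (t *\<^sub>R z)) has_vector_derivative (\<Sum>i\<in>UNIV. z $ i * pd i F (t *\<^sub>R z))) (at t within {0..1})"
      if t: "t \<in> {0..1}" for t :: real
    proof -
      have "((\<lambda>t. t *\<^sub>R z) has_derivative (\<lambda>s. s *\<^sub>R z)) (at t)"
        by (auto intro!: derivative_eq_intros)
      from has_derivative_compose[OF this pd_has_derivative[OF smooth_on_differentiable[OF assms(1) inb[OF t]]]]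
      have "((\<lambda>t. F (t *\<^sub>R z)) has_derivative (\<lambda>s. \<Sum>i\<in>UNIV. (s *\<^sub>R z) $ i *\<^sub>R pd i F (t *\<^sub>R z))) (at t)" .
      moreover have "(\<lambda>s. \<Sum>i\<in>UNIV. (s *\<^sub>R z) $ i *\<^sub>R pd i F (t *\<^sub>R z))
          = (\<lambda>s. s *\<^sub>R (\<Sum>i\<in>UNIV. z $ i * pd i F (t *\<^sub>R z)))"
        by (simp add: fun_eq_iff sum_distrib_left mult.assoc)
      ultimately show ?thesis unfolding has_vector_derivative_def
        by (simp only: has_derivative_at_withinI)
    qed
    from fundamental_theorem_of_calculus[OF _ this]
    have "((\<lambda>t. \<Sum>i\<in>UNIV. z $ i * pd i F (t *\<^sub>R z)) has_integral F z) {0..1}"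
      using assms(2) by simp
    moreover have "((\<lambda>t. \<Sum>i\<in>UNIV. z $ i * pd i F (t *\<^sub>R z)) has_integral (\<Sum>i\<in>UNIV. z $ i * A i z)) {0..1}"
    proof (intro has_integral_sum has_integral_mult_right finite)
      show "((\<lambda>t. pd i F (t *\<^sub>R z)) has_integral A i z) {0..1}" for i
      proof -
        have "continuous_on {0..1} (\<lambda>t. pd i F (t *\<^sub>R z))"
          by (rule continuous_on_compose2[OF smooth_on_continuous[OF smooth_on_pd[OF assms(1)]]])
            (use inb in \<open>auto intro!: continuous_intros\<close>)
        then show ?thesis
          by (simp add: A_def integrable_integral integrable_continuous_interval)
      qed
    qed
    ultimately show ?thesis by (rule has_integral_unique)
  qed
qed

section \<open>Levi-Civita derivative along a map\<close>

text \<open>The connection term of \<open>covd\<close> as a vector-valued bilinear form in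
  \<open>a\<close> and \<open>b\<close>, so that linearity and symmetry can be used without
  indices.\<close>

definition Gam :: "(real^'n::finite \<Rightarrow> real^'n^'n) \<Rightarrow> real^'n \<Rightarrow> real^'n \<Rightarrow> real^'n \<Rightarrow> real^'n" where
  "Gam h y a b = (\<Sum>i\<in>UNIV. \<Sum>j\<in>UNIV. (a $ i * b $ j) *\<^sub>R (\<chi> k. christoffel h y k i j))"

lemma covd_Gam: "covd h F i X z = pd i X z + Gam h (F z) (pd i F z) (X z)"
  unfolding covd_def Gam_def by (simp add: vec_eq_iff mult_ac)

lemma Gam_add: "Gam h y (a + a') b = Gam h y a b + Gam h y a' b"
  "Gam h y a (b + b') = Gam h y a b + Gam h y a b'"
  unfolding Gam_def by (simp_all add: ring_distribs scaleR_add_left sum.distrib)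

lemma Gam_scaleR: "Gam h y (r *\<^sub>R a) b = r *\<^sub>R Gam h y a b"
  "Gam h y a (r *\<^sub>R b) = r *\<^sub>R Gam h y a b"
  unfolding Gam_def by (simp_all add: scaleR_sum_right mult_ac)

text \<open>Multiplication by \<open>h y\<close> cancels the inverse matrix in the definition and
  leaves the Christoffel symbols of the first kind.\<close>

lemma christoffel_lower:
  fixes h :: "real^'n \<Rightarrow> real^'n^'n"
  assumes "det (h y) \<noteq> 0"
  shows "(\<Sum>k\<in>UNIV. h y $ l $ k * christoffel h y k i j) =
    1/2 * (pd i (\<lambda>y. h y $ j $ l) y + pd j (\<lambda>y. h y $ i $ l) y - pd l (\<lambda>y. h y $ i $ j) y)"
proof -
  define T where "T = (\<chi> l. 1/2 * (pd i (\<lambda>y. h y $ j $ l) y + pd j (\<lambda>y. h y $ i $ l) y - pd l (\<lambda>y. h y $ i $ j) y))"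
  have c: "(\<chi> k. christoffel h y k i j) = matrix_inv (h y) *v T"
    by (simp add: christoffel_def T_def matrix_vector_mult_def vec_eq_iff sum_distrib_left mult_ac)
  have "h y *v (\<chi> k. christoffel h y k i j) = T"
    unfolding c by (simp add: matrix_vector_mul_assoc matrix_inv_mult[OF assms])
  then have "(h y *v (\<chi> k. christoffel h y k i j)) $ l = T $ l" by simp
  then show ?thesis by (simp add: T_def matrix_vector_mult_def)
qed

lemma smooth_on_christoffel:
  assumes "open Y" "smooth_on Y h" "\<And>y. y \<in> Y \<Longrightarrow> det (h y) \<noteq> 0"
  shows "smooth_on Y (\<lambda>y. christoffel h y k i j)"
  unfolding christoffel_def
  by (intro smooth_on_mult smooth_on_sum smooth_on_add smooth_on_diff smooth_on_const smooth_on_pd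
      smooth_on_nth smooth_on_matrix_inv assms)

lemma ip_matrix: "ip (\<Sum>k\<in>K. r k *\<^sub>R A k) a b = (\<Sum>k\<in>K. r k * ip (A k) a b)"
proof -
  have "(\<Sum>k\<in>K. r k *\<^sub>R A k) *v b = (\<Sum>k\<in>K. r k *\<^sub>R (A k *v b))"
    by (induction K rule: infinite_finite_induct)
      (simp_all add: matrix_vector_mult_add_rdistrib scaleR_matrix_vector_assoc)
  then show ?thesis by (simp add: ip_def inner_sum_right)
qed

lemma ip_expand: "ip A a b = (\<Sum>i\<in>UNIV. \<Sum>j\<in>UNIV. a $ i * b $ j * A $ i $ j)"
  unfolding ip_def by (simp add: inner_vec_def matrix_vector_mult_def sum_distrib_left mult_ac)

section \<open>Positive definite matrices\<close>

lemma det_nonzero_if_definite: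
  fixes A :: "real^'n^'n"
  assumes "\<And>a. a \<noteq> 0 \<Longrightarrow> 0 < ip A a a"
  shows "det A \<noteq> 0"
proof -
  have "x = 0" if "A *v x = 0" for x
    using assms[of x] that by (auto simp: ip_def)
  then show ?thesis
    using invertible_det_nz matrix_left_invertible_ker[of A] invertible_left_inverse by blast
qed

text \<open>The segment from the identity to a positive definite matrix consists of invertible matrices,
  so the determinant does not change sign along it.\<close>

lemma det_pos_if_definite:
  fixes A :: "real^'n^'n"
  assumes "\<And>a. a \<noteq> 0 \<Longrightarrow> 0 < ip A a a"
  shows "0 < det A"
proof (rule ccontr)
  assume "\<not> 0 < det A"
  define B where "B t = mat 1 + t *\<^sub>R (A - mat 1)" for t :: real
  have ipB: "ip (B t) a a = (1 - t) * (a \<bullet> a) + t * ip A a a" for t a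
    by (simp add: B_def ip_def matrix_vector_mult_add_rdistrib matrix_vector_mult_diff_rdistrib
        scaleR_matrix_vector_assoc[symmetric] inner_add_right inner_diff_right algebra_simps)
  have nz: "det (B t) \<noteq> 0" if "0 \<le> t" "t \<le> 1" for t
  proof (rule det_nonzero_if_definite)
    fix a :: "real^'n" assume a: "a \<noteq> 0"
    show "0 < ip (B t) a a"
    proof (cases "t = 0")
      case False
      then have "0 < t * ip A a a" using assms[OF a] that by simp
      moreover have "0 \<le> (1 - t) * (a \<bullet> a)" using that by simp
      ultimately show ?thesis unfolding ipB by linarith
    qed (use a in \<open>simp add: ipB\<close>)
  qed
  have "continuous_on {0..1} (\<lambda>t. det (B t))"
    unfolding det_def B_def by (intro continuous_intros) 
  then have "\<exists>t. 0 \<le> t \<and> t \<le> 1 \<and> det (B t) = 0"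
    using IVT2'[of "\<lambda>t. det (B t)" 1 0 0] \<open>\<not> 0 < det A\<close> by (auto simp: B_def)
  with nz show False by blast
qed

section \<open>Symmetry and metric compatibility of the connection\<close>

locale metric_field =
  fixes Y :: "(real^'n::finite) set" and g :: "real^'n \<Rightarrow> real^'n^'n"
  assumes open_Y: "open Y" and smooth_g: "smooth_on Y g"
    and sym_g: "y \<in> Y \<Longrightarrow> transpose (g y) = g y"
    and pos_g: "y \<in> Y \<Longrightarrow> a \<noteq> 0 \<Longrightarrow> 0 < ip (g y) a a"
begin

lemma sym_nth: "y \<in> Y \<Longrightarrow> g y $ i $ j = g y $ j $ i"
  using arg_cong[OF sym_g[of y], of "\<lambda>M. M $ j $ i"] by (simp add: transpose_def)

lemma ip_sym: "y \<in> Y \<Longrightarrow> ip (g y) a b = ip (g y) b a"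
  using ip_commute sym_g by blast

lemma det_g_pos: "y \<in> Y \<Longrightarrow> 0 < det (g y)"
  using det_pos_if_definite pos_g by blast

lemma det_g: "y \<in> Y \<Longrightarrow> det (g y) \<noteq> 0"
  using det_g_pos[of y] by simp

lemma pd_g_nth: "y \<in> Y \<Longrightarrow> pd k (\<lambda>y. g y $ i $ j) y = pd k g y $ i $ j"
  using pd_nth[OF smooth_on_differentiable[OF smooth_on_nth[OF open_Y smooth_g]]]
    pd_nth[OF smooth_on_differentiable[OF smooth_g]] by metis

lemma pd_g_sym: "y \<in> Y \<Longrightarrow> pd k g y $ i $ j = pd k g y $ j $ i"
  using pd_cong[OF open_Y, of y "\<lambda>y. g y $ i $ j" "\<lambda>y. g y $ j $ i" k] sym_nth pd_g_nth by metis

lemma christoffel_sym: "y \<in> Y \<Longrightarrow> christoffel g y k i j = christoffel g y k j i"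
  unfolding christoffel_def by (simp add: pd_g_nth pd_g_sym[of y _ i j] add_ac)

lemma Gam_sym: "y \<in> Y \<Longrightarrow> Gam g y a b = Gam g y b a"
  unfolding Gam_def by (subst sum.swap) (simp add: christoffel_sym[of y] mult_ac)

lemma ip_Gam:
  assumes "y \<in> Y"
  shows "ip (g y) (Gam g y a b) c =
    (\<Sum>i\<in>UNIV. \<Sum>j\<in>UNIV. \<Sum>l\<in>UNIV. a $ i * b $ j * c $ l *
      (1/2 * (pd i g y $ j $ l + pd j g y $ i $ l - pd l g y $ i $ j)))"
proof -
  have "ip (g y) (\<chi> k. christoffel g y k i j) c =
      (\<Sum>l\<in>UNIV. c $ l * (1/2 * (pd i g y $ j $ l + pd j g y $ i $ l - pd l g y $ i $ j)))" for i j
  proof -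
    have "ip (g y) (\<chi> k. christoffel g y k i j) c = ip (g y) c (\<chi> k. christoffel g y k i j)"
      by (rule ip_sym[OF assms])
    also have "\<dots> = (\<Sum>l\<in>UNIV. c $ l * (\<Sum>k\<in>UNIV. g y $ l $ k * christoffel g y k i j))"
      by (simp add: ip_def inner_vec_def matrix_vector_mult_def)
    finally show ?thesis
      by (simp only: christoffel_lower[of g, OF det_g[OF assms]] pd_g_nth[OF assms])
  qed
  then show ?thesis
    unfolding Gam_def by (simp add: ip_sum ip_distrib sum_distrib_left mult.assoc)
qed

text \<open>Metric compatibility. When the lowered symbols with exchanged last arguments are added,
  the derivatives of \<open>g\<close> in the directions of \<open>b\<close> and \<open>c\<close>
  cancel by symmetry of \<open>g\<close>.\<close>

lemma Gam_compat:
  assumes "y \<in> Y"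
  shows "(\<Sum>m\<in>UNIV. a $ m * ip (pd m g y) b c) =
    ip (g y) (Gam g y a b) c + ip (g y) b (Gam g y a c)"
proof -
  let ?T = "\<lambda>i j l. 1/2 * (pd i g y $ j $ l + pd j g y $ i $ l - pd l g y $ i $ j)"
  have "ip (g y) b (Gam g y a c) = (\<Sum>i\<in>UNIV. \<Sum>l\<in>UNIV. \<Sum>j\<in>UNIV. a $ i * c $ l * b $ j * ?T i l j)"
    using ip_Gam[OF assms, of a c b] ip_sym[OF assms] by metis
  also have "\<dots> = (\<Sum>i\<in>UNIV. \<Sum>j\<in>UNIV. \<Sum>l\<in>UNIV. a $ i * c $ l * b $ j * ?T i l j)"
    by (intro sum.cong refl sum.swap)
  finally have "ip (g y) (Gam g y a b) c + ip (g y) b (Gam g y a c) =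
     (\<Sum>i\<in>UNIV. \<Sum>j\<in>UNIV. \<Sum>l\<in>UNIV. a $ i * b $ j * c $ l * ?T i j l + a $ i * c $ l * b $ j * ?T i l j)"
    unfolding ip_Gam[OF assms] by (simp only: sum.distrib)
  also have "\<dots> = (\<Sum>i\<in>UNIV. \<Sum>j\<in>UNIV. \<Sum>l\<in>UNIV. a $ i * (b $ j * c $ l * pd i g y $ j $ l))"
  proof (intro sum.cong refl)
    fix i j l
    show "a $ i * b $ j * c $ l * ?T i j l + a $ i * c $ l * b $ j * ?T i l j = a $ i * (b $ j * c $ l * pd i g y $ j $ l)"
      using pd_g_sym[OF assms, of i l j] pd_g_sym[OF assms, of j l i] pd_g_sym[OF assms, of l j i]
      by (simp add: algebra_simps)
  qed
  also have "\<dots> = (\<Sum>m\<in>UNIV. a $ m * ip (pd m g y) b c)"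
    by (simp only: ip_expand sum_distrib_left)
  finally show ?thesis by simp
qed

lemma smooth_on_Gamv: "smooth_on Y (\<lambda>y. \<chi> k. christoffel g y k i j)"
  by (intro smooth_on_vec open_Y smooth_on_christoffel smooth_g det_g)

end

section \<open>Covariant derivatives of fields along a map\<close>

locale map_into_metric = metric_field Y g
  for Y :: "(real^'n::finite) set" and g +
  fixes W :: "(real^'m::finite) set" and F :: "real^'m \<Rightarrow> real^'n"
  assumes open_W: "open W" and smooth_F: "smooth_on W F" and F_into: "F ` W \<subseteq> Y"
begin

abbreviation D :: "'m \<Rightarrow> (real^'m \<Rightarrow> real^'n) \<Rightarrow> real^'m \<Rightarrow> real^'n" where
  "D \<equiv> covd g F"

abbreviation gip :: "real^'m \<Rightarrow> real^'n \<Rightarrow> real^'n \<Rightarrow> real" where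
  "gip z \<equiv> ip (g (F z))"

lemma FY: "z \<in> W \<Longrightarrow> F z \<in> Y" using F_into by blast

lemma gip_sym: "z \<in> W \<Longrightarrow> gip z a b = gip z b a" using ip_sym FY by blast

lemma smooth_gF: "smooth_on W (\<lambda>z. g (F z))"
  by (rule smooth_on_compose[OF smooth_g smooth_F open_W F_into])

lemma smooth_ip: "smooth_on W X \<Longrightarrow> smooth_on W Z \<Longrightarrow> smooth_on W (\<lambda>z. gip z (X z) (Z z))"
  by (rule smooth_on_ip[OF open_W smooth_gF])

lemma smooth_Gam:
  assumes "smooth_on W A" "smooth_on W B"
  shows "smooth_on W (\<lambda>z. Gam g (F z) (A z) (B z))"
  unfolding Gam_def
  by (intro smooth_on_sum smooth_on_scaleR smooth_on_mult smooth_on_nth open_W assms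
      smooth_on_compose[OF smooth_on_Gamv smooth_F open_W F_into])

lemma smooth_D: "smooth_on W X \<Longrightarrow> smooth_on W (D i X)"
  unfolding covd_Gam[abs_def]
  by (intro smooth_on_add smooth_Gam smooth_on_pd smooth_F open_W)

lemma smooth_pdF: "smooth_on W (pd i F)" by (rule smooth_on_pd[OF smooth_F])

text \<open>The chain rule differentiates \<open>g\<close> along \<open>F\<close>, and metric
  compatibility splits the result into the connection terms of the two arguments.\<close>

lemma pd_gip:
  assumes "smooth_on W X" "smooth_on W Z" "z \<in> W"
  shows "pd i (\<lambda>z. gip z (X z) (Z z)) z = gip z (D i X z) (Z z) + gip z (X z) (D i Z z)"
proof -
  have "pd i (\<lambda>z. g (F z)) z = (\<Sum>k\<in>UNIV. pd i F z $ k *\<^sub>R pd k g (F z))"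
    by (rule pd_compose[OF smooth_on_differentiable[OF smooth_g FY[OF assms(3)]]
        smooth_on_differentiable[OF smooth_F assms(3)]])
  then have "ip (pd i (\<lambda>z. g (F z)) z) (X z) (Z z) =
     gip z (Gam g (F z) (pd i F z) (X z)) (Z z) + gip z (X z) (Gam g (F z) (pd i F z) (Z z))"
    using Gam_compat[OF FY[OF assms(3)]] by (simp add: ip_matrix)
  then show ?thesis
    using pd_ip[OF smooth_on_differentiable[OF smooth_gF assms(3)]
        smooth_on_differentiable[OF assms(1,3)] smooth_on_differentiable[OF assms(2,3)], of i]
    by (simp add: covd_Gam ip_distrib)
qed

lemma D_torsion: "z \<in> W \<Longrightarrow> D i (pd j F) z = D j (pd i F) z"
  unfolding covd_Gam using pd_pd_commute[OF smooth_F open_W] Gam_sym FY by metis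

lemma pd_Gam:
  assumes "smooth_on W A" "smooth_on W B" "z \<in> W"
  shows "pd i (\<lambda>z. Gam g (F z) (A z) (B z)) z =
    Gam g (F z) (pd i A z) (B z) + Gam g (F z) (A z) (pd i B z) +
    (\<Sum>k\<in>UNIV. \<Sum>l\<in>UNIV. (A z $ k * B z $ l) *\<^sub>R
      (\<Sum>m\<in>UNIV. pd i F z $ m *\<^sub>R pd m (\<lambda>y. \<chi> n. christoffel g y n k l) (F z)))"
proof -
  let ?G = "\<lambda>k l y. \<chi> n. christoffel g y n k l"
  have sG: "smooth_on W (\<lambda>z. ?G k l (F z))" for k l
    by (rule smooth_on_compose[OF smooth_on_Gamv smooth_F open_W F_into])
  have sAB: "smooth_on W (\<lambda>z. A z $ k)" "smooth_on W (\<lambda>z. B z $ k)" for k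
    using assms smooth_on_nth[OF open_W] by blast+
  have sm: "smooth_on W (\<lambda>z. (A z $ k * B z $ l) *\<^sub>R ?G k l (F z))" for k l
    by (intro smooth_on_scaleR smooth_on_mult open_W sG sAB)
  note df = smooth_on_differentiable[OF _ assms(3)]
  have pG: "pd i (\<lambda>z. ?G k l (F z)) z = (\<Sum>m\<in>UNIV. pd i F z $ m *\<^sub>R pd m (?G k l) (F z))" for k l
    by (rule pd_compose[OF smooth_on_differentiable[OF smooth_on_Gamv FY[OF assms(3)]] df[OF smooth_F]])
  have pAB: "pd i (\<lambda>z. A z $ k * B z $ l) z = A z $ k * pd i B z $ l + pd i A z $ k * B z $ l" for k l
    by (simp add: pd_mult[OF df[OF sAB(1)] df[OF sAB(2)]] pd_nth[OF df[OF assms(1)]] pd_nth[OF df[OF assms(2)]])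
  have "pd i (\<lambda>z. Gam g (F z) (A z) (B z)) z =
      (\<Sum>k\<in>UNIV. \<Sum>l\<in>UNIV. pd i (\<lambda>z. (A z $ k * B z $ l) *\<^sub>R ?G k l (F z)) z)"
    unfolding Gam_def
    by (subst pd_sum, rule df[OF smooth_on_sum[OF open_W sm]], intro sum.cong refl,
        rule pd_sum, rule df[OF sm])
  also have "\<dots> = (\<Sum>k\<in>UNIV. \<Sum>l\<in>UNIV. (pd i A z $ k * B z $ l) *\<^sub>R ?G k l (F z)
      + (A z $ k * pd i B z $ l) *\<^sub>R ?G k l (F z)
      + (A z $ k * B z $ l) *\<^sub>R (\<Sum>m\<in>UNIV. pd i F z $ m *\<^sub>R pd m (?G k l) (F z)))"
    by (intro sum.cong refl)
      (simp add: pd_scaleR[OF df[OF smooth_on_mult[OF open_W sAB]] df[OF sG]] pAB pG scaleR_add_left)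
  finally show ?thesis unfolding Gam_def by (simp add: sum.distrib)
qed

text \<open>The curvature \<open>R(F\<^sub>i, F\<^sub>j)\<close> vanishes where \<open>F\<^sub>i\<close> and \<open>F\<^sub>j\<close> are linearly dependent.\<close>

lemma D_commute_if_dependent:
  assumes "smooth_on W X" "z \<in> W" "pd i F z = r *\<^sub>R pd j F z"
  shows "D i (D j X) z = D j (D i X) z"
proof -
  let ?G = "\<lambda>k l y. \<chi> n. christoffel g y n k l"
  let ?E = "\<lambda>i a b. \<Sum>k\<in>UNIV. \<Sum>l\<in>UNIV. (a $ k * b $ l) *\<^sub>R (\<Sum>m\<in>UNIV. pd i F z $ m *\<^sub>R pd m (?G k l) (F z))"
  have *: "D i (D j X) z = pd i (pd j X) z + (Gam g (F z) (pd i (pd j F) z) (X z)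
      + Gam g (F z) (pd j F z) (pd i X z) + ?E i (pd j F z) (X z))
      + (Gam g (F z) (pd i F z) (pd j X z) + Gam g (F z) (pd i F z) (Gam g (F z) (pd j F z) (X z)))" for i j
  proof -
    have "pd i (D j X) z = pd i (pd j X) z + pd i (\<lambda>z. Gam g (F z) (pd j F z) (X z)) z"
      unfolding covd_Gam[abs_def]
      by (rule pd_add[OF smooth_on_differentiable[OF smooth_on_pd[OF assms(1)] assms(2)]
          smooth_on_differentiable[OF smooth_Gam[OF smooth_pdF assms(1)] assms(2)]])
    then show ?thesis
      unfolding covd_Gam[of g F i] pd_Gam[OF smooth_pdF assms(1,2)]
      by (simp add: covd_Gam Gam_add)
  qed
  \<comment> \<open>Second derivatives commute, and the terms with first derivatives of
    \<open>X\<close> are together symmetric in \<open>i\<close> and \<open>j\<close>. Each of the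
    two remaining terms has one factor \<open>pd i F z\<close> and one factor
    \<open>pd j F z\<close>, so the scalar \<open>r\<close> can move between them.\<close>
  have E: "?E i (pd j F z) (X z) = ?E j (pd i F z) (X z)"
    unfolding assms(3) by (simp add: scaleR_sum_right mult_ac)
  have "Gam g (F z) (pd i F z) (Gam g (F z) (pd j F z) (X z)) = Gam g (F z) (pd j F z) (Gam g (F z) (pd i F z) (X z))"
    unfolding assms(3) by (simp add: Gam_scaleR)
  then show ?thesis
    unfolding *[of i j] *[of j i] E pd_pd_commute[OF assms(1) open_W assms(2), of i j]
      pd_pd_commute[OF smooth_F open_W assms(2), of i j] by simp
qed

text \<open>Christoffel symbols of the first kind of the pulled-back metric, lowered index first.
  Written through the ambient connection, they stay smooth where \<open>ff\<close>
  degenerates.\<close>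

definition first_kind :: "'m \<Rightarrow> 'm \<Rightarrow> 'm \<Rightarrow> real^'m \<Rightarrow> real" where
  "first_kind k i j z = gip z (D i (pd j F) z) (pd k F z)"

definition ff :: "real^'m \<Rightarrow> real^'m^'m" where
  "ff z = (\<chi> i j. gip z (pd i F z) (pd j F z))"

lemma smooth_ff_nth: "smooth_on W (\<lambda>z. ff z $ i $ j)"
  unfolding ff_def by (simp add: smooth_ip smooth_pdF)

lemma smooth_ff: "smooth_on W ff"
proof -
  have "smooth_on W (\<lambda>z. \<chi> i j. gip z (pd i F z) (pd j F z))"
    by (intro smooth_on_vec smooth_ip smooth_pdF open_W)
  then show ?thesis by (simp add: ff_def[abs_def])
qed

lemma first_kind_sym: "z \<in> W \<Longrightarrow> first_kind k i j z = first_kind k j i z"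
  unfolding first_kind_def using D_torsion by metis

lemma ff_sym: "z \<in> W \<Longrightarrow> ff z $ i $ j = ff z $ j $ i"
  unfolding ff_def by (simp add: gip_sym)

lemma pd_ff: "z \<in> W \<Longrightarrow> pd i (\<lambda>z. ff z $ j $ k) z = first_kind k i j z + first_kind j i k z"
  unfolding ff_def first_kind_def by (simp add: pd_gip[OF smooth_pdF smooth_pdF] gip_sym)

lemma pd_first_kind:
  "z \<in> W \<Longrightarrow> pd l (first_kind k i j) z =
    gip z (D l (D i (pd j F)) z) (pd k F z) + gip z (D i (pd j F) z) (D l (pd k F) z)"
  unfolding first_kind_def[abs_def] by (rule pd_gip[OF smooth_D[OF smooth_pdF] smooth_pdF])

text \<open>The Koszul formula: by \<open>pd_ff\<close> the three derivatives of \<open>ff\<close>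
  give six symbols, of which four cancel and two coincide by symmetry in the last two
  indices.\<close>

lemma christoffel_ff:
  assumes "z \<in> W" "det (ff z) \<noteq> 0"
  shows "(\<Sum>l\<in>UNIV. ff z $ k $ l * christoffel ff z l i j) = first_kind k i j z"
  unfolding christoffel_lower[of ff, OF assms(2)] pd_ff[OF assms(1)]
  using first_kind_sym[OF assms(1)] by simp

end

section \<open>Local frontals\<close>

lemma det_vector_3:
  "det (vector [a, b, c] :: real^3^3) =
    a$1 * b$2 * c$3 + a$2 * b$3 * c$1 + a$3 * b$1 * c$2
    - a$1 * b$3 * c$2 - a$2 * b$1 * c$3 - a$3 * b$2 * c$1"
  by (simp add: det_3 algebra_simps)

text \<open>If A has the rows \<open>a\<close>, \<open>b\<close>, \<open>c\<close>, the Gram matrix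
  is A G A^T, and determinants multiply.\<close>

lemma vol_square:
  assumes "0 \<le> det G"
  shows "(vol G a b c)\<^sup>2 = det (vector [vector [ip G a a, ip G a b, ip G a c],
    vector [ip G b a, ip G b b, ip G b c], vector [ip G c a, ip G c b, ip G c c]] :: real^3^3)"
    (is "_ = det ?R")
proof -
  let ?A = "vector [a, b, c] :: real^3^3"
  have "(?A ** G ** transpose ?A) $ i $ j = ip G (?A $ i) (?A $ j)" for i j
    unfolding ip_expand by (simp add: matrix_matrix_mult_def transpose_def sum_3 algebra_simps)
  then have "?A ** G ** transpose ?A = ?R"
    by (simp add: vec_eq_iff forall_3)
  then have "det ?R = det ?A * det G * det ?A" by (metis det_mul det_transpose)
  then show ?thesis using assms by (simp add: vol_def power_mult_distrib power2_eq_square mult_ac)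
qed

lemma orthogonal_to_basis_zero:
  assumes "vol G a b c \<noteq> 0" "ip G a x = 0" "ip G b x = 0" "ip G c x = 0"
  shows "x = 0"
proof -
  let ?A = "vector [a, b, c] :: real^3^3"
  have zero: "M *v y = 0 \<Longrightarrow> det M \<noteq> 0 \<Longrightarrow> y = 0" for M :: "real^3^3" and y
    using invertible_det_nz inj_matrix_vector_mult[of M] matrix_vector_mult_0_right[of M] 
    by (metis injD)
  have nz: "det ?A \<noteq> 0" "det G \<noteq> 0" using assms(1) by (auto simp: vol_def)
  have "?A *v (G *v x) = 0"
    using assms(2-4) unfolding ip_def
    by (simp add: vec_eq_iff forall_3 matrix_vector_mul_component)
  then show "x = 0" using zero nz by blast
qed

lemma smooth_on_vol:
  assumes "open X" "smooth_on X G" "\<And>x. x \<in> X \<Longrightarrow> 0 < det (G x)"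
    "smooth_on X a" "smooth_on X b" "smooth_on X c"
  shows "smooth_on X (\<lambda>x. vol (G x) (a x) (b x) (c x))"
  unfolding vol_def det_vector_3
  by (intro smooth_on_mult smooth_on_sqrt smooth_on_det smooth_on_nth smooth_on_add smooth_on_diff assms)

section \<open>Fundamental forms of a frontal\<close>

locale local_frontal = map_into_metric Y g W F
  for Y :: "(real^3) set" and g and W :: "(real^2) set" and F +
  fixes \<nu> :: "real^2 \<Rightarrow> real^3"
  assumes smooth_\<nu>: "smooth_on W \<nu>"
    and \<nu>_unit: "z \<in> W \<Longrightarrow> ip (g (F z)) (\<nu> z) (\<nu> z) = 1"
    and \<nu>_orth: "z \<in> W \<Longrightarrow> ip (g (F z)) (\<nu> z) (pd i F z) = 0"
begin

definition sf :: "2 \<Rightarrow> 2 \<Rightarrow> real^2 \<Rightarrow> real" where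
  "sf i j z = gip z (D i (pd j F) z) (\<nu> z)"

definition lam :: "real^2 \<Rightarrow> real" where
  "lam z = vol (g (F z)) (pd 1 F z) (pd 2 F z) (\<nu> z)"

lemma \<nu>_orth': "z \<in> W \<Longrightarrow> gip z (pd i F z) (\<nu> z) = 0"
  using \<nu>_orth gip_sym by metis

lemma smooth_sf: "smooth_on W (sf i j)"
  unfolding sf_def[abs_def] by (intro smooth_ip smooth_D smooth_pdF smooth_\<nu>)

lemma smooth_lam: "smooth_on W lam"
  unfolding lam_def[abs_def]
  by (intro smooth_on_vol open_W smooth_gF smooth_pdF smooth_\<nu> det_g_pos FY)

lemma sf_sym: "z \<in> W \<Longrightarrow> sf i j z = sf j i z"
  unfolding sf_def using D_torsion by metis

text \<open>Weingarten's formula, obtained by differentiating the orthogonality of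
  \<open>pd j F\<close> and \<nu>. It contains first derivatives of \<open>F\<close> and \<nu>
  only.\<close>

lemma sf_normal: "z \<in> W \<Longrightarrow> sf i j z = - gip z (pd j F z) (D i \<nu> z)"
proof -
  assume z: "z \<in> W"
  have "pd i (\<lambda>z. gip z (pd j F z) (\<nu> z)) z = pd i (\<lambda>z. 0) z"
    by (rule pd_cong[OF open_W z \<nu>_orth'])
  then show ?thesis
    unfolding pd_gip[OF smooth_pdF smooth_\<nu> z] sf_def pd_const by simp
qed

text \<open>The Gram matrix of F_1, F_2 and the unit normal consists of the block \<open>ff\<close>
  and a single 1.\<close>

lemma lam_square: "z \<in> W \<Longrightarrow> (lam z)\<^sup>2 = det (ff z)"
proof -
  assume z: "z \<in> W"
  have "0 \<le> det (g (F z))" using det_g_pos[OF FY[OF z]] by simp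
  from vol_square[OF this, of "pd 1 F z" "pd 2 F z" "\<nu> z"] show ?thesis
    by (simp add: lam_def ff_def \<nu>_orth[OF z] \<nu>_orth'[OF z] \<nu>_unit[OF z] det_2 det_3)
qed

text \<open>Equality in the Cauchy-Schwarz inequality: F_1 minus its projection onto F_2 has length
  zero.\<close>

lemma dependent_if_lam_zero:
  assumes "z \<in> W" "lam z = 0"
  shows "(\<exists>r. pd 1 F z = r *\<^sub>R pd 2 F z) \<or> (\<exists>r. pd 2 F z = r *\<^sub>R pd 1 F z)"
proof (cases "pd 2 F z = 0")
  case True
  then show ?thesis by (intro disjI2 exI[of _ 0]) simp
next
  case False
  define a where "a = gip z (pd 1 F z) (pd 1 F z)"
  define b where "b = gip z (pd 1 F z) (pd 2 F z)"
  define c where "c = gip z (pd 2 F z) (pd 2 F z)"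
  have c: "c > 0" unfolding c_def using pos_g[OF FY[OF assms(1)] False] .
  have "det (ff z) = 0" using lam_square[OF assms(1)] assms(2) by simp
  then have abc: "a * c = b * b"
    unfolding det_2 ff_def a_def b_def c_def using gip_sym[OF assms(1)] by simp
  let ?v = "pd 1 F z - (b / c) *\<^sub>R pd 2 F z"
  have "gip z ?v ?v = a - (b / c) * b - (b / c) * (b - (b / c) * c)"
    using gip_sym[OF assms(1), of "pd 2 F z" "pd 1 F z"]
    by (simp add: ip_distrib a_def b_def c_def)
  also have "\<dots> = 0" using c abc by (simp add: field_simps)
  finally have "?v = 0" using pos_g[OF FY[OF assms(1)], of ?v] by auto
  then show ?thesis by (intro disjI1 exI[of _ "b / c"]) simp
qed

lemma frame_decomposition:
  assumes "z \<in> W" "lam z \<noteq> 0" "\<And>k. (\<Sum>l\<in>UNIV. ff z $ k $ l * c l) = gip z X (pd k F z)"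
  shows "X = c 1 *\<^sub>R pd 1 F z + c 2 *\<^sub>R pd 2 F z + gip z X (\<nu> z) *\<^sub>R \<nu> z"
proof -
  let ?x = "X - (c 1 *\<^sub>R pd 1 F z + c 2 *\<^sub>R pd 2 F z + gip z X (\<nu> z) *\<^sub>R \<nu> z)"
  have "gip z (pd k F z) ?x = 0" for k
    using assms(3)[of k] gip_sym[OF assms(1), of X "pd k F z"]
    by (simp add: ip_distrib \<nu>_orth'[OF assms(1)] sum_2 ff_def mult_ac)
  moreover have "gip z (\<nu> z) ?x = 0"
    using gip_sym[OF assms(1), of X "\<nu> z"]
    by (simp add: ip_distrib \<nu>_orth[OF assms(1)] \<nu>_unit[OF assms(1)])
  ultimately have "?x = 0"
    using orthogonal_to_basis_zero assms(2) unfolding lam_def by blast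
  then show ?thesis by simp
qed

text \<open>The ambient curvature <R(F_1, F_2) F_2, F_1>, with R realised as the commutator of
  covariant derivatives along \<open>F\<close>.\<close>

definition amb :: "real^2 \<Rightarrow> real" where
  "amb z = gip z (D 1 (D 2 (pd 2 F)) z - D 2 (D 1 (pd 2 F)) z) (pd 1 F z)"

definition Q :: "real^2 \<Rightarrow> real" where
  "Q z = sf 1 1 z * sf 2 2 z - (sf 1 2 z)\<^sup>2 + amb z"

lemma smooth_amb: "smooth_on W amb"
  unfolding amb_def[abs_def] by (intro smooth_ip smooth_on_diff smooth_D smooth_pdF open_W)

lemma smooth_Q: "smooth_on W Q"
  unfolding Q_def[abs_def]
  by (intro smooth_on_add smooth_on_diff smooth_on_mult smooth_on_power smooth_sf smooth_amb open_W)

text \<open>The product rule trades the derivatives of the Christoffel symbols, lowered by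
  \<open>ff\<close>, for derivatives of \<open>first_kind\<close>, which contain the ambient
  commutator. The quadratic rest pairs the tangential parts of the \<open>D i (pd j F)\<close>;
  their normal parts supply the terms in \<open>sf\<close>.\<close>

lemma gauss_equation:
  assumes z: "z \<in> W" and lam: "lam z \<noteq> 0"
  shows "gauss_curvature ff z * (lam z)\<^sup>2 = Q z"
proof -
  define V where "V = {z \<in> W. lam z \<noteq> 0}"
  have "V = W \<inter> lam -` (- {0})" by (auto simp: V_def)
  then have opV: "open V"
    using continuous_open_preimage[OF smooth_on_continuous[OF smooth_lam] open_W, of "- {0}"] by auto
  have zV: "z \<in> V" using assms by (simp add: V_def)
  have detV: "det (ff y) \<noteq> 0" if "y \<in> V" for y
    using lam_square[of y] that unfolding V_def by auto
  have VW: "V \<subseteq> W" by (auto simp: V_def)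
  define c where "c l i j = (\<lambda>y. christoffel ff y l i j)" for l i j
  have sm_c: "smooth_on V (c l i j)" for l i j
    unfolding c_def by (rule smooth_on_christoffel[OF opV smooth_on_subset[OF smooth_ff VW] detV])
  have dc: "c l i j differentiable (at z)" for l i j
    by (rule smooth_on_differentiable[OF sm_c zV])
  have dff: "(\<lambda>y. ff y $ i $ j) differentiable (at z)" for i j
    by (rule smooth_on_differentiable[OF smooth_ff_nth z])
  have low: "ff y $ k $ 1 * c 1 i j y + ff y $ k $ 2 * c 2 i j y = first_kind k i j y" if "y \<in> V" for y k i j
    using christoffel_ff[of y k i j] detV[OF that] that VW unfolding c_def by (auto simp: sum_2)
  \<comment> \<open>The lowering relation may be differentiated since it holds on the whole open set
    \<open>V\<close>.\<close>
  have pdlow: "pd m (first_kind k i j) z =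
      ff z $ k $ 1 * pd m (c 1 i j) z + pd m (\<lambda>y. ff y $ k $ 1) z * c 1 i j z +
      (ff z $ k $ 2 * pd m (c 2 i j) z + pd m (\<lambda>y. ff y $ k $ 2) z * c 2 i j z)" for m k i j
  proof -
    have "pd m (first_kind k i j) z = pd m (\<lambda>y. ff y $ k $ 1 * c 1 i j y + ff y $ k $ 2 * c 2 i j y) z"
      by (rule pd_cong[OF opV zV low[symmetric]])
    also have "\<dots> = pd m (\<lambda>y. ff y $ k $ 1 * c 1 i j y) z + pd m (\<lambda>y. ff y $ k $ 2 * c 2 i j y) z"
      by (intro pd_add differentiable_bilinear[OF bounded_bilinear_mult] dff dc)
    finally show ?thesis by (simp only: pd_mult[OF dff dc])
  qed
  let ?X = "\<lambda>i j. D i (pd j F) z"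
  \<comment> \<open>Each derivative of \<open>ff\<close> produced by the product rule is a sum of
    two \<open>first_kind\<close> symbols, one of which cancels against the quadratic terms.\<close>
  have gauss: "gauss_curvature ff z * (lam z)\<^sup>2 =
      pd 1 (first_kind 1 2 2) z - pd 2 (first_kind 1 1 2) z
      - (first_kind 1 1 1 z * c 1 2 2 z + first_kind 2 1 1 z * c 2 2 2 z)
      + (first_kind 1 1 2 z * c 1 1 2 z + first_kind 2 1 2 z * c 2 1 2 z)"
  proof -
    have "gauss_curvature ff z * (lam z)\<^sup>2 =
       ff z $ 1 $ 1 * (pd 1 (c 1 2 2) z - pd 2 (c 1 1 2) z
          + (c 1 2 2 z * c 1 1 1 z - c 1 1 2 z * c 1 2 1 z + (c 2 2 2 z * c 1 1 2 z - c 2 1 2 z * c 1 2 2 z))) +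
       ff z $ 1 $ 2 * (pd 1 (c 2 2 2) z - pd 2 (c 2 1 2) z
          + (c 1 2 2 z * c 2 1 1 z - c 1 1 2 z * c 2 2 1 z + (c 2 2 2 z * c 2 1 2 z - c 2 1 2 z * c 2 2 2 z)))"
      using lam_square[OF z] detV[OF zV] ff_sym[OF z, of 2 1]
      by (simp add: gauss_curvature_def c_def sum_2)
    also have "\<dots> = pd 1 (first_kind 1 2 2) z - pd 2 (first_kind 1 1 2) z
       - (pd 1 (\<lambda>y. ff y $ 1 $ 1) z * c 1 2 2 z + pd 1 (\<lambda>y. ff y $ 1 $ 2) z * c 2 2 2 z)
       + (pd 2 (\<lambda>y. ff y $ 1 $ 1) z * c 1 1 2 z + pd 2 (\<lambda>y. ff y $ 1 $ 2) z * c 2 1 2 z)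
       + (c 1 2 2 z * (ff z $ 1 $ 1 * c 1 1 1 z + ff z $ 1 $ 2 * c 2 1 1 z)
          - c 1 1 2 z * (ff z $ 1 $ 1 * c 1 2 1 z + ff z $ 1 $ 2 * c 2 2 1 z)
          + c 2 2 2 z * (ff z $ 1 $ 1 * c 1 1 2 z + ff z $ 1 $ 2 * c 2 1 2 z)
          - c 2 1 2 z * (ff z $ 1 $ 1 * c 1 2 2 z + ff z $ 1 $ 2 * c 2 2 2 z))"
      unfolding pdlow by (simp add: algebra_simps)
    also have "\<dots> = pd 1 (first_kind 1 2 2) z - pd 2 (first_kind 1 1 2) z
      - (first_kind 1 1 1 z * c 1 2 2 z + first_kind 2 1 1 z * c 2 2 2 z)
      + (first_kind 1 1 2 z * c 1 1 2 z + first_kind 2 1 2 z * c 2 1 2 z)"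
      unfolding low[OF zV] pd_ff[OF z] first_kind_sym[OF z, of _ 2 1] by (simp add: algebra_simps)
    finally show ?thesis .
  qed
  have dec: "?X i j = c 1 i j z *\<^sub>R pd 1 F z + c 2 i j z *\<^sub>R pd 2 F z + sf i j z *\<^sub>R \<nu> z" for i j
    unfolding sf_def
    by (rule frame_decomposition[OF z lam]) (use low[OF zV] in \<open>simp add: sum_2 first_kind_def\<close>)
  \<comment> \<open>Decomposing only the second vector of the pairing is enough: its normal part
    contributes the product of the two \<open>sf\<close>.\<close>
  have tang: "first_kind 1 i j z * c 1 k l z + first_kind 2 i j z * c 2 k l z =
      gip z (?X i j) (?X k l) - sf i j z * sf k l z" for i j k l
  proof -
    have "gip z (?X i j) (?X k l) = gip z (?X i j)
        (c 1 k l z *\<^sub>R pd 1 F z + c 2 k l z *\<^sub>R pd 2 F z + sf k l z *\<^sub>R \<nu> z)"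
      by (subst dec[of k l]) (rule refl)
    then show ?thesis by (simp add: ip_distrib first_kind_def sf_def)
  qed
  have "pd 1 (first_kind 1 2 2) z - pd 2 (first_kind 1 1 2) z =
      amb z + gip z (?X 2 2) (?X 1 1) - gip z (?X 1 2) (?X 2 1)"
    unfolding pd_first_kind[OF z] amb_def by (simp add: ip_distrib)
  then show ?thesis
    unfolding gauss tang Q_def
    using gip_sym[OF z, of "?X 2 2" "?X 1 1"] D_torsion[OF z, of 2 1]
    by (simp add: power2_eq_square)
qed

text \<open>The second partial derivatives of <X, Z> commute; after expansion the products of first
  covariant derivatives are symmetric in the two directions and drop out.\<close>

lemma D_commutator_antisym:
  assumes "smooth_on W X" "smooth_on W Z" "z \<in> W"
  shows "gip z (D 1 (D 2 X) z - D 2 (D 1 X) z) (Z z) = - gip z (X z) (D 1 (D 2 Z) z - D 2 (D 1 Z) z)"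
proof -
  have *: "pd i (pd j (\<lambda>z. gip z (X z) (Z z))) z =
     gip z (D i (D j X) z) (Z z) + gip z (D j X z) (D i Z z) +
     (gip z (D i X z) (D j Z z) + gip z (X z) (D i (D j Z) z))" for i j
  proof -
    have "pd i (pd j (\<lambda>z. gip z (X z) (Z z))) z = pd i (\<lambda>z. gip z (D j X z) (Z z) + gip z (X z) (D j Z z)) z"
      by (rule pd_cong[OF open_W assms(3)]) (rule pd_gip[OF assms(1,2)])
    also have "\<dots> = pd i (\<lambda>z. gip z (D j X z) (Z z)) z + pd i (\<lambda>z. gip z (X z) (D j Z z)) z"
      by (intro pd_add smooth_on_differentiable[OF smooth_ip assms(3)] smooth_D assms)
    finally show ?thesis
      by (simp only: pd_gip[OF smooth_D[OF assms(1)] assms(2,3)] pd_gip[OF assms(1) smooth_D[OF assms(2)] assms(3)])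
  qed
  show ?thesis
    using pd_pd_commute_real[OF smooth_ip[OF assms(1,2)] open_W assms(3), of 1 2]
    unfolding * by (simp add: ip_distrib)
qed

lemma gip_jet_zero:
  assumes "smooth_on W X" "smooth_on W Z" "z \<in> W" "X z = 0" "Z z = 0"
  shows "pd i (\<lambda>z. gip z (X z) (Z z)) z = 0"
  using pd_gip[OF assms(1-3)] assms(4,5) by (simp add: ip_distrib)

text \<open>The factor r of proportionality is taken at \<open>z\<close> and kept constant nearby,
  so no smooth choice of r along the singular set enters. Two fields that vanish at \<open>z\<close>
  have a scalar product with vanishing derivative.\<close>

lemma amb_jet_zero:
  assumes z: "z \<in> W" and "lam z = 0"
  shows "amb z = 0" "pd i amb z = 0"
proof -
  let ?C = "\<lambda>X z. D 1 (D 2 X) z - D 2 (D 1 X) z"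
  have smC: "smooth_on W (?C X)" if "smooth_on W X" for X
    by (intro smooth_on_diff smooth_D open_W that)
  have sk: "gip y (?C (pd j F) y) (pd j F y) = 0" if "y \<in> W" for y j
    using D_commutator_antisym[OF smooth_pdF smooth_pdF that, of j j]
      gip_sym[OF that, of "pd j F y"] by simp
  have C0: "?C X z = 0" if "smooth_on W X" for X
  proof -
    have "D 1 (D 2 X) z = D 2 (D 1 X) z"
      using dependent_if_lam_zero[OF assms]
        D_commute_if_dependent[OF that z, of 1 _ 2] D_commute_if_dependent[OF that z, of 2 _ 1] by metis
    then show ?thesis by simp
  qed
  show "amb z = 0" unfolding amb_def C0[OF smooth_pdF] by (simp add: ip_distrib)
  show "pd i amb z = 0"
    using dependent_if_lam_zero[OF assms]
  proof (elim disjE exE)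
    fix r assume r: "pd 1 F z = r *\<^sub>R pd 2 F z"
    have sm: "smooth_on W (\<lambda>y. pd 1 F y - r *\<^sub>R pd 2 F y)"
      by (intro smooth_on_diff smooth_on_scaleR smooth_on_const smooth_pdF open_W)
    have "pd i amb z = pd i (\<lambda>y. gip y (?C (pd 2 F) y) (pd 1 F y - r *\<^sub>R pd 2 F y)) z"
      by (rule pd_cong[OF open_W z])
        (use sk[of _ 2] in \<open>simp add: amb_def ip_distrib(4) ip_distrib(6)\<close>)
    then show ?thesis
      using gip_jet_zero[OF smC[OF smooth_pdF] sm z C0[OF smooth_pdF], of i 2] r by simp
  next
    fix r assume r: "pd 2 F z = r *\<^sub>R pd 1 F z"
    have sm: "smooth_on W (\<lambda>y. r *\<^sub>R pd 1 F y - pd 2 F y)"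
      by (intro smooth_on_diff smooth_on_scaleR smooth_on_const smooth_pdF open_W)
    \<comment> \<open>With F_2 = r F_1 the roles are exchanged: antisymmetry moves the commutator
      from F_2 to F_1, and the commutator of F_1 is orthogonal to F_1.\<close>
    have "pd i amb z = pd i (\<lambda>y. gip y (?C (pd 1 F) y) (r *\<^sub>R pd 1 F y - pd 2 F y)) z"
    proof (rule pd_cong[OF open_W z])
      fix y assume y: "y \<in> W"
      show "amb y = gip y (?C (pd 1 F) y) (r *\<^sub>R pd 1 F y - pd 2 F y)"
        using sk[OF y, of 1] D_commutator_antisym[OF smooth_pdF smooth_pdF y, of 2 1]
          gip_sym[OF y, of "pd 2 F y" "?C (pd 1 F) y"]
        by (simp add: amb_def ip_distrib(4)[of _ "?C (pd 1 F) y"] ip_distrib(6))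
    qed
    then show ?thesis
      using gip_jet_zero[OF smC[OF smooth_pdF] sm z C0[OF smooth_pdF], of i 1] r by simp
  qed
qed

end

section \<open>Jets at a singular point of the second kind\<close>

lemma pd_mult_zero:
  fixes f h :: "real^'n \<Rightarrow> real"
  assumes "f differentiable (at z)" "h differentiable (at z)" "h z = 0"
  shows "pd i (\<lambda>z. f z * h z) z = f z * pd i h z"
  using pd_mult[OF assms(1,2)] assms(3) by simp

lemma pd_zero_on_axis:
  fixes \<phi> :: "real^'n \<Rightarrow> 'b::real_normed_vector" and W :: "(real^'n) set"
  assumes "open W" "0 \<in> W" "\<phi> differentiable (at 0)" "\<And>s. s *\<^sub>R axis i 1 \<in> W \<Longrightarrow> \<phi> (s *\<^sub>R axis i 1) = 0"
  shows "pd i \<phi> 0 = 0"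
proof -
  have "(\<phi> has_derivative frechet_derivative \<phi> (at 0)) (at ((0::real) *\<^sub>R axis i 1))"
    using assms(3) by (simp add: frechet_derivative_works)
  moreover have "((\<lambda>s::real. s *\<^sub>R axis i (1::real)) has_derivative (\<lambda>s. s *\<^sub>R axis i 1)) (at 0)"
    by (auto intro!: derivative_eq_intros)
  ultimately have "((\<lambda>s. \<phi> (s *\<^sub>R axis i 1)) has_derivative (\<lambda>s. frechet_derivative \<phi> (at 0) (s *\<^sub>R axis i 1))) (at (0::real))"
    using has_derivative_compose by fastforce
  moreover have "((\<lambda>s. \<phi> (s *\<^sub>R axis i 1)) has_derivative (\<lambda>s. 0)) (at (0::real))"
  proof (rule has_derivative_transform_within_open[of "\<lambda>s. 0"])
    have "continuous_on UNIV (\<lambda>s::real. s *\<^sub>R axis i (1::real) :: real^'n)" by (intro continuous_intros)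
    then show "open ((\<lambda>s::real. s *\<^sub>R axis i (1::real) :: real^'n) -` W)"
      using continuous_open_preimage[of UNIV _ W] assms(1) by fastforce
  qed (use assms(2,4) in auto)
  ultimately have "(\<lambda>s::real. frechet_derivative \<phi> (at 0) (s *\<^sub>R axis i 1)) = (\<lambda>s. 0)"
    by (rule has_derivative_unique)
  from fun_cong[OF this, of 1] show ?thesis by (simp add: pd_def)
qed

text \<open>Linearity in the first slot, written with coefficients so that the product rule applies
  when the first vector vanishes at the point.\<close>

lemma vol_first_argument: "vol G a b c = (\<Sum>k\<in>UNIV. a $ k * vol G (axis k 1) b c)"
  unfolding vol_def det_vector_3 by (simp add: sum_3 axis_def algebra_simps)

lemma gnorm_square:
  assumes "\<And>a. a \<noteq> 0 \<Longrightarrow> 0 < ip G a a"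
  shows "(gnorm G a)\<^sup>2 = ip G a a"
  using assms[of a] by (cases "a = 0") (auto simp: gnorm_def ip_distrib)

text \<open>The vector that represents \<open>vol G a b\<close> is orthogonal to \<open>a\<close>
  and \<open>b\<close>, hence equals \<open>vol G a b n\<close> times \<open>n\<close>. Its
  existence and uniqueness are proved on the way because \<open>cross_g\<close> is a definite
  description.\<close>

lemma cross_g_norm:
  assumes sym: "transpose G = G" and pos: "\<And>a. a \<noteq> 0 \<Longrightarrow> 0 < ip G a a"
    and n: "ip G n a = 0" "ip G n b = 0" "ip G n n = 1" and vol: "vol G a b n \<noteq> 0"
  shows "(gnorm G (cross_g G a b))\<^sup>2 = (vol G a b n)\<^sup>2"
proof -
  define v where "v = (\<chi> k. vol G a b (axis k 1))"
  have lin: "vol G a b c = c \<bullet> v" for c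
    unfolding v_def vol_def det_vector_3 inner_vec_def by (simp add: sum_3 axis_def algebra_simps)
  have nz: "det G \<noteq> 0" using det_nonzero_if_definite[OF pos] by blast
  have "ip G (matrix_inv G *v v) c = vol G a b c" for c
  proof -
    have "ip G (matrix_inv G *v v) c = ip G c (matrix_inv G *v v)" by (rule ip_commute[OF sym])
    also have "\<dots> = c \<bullet> v" by (simp add: ip_def matrix_vector_mul_assoc matrix_inv_mult[OF nz])
    finally show ?thesis using lin by simp
  qed
  moreover have "w = w'" if w: "\<forall>c. ip G w c = vol G a b c" "\<forall>c. ip G w' c = vol G a b c" for w w'
  proof (rule ccontr)
    assume "w \<noteq> w'"
    moreover have "ip G (w - w') (w - w') = 0" using w by (simp add: ip_distrib(3))
    ultimately show False using pos[of "w - w'"] by simp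
  qed
  ultimately have "\<exists>!w. \<forall>c. ip G w c = vol G a b c" by blast
  then have w: "ip G (cross_g G a b) c = vol G a b c" for c
    unfolding cross_g_def using theI'[of "\<lambda>w. \<forall>c. ip G w c = vol G a b c"] by blast
  let ?w = "cross_g G a b"
  have "vol G a b a = 0" "vol G a b b = 0"
    unfolding vol_def det_vector_3 by (simp_all add: algebra_simps)
  then have "ip G a ?w = 0" "ip G b ?w = 0" "ip G n ?w = vol G a b n"
    using w ip_commute[OF sym] by metis+
  moreover have "ip G a n = 0" "ip G b n = 0" using n ip_commute[OF sym] by metis+
  ultimately have "?w - vol G a b n *\<^sub>R n = 0"
    using n(3) by (intro orthogonal_to_basis_zero[OF vol]) (simp_all add: ip_distrib)
  then have "?w = vol G a b n *\<^sub>R n" by simp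
  moreover have "(gnorm G ?w)\<^sup>2 = ip G ?w ?w" by (rule gnorm_square[OF pos])
  ultimately show ?thesis by (simp add: ip_distrib n power2_eq_square)
qed

section \<open>First derivatives at the origin of adapted coordinates\<close>

locale adapted_frontal = local_frontal +
  assumes zero_W: "0 \<in> W" and F1_zero: "pd 1 F 0 = 0"
    and F2_unit: "ip (g (F 0)) (pd 2 F 0) (pd 2 F 0) = 1"
    and lam_axis: "z \<in> W \<Longrightarrow> lam z = 0 \<longleftrightarrow> z $ 2 = 0"
    and pd2_lam: "pd 2 lam 0 \<noteq> 0"
begin

lemma df0: "smooth_on W X \<Longrightarrow> X differentiable (at 0)"
  using smooth_on_differentiable zero_W by blast

lemma lam_zero: "lam 0 = 0" using lam_axis[OF zero_W] by simp

lemma pd1_lam: "pd 1 lam 0 = 0"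
  by (rule pd_zero_on_axis[OF open_W zero_W df0[OF smooth_lam]]) (simp add: lam_axis axis_def)

lemma sf_zero: "sf i 1 0 = 0" "sf 1 i 0 = 0"
  using sf_normal[OF zero_W, of i 1] sf_sym[OF zero_W, of 1 i] by (simp_all add: F1_zero ip_distrib)

lemma D_F1_zero: "D i (pd 1 F) 0 = pd i (pd 1 F) 0"
  unfolding covd_Gam using Gam_scaleR(2)[of g "F 0" "pd i F 0" 0 0] by (simp add: F1_zero)

lemma pd_sf11: "pd i (sf 1 1) 0 = - gip 0 (D i (pd 1 F) 0) (D 1 \<nu> 0)"
proof -
  have "pd i (sf 1 1) 0 = pd i (\<lambda>z. - gip z (pd 1 F z) (D 1 \<nu> z)) 0"
    by (rule pd_cong[OF open_W zero_W sf_normal])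
  also have "\<dots> = - pd i (\<lambda>z. gip z (pd 1 F z) (D 1 \<nu> z)) 0"
    by (rule pd_minus[OF df0[OF smooth_ip[OF smooth_pdF smooth_D[OF smooth_\<nu>]]]])
  finally show ?thesis
    by (simp add: pd_gip[OF smooth_pdF smooth_D[OF smooth_\<nu>] zero_W] F1_zero ip_distrib)
qed

text \<open>Along the singular axis F_1 is a multiple of F_2, which makes F_11 parallel to F_2 at 0;
  and F_2 is orthogonal to D_1 \<nu> there because \<open>sf 1 2\<close> vanishes.\<close>

lemma pd1_sf11: "pd 1 (sf 1 1) 0 = 0"
proof -
  let ?a = "\<lambda>z. ff z $ 2 $ 2" and ?b = "\<lambda>z. ff z $ 1 $ 2"
  \<comment> \<open>The proportionality of F_1 and F_2 with denominators cleared: \<open>w\<close>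
    is smooth on all of \<open>W\<close> and vanishes wherever \<open>lam\<close> does.\<close>
  define w where "w z = ?a z *\<^sub>R pd 1 F z - ?b z *\<^sub>R pd 2 F z" for z
  have sm: "smooth_on W (\<lambda>z. ?a z *\<^sub>R pd 1 F z)" "smooth_on W (\<lambda>z. ?b z *\<^sub>R pd 2 F z)"
    by (intro smooth_on_scaleR smooth_ff_nth smooth_pdF open_W)+
  have w0: "w z = 0" if "z \<in> W" "lam z = 0" for z
    using dependent_if_lam_zero[OF that]
    by (elim disjE exE) (simp_all add: w_def ff_def ip_distrib)
  have "pd 1 w 0 = 0"
  proof (rule pd_zero_on_axis[OF open_W zero_W])
    show "w differentiable (at 0)"
      unfolding w_def[abs_def] by (rule df0[OF smooth_on_diff[OF open_W sm]])
  qed (simp add: w0 lam_axis axis_def)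
  moreover have "?a 0 = 1" "?b 0 = 0" by (simp_all add: ff_def F1_zero F2_unit ip_distrib)
  ultimately have "pd 1 (pd 1 F) 0 = pd 1 ?b 0 *\<^sub>R pd 2 F 0"
    unfolding w_def[abs_def]
    by (simp add: pd_diff[OF df0[OF sm(1)] df0[OF sm(2)]] F1_zero
        pd_scaleR[OF df0[OF smooth_ff_nth] df0[OF smooth_pdF]])
  then show ?thesis
    using sf_normal[OF zero_W, of 1 2] sf_zero(2)[of 2]
    by (simp add: pd_sf11 D_F1_zero ip_distrib)
qed

lemma pd_lam: "pd i lam 0 = vol (g (F 0)) (D i (pd 1 F) 0) (pd 2 F 0) (\<nu> 0)"
proof -
  let ?m = "\<lambda>k z. vol (g (F z)) (axis k 1) (pd 2 F z) (\<nu> z)"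
  have m: "smooth_on W (?m k)" for k
    by (intro smooth_on_vol open_W smooth_gF det_g_pos FY smooth_on_const smooth_pdF smooth_\<nu>)
  have Fk: "smooth_on W (\<lambda>z. pd 1 F z $ k)" for k by (rule smooth_on_nth[OF open_W smooth_pdF])
  have "lam = (\<lambda>z. \<Sum>k\<in>UNIV. pd 1 F z $ k * ?m k z)"
    unfolding lam_def[abs_def] by (rule ext) (rule vol_first_argument)
  then have "pd i lam 0 = (\<Sum>k\<in>UNIV. pd i (\<lambda>z. pd 1 F z $ k * ?m k z) 0)"
    using pd_sum[OF df0[OF smooth_on_mult[OF open_W Fk m]]] by simp
  also have "\<dots> = (\<Sum>k\<in>UNIV. D i (pd 1 F) 0 $ k * ?m k 0)"
    by (simp add: pd_mult[OF df0[OF Fk] df0[OF m]] F1_zero D_F1_zero pd_nth[OF df0[OF smooth_pdF]])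
  finally show ?thesis using vol_first_argument by metis
qed

text \<open>Since \<open>sf 2 1\<close> vanishes at 0, F_uv is orthogonal to \<nu>, so its cross
  product with F_v has length |\<open>pd 2 lam 0\<close>|. The numerator is the derivative of
  Weingarten's formula, where F_u = 0 leaves one term.\<close>

lemma cuspidal_jet:
  "- gip 0 (D 2 (pd 1 F) 0) (D 1 \<nu> 0) / (gnorm (g (F 0)) (cross_g (g (F 0)) (D 2 (pd 1 F) 0) (pd 2 F 0)))\<^sup>2
    = pd 2 (sf 1 1) 0 / (pd 2 lam 0)\<^sup>2"
proof -
  have "gip 0 (\<nu> 0) (D 2 (pd 1 F) 0) = 0"
    using sf_zero(1)[of 2] gip_sym[OF zero_W] unfolding sf_def by metis
  note this \<nu>_orth[OF zero_W, of 2] \<nu>_unit[OF zero_W] pd2_lam[unfolded pd_lam]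
  from cross_g_norm[OF sym_g[OF FY[OF zero_W]] pos_g[OF FY[OF zero_W]] this]
  have "(gnorm (g (F 0)) (cross_g (g (F 0)) (D 2 (pd 1 F) 0) (pd 2 F 0)))\<^sup>2 = (pd 2 lam 0)\<^sup>2"
    unfolding pd_lam .
  then show ?thesis by (simp add: pd_sf11)
qed

end

section \<open>Change of coordinates\<close>

locale frontal_change = a: local_frontal Y g W F \<nu> + b: local_frontal Y g W' F' \<nu>'
  for Y g W F \<nu> W' F' \<nu>' +
  fixes \<tau> :: "real^2 \<Rightarrow> real^2"
  assumes smooth_\<tau>: "smooth_on W \<tau>" and \<tau>_into: "\<tau> ` W \<subseteq> W'"
    and F_eq: "z \<in> W \<Longrightarrow> F z = F' (\<tau> z)" and \<nu>_eq: "z \<in> W \<Longrightarrow> \<nu> z = \<nu>' (\<tau> z)"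
begin

text \<open>The first index is the direction of differentiation, the second the component of
  \<tau>.\<close>

definition J :: "2 \<Rightarrow> 2 \<Rightarrow> real^2 \<Rightarrow> real" where
  "J i k z = pd i \<tau> z $ k"

definition detJ :: "real^2 \<Rightarrow> real" where
  "detJ z = J 1 1 z * J 2 2 z - J 1 2 z * J 2 1 z"

lemma \<tau>W: "z \<in> W \<Longrightarrow> \<tau> z \<in> W'" using \<tau>_into by blast

lemma smooth_J: "smooth_on W (J i k)"
  unfolding J_def[abs_def] by (intro smooth_on_nth smooth_on_pd smooth_\<tau> a.open_W)

lemma smooth_detJ: "smooth_on W detJ"
  unfolding detJ_def[abs_def] by (intro smooth_on_diff smooth_on_mult smooth_J a.open_W)

lemma pd_compose_\<tau>:
  fixes X :: "real^2 \<Rightarrow> 'c::real_normed_vector"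
  assumes "z \<in> W" "smooth_on W' X"
  shows "pd i (\<lambda>z. X (\<tau> z)) z = J i 1 z *\<^sub>R pd 1 X (\<tau> z) + J i 2 z *\<^sub>R pd 2 X (\<tau> z)"
  using pd_compose[OF smooth_on_differentiable[OF assms(2) \<tau>W[OF assms(1)]]
      smooth_on_differentiable[OF smooth_\<tau> assms(1)]]
  by (simp add: sum_2 J_def)

lemma pdF: "z \<in> W \<Longrightarrow> pd i F z = J i 1 z *\<^sub>R pd 1 F' (\<tau> z) + J i 2 z *\<^sub>R pd 2 F' (\<tau> z)"
  by (subst pd_cong[OF a.open_W _ F_eq], assumption+) (rule pd_compose_\<tau>[OF _ b.smooth_F])

lemma D_normal: "z \<in> W \<Longrightarrow> a.D i \<nu> z = J i 1 z *\<^sub>R b.D 1 \<nu>' (\<tau> z) + J i 2 z *\<^sub>R b.D 2 \<nu>' (\<tau> z)"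
proof -
  assume z: "z \<in> W"
  have "pd i \<nu> z = J i 1 z *\<^sub>R pd 1 \<nu>' (\<tau> z) + J i 2 z *\<^sub>R pd 2 \<nu>' (\<tau> z)"
    by (subst pd_cong[OF a.open_W z \<nu>_eq], assumption) (rule pd_compose_\<tau>[OF z b.smooth_\<nu>])
  then show ?thesis
    by (simp add: covd_Gam F_eq[OF z] \<nu>_eq[OF z] pdF[OF z] Gam_add Gam_scaleR scaleR_add_right)
qed

lemma ff_change: "z \<in> W \<Longrightarrow> a.ff z $ i $ j =
    J i 1 z * J j 1 z * b.ff (\<tau> z) $ 1 $ 1 + J i 1 z * J j 2 z * b.ff (\<tau> z) $ 1 $ 2
    + (J i 2 z * J j 1 z * b.ff (\<tau> z) $ 2 $ 1 + J i 2 z * J j 2 z * b.ff (\<tau> z) $ 2 $ 2)"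
  by (simp add: a.ff_def b.ff_def pdF F_eq ip_distrib algebra_simps)

text \<open>Weingarten's formula involves only first derivatives, so no second derivatives of \<tau>
  appear.\<close>

lemma sf_change: "z \<in> W \<Longrightarrow> a.sf i j z =
    J i 1 z * J j 1 z * b.sf 1 1 (\<tau> z) + (J i 1 z * J j 2 z + J i 2 z * J j 1 z) * b.sf 1 2 (\<tau> z)
    + J i 2 z * J j 2 z * b.sf 2 2 (\<tau> z)"
proof -
  assume z: "z \<in> W"
  have "a.sf i j z = J i 1 z * J j 1 z * b.sf 1 1 (\<tau> z) + J i 1 z * J j 2 z * b.sf 1 2 (\<tau> z)
    + (J i 2 z * J j 1 z * b.sf 2 1 (\<tau> z) + J i 2 z * J j 2 z * b.sf 2 2 (\<tau> z))"
    unfolding a.sf_normal[OF z] b.sf_normal[OF \<tau>W[OF z]]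
    by (simp add: pdF[OF z] D_normal[OF z] F_eq[OF z] ip_distrib algebra_simps)
  then show ?thesis using b.sf_sym[OF \<tau>W[OF z], of 2 1] by (simp add: algebra_simps)
qed

lemma lam_change: "z \<in> W \<Longrightarrow> a.lam z = detJ z * b.lam (\<tau> z)"
  unfolding a.lam_def b.lam_def vol_def det_vector_3 detJ_def
  by (simp add: pdF F_eq \<nu>_eq algebra_simps)

lemma sf_det_change: "z \<in> W \<Longrightarrow> a.sf 1 1 z * a.sf 2 2 z - (a.sf 1 2 z)\<^sup>2 =
    (detJ z)\<^sup>2 * (b.sf 1 1 (\<tau> z) * b.sf 2 2 (\<tau> z) - (b.sf 1 2 (\<tau> z))\<^sup>2)"
  unfolding sf_change detJ_def by (simp add: power2_eq_square algebra_simps)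

lemma smooth_compose_\<tau>: "smooth_on W' X \<Longrightarrow> smooth_on W (\<lambda>z. X (\<tau> z))"
  by (rule smooth_on_compose[OF _ smooth_\<tau> a.open_W \<tau>_into])

lemma pd_lam_change:
  assumes "z \<in> W" "b.lam (\<tau> z) = 0"
  shows "pd i a.lam z = detJ z * (J i 1 z * pd 1 b.lam (\<tau> z) + J i 2 z * pd 2 b.lam (\<tau> z))"
proof -
  have "pd i a.lam z = pd i (\<lambda>z. detJ z * b.lam (\<tau> z)) z"
    by (rule pd_cong[OF a.open_W assms(1) lam_change])
  also have "\<dots> = detJ z * pd i (\<lambda>z. b.lam (\<tau> z)) z"
    using assms by (intro pd_mult_zero smooth_on_differentiable[OF smooth_detJ]
        smooth_on_differentiable[OF smooth_compose_\<tau>[OF b.smooth_lam]])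
  finally show ?thesis by (simp add: pd_compose_\<tau>[OF assms(1) b.smooth_lam])
qed

end

locale change_to_adapted = frontal_change Y g W F \<nu> W' F' \<nu>' \<tau> + b: adapted_frontal Y g W' F' \<nu>'
  for Y g W F \<nu> W' F' \<nu>' \<tau> +
  assumes zero_in_W: "0 \<in> W" and \<tau>_zero: "\<tau> 0 = 0"
begin

lemma df0: "smooth_on W X \<Longrightarrow> X differentiable (at 0)"
  using smooth_on_differentiable zero_in_W by blast

lemma a_lam_zero: "a.lam 0 = 0"
  using lam_change[OF zero_in_W] b.lam_zero by (simp add: \<tau>_zero)

lemma pd_a_lam: "pd i a.lam 0 = detJ 0 * pd 2 b.lam 0 * J i 2 0"
  using pd_lam_change[OF zero_in_W, of i] by (simp add: \<tau>_zero b.lam_zero b.pd1_lam)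

lemma pd_pullback_zero:
  fixes X :: "real^2 \<Rightarrow> real"
  assumes "smooth_on W f" "smooth_on W' X" "X 0 = 0"
  shows "pd i (\<lambda>z. f z * X (\<tau> z)) 0 = f 0 * (J i 1 0 * pd 1 X 0 + J i 2 0 * pd 2 X 0)"
proof -
  have "pd i (\<lambda>z. f z * X (\<tau> z)) 0 = f 0 * pd i (\<lambda>z. X (\<tau> z)) 0"
    using assms(3) by (intro pd_mult_zero df0 assms(1) smooth_compose_\<tau>[OF assms(2)]) (simp add: \<tau>_zero)
  then show ?thesis by (simp add: pd_compose_\<tau>[OF zero_in_W assms(2)] \<tau>_zero)
qed

definition sf_det :: "real^2 \<Rightarrow> real" where
  "sf_det z = b.sf 1 1 z * b.sf 2 2 z - (b.sf 1 2 z)\<^sup>2"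

text \<open>Both \<open>sf 1 1\<close> and \<open>sf 1 2\<close> vanish at 0: the square has no
  first-order part, and the product keeps only the derivative of \<open>sf 1 1\<close>.\<close>

lemma sf_det_jet: "smooth_on W' sf_det" "sf_det 0 = 0" "pd 1 sf_det 0 = 0"
  "pd 2 sf_det 0 = b.sf 2 2 0 * pd 2 (b.sf 1 1) 0"
proof -
  have sm: "smooth_on W' (\<lambda>z. b.sf 2 2 z * b.sf 1 1 z)" "smooth_on W' (\<lambda>z. b.sf 1 2 z * b.sf 1 2 z)"
    by (intro smooth_on_mult b.smooth_sf b.open_W)+
  have eq: "sf_det = (\<lambda>z. b.sf 2 2 z * b.sf 1 1 z - b.sf 1 2 z * b.sf 1 2 z)"
    by (simp add: fun_eq_iff sf_det_def power2_eq_square)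
  show "smooth_on W' sf_det" unfolding eq by (rule smooth_on_diff[OF b.open_W sm])
  show "sf_det 0 = 0" by (simp add: eq b.sf_zero)
  have "pd i sf_det 0 = b.sf 2 2 0 * pd i (b.sf 1 1) 0" for i
    unfolding eq
    by (simp add: pd_diff[OF b.df0[OF sm(1)] b.df0[OF sm(2)]]
        pd_mult[OF b.df0[OF b.smooth_sf] b.df0[OF b.smooth_sf]] b.sf_zero)
  then show "pd 1 sf_det 0 = 0" "pd 2 sf_det 0 = b.sf 2 2 0 * pd 2 (b.sf 1 1) 0"
    by (simp_all add: b.pd1_sf11)
qed

lemma Q_zero: "a.Q 0 = 0"
  unfolding a.Q_def sf_det_change[OF zero_in_W] \<tau>_zero
  using a.amb_jet_zero(1)[OF zero_in_W a_lam_zero] sf_det_jet(2) by (simp add: sf_det_def)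

text \<open>The ambient term is treated in the given coordinates, where its derivative vanishes; the
  determinant of the second fundamental form is pulled back from the adapted ones.\<close>

lemma pd_Q: "pd i a.Q 0 = (detJ 0)\<^sup>2 * (b.sf 2 2 0 * pd 2 (b.sf 1 1) 0) * J i 2 0"
proof -
  have sm: "smooth_on W (\<lambda>z. (detJ z)\<^sup>2)" by (intro smooth_on_power smooth_detJ a.open_W)
  have sm2: "smooth_on W (\<lambda>z. (detJ z)\<^sup>2 * sf_det (\<tau> z))"
    by (intro smooth_on_mult sm smooth_compose_\<tau> sf_det_jet a.open_W)
  have "pd i a.Q 0 = pd i (\<lambda>z. (detJ z)\<^sup>2 * sf_det (\<tau> z) + a.amb z) 0"
    by (rule pd_cong[OF a.open_W zero_in_W]) (simp add: a.Q_def sf_det_change sf_det_def)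
  also have "\<dots> = pd i (\<lambda>z. (detJ z)\<^sup>2 * sf_det (\<tau> z)) 0 + pd i a.amb 0"
    by (rule pd_add[OF df0[OF sm2] df0[OF a.smooth_amb]])
  finally show ?thesis
    by (simp add: pd_pullback_zero[OF sm sf_det_jet(1,2)] sf_det_jet
        a.amb_jet_zero(2)[OF zero_in_W a_lam_zero])
qed

text \<open>F_y = 0 says that \<tau> sends the y-direction to the u-direction, so
  \<open>J 2 2 0 = 0\<close> and \<open>J 1 2 0\<close> is nonzero. Numerator and denominator both
  carry its square.\<close>

lemma limiting_curvature_jet:
  assumes "pd 2 F 0 = 0" "detJ 0 \<noteq> 0"
  shows "a.gip 0 (a.D 1 (pd 1 F) 0) (\<nu> 0) / (gnorm (g (F 0)) (pd 1 F 0))\<^sup>2 = b.sf 2 2 0"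
proof -
  have "J 2 2 0 *\<^sub>R pd 2 F' 0 = 0"
    using assms(1) pdF[OF zero_in_W, of 2] by (simp add: \<tau>_zero b.F1_zero)
  moreover have "pd 2 F' 0 \<noteq> 0" using b.F2_unit by (auto simp: ip_distrib)
  ultimately have "J 2 2 0 = 0" by simp
  then have J12: "J 1 2 0 \<noteq> 0" using assms(2) by (auto simp: detJ_def)
  have "a.gip 0 (a.D 1 (pd 1 F) 0) (\<nu> 0) = (J 1 2 0)\<^sup>2 * b.sf 2 2 0"
    using sf_change[OF zero_in_W, of 1 1] by (simp add: a.sf_def \<tau>_zero b.sf_zero power2_eq_square)
  moreover have "(gnorm (g (F 0)) (pd 1 F 0))\<^sup>2 = a.gip 0 (pd 1 F 0) (pd 1 F 0)"
    by (rule gnorm_square[OF a.pos_g[OF a.FY[OF zero_in_W]]])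
  moreover have "a.gip 0 (pd 1 F 0) (pd 1 F 0) = (J 1 2 0)\<^sup>2"
    unfolding pdF[OF zero_in_W]
    by (simp add: \<tau>_zero b.F1_zero F_eq[OF zero_in_W] ip_distrib b.F2_unit power2_eq_square)
  ultimately show ?thesis using J12 by simp
qed

text \<open>F_u = 0 in both systems forces \<open>J 1 2 0 = 0\<close>, and |F_v| = 1 forces
  \<open>J 2 2 0\<close> to be 1 or -1. Then the derivative of \<open>sf 1 1\<close> scales by (J 1
  1)^2 J 2 2 and that of \<open>lam\<close> by J 1 1.\<close>

lemma adapted_change:
  assumes "adapted_frontal Y g W F \<nu>"
  shows "(J 2 2 0)\<^sup>2 = 1"
    "pd 2 (a.sf 1 1) 0 / (pd 2 a.lam 0)\<^sup>2 = J 2 2 0 * (pd 2 (b.sf 1 1) 0 / (pd 2 b.lam 0)\<^sup>2)"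
proof -
  interpret A: adapted_frontal Y g W F \<nu> by fact
  have F2: "pd 2 F' 0 \<noteq> 0" using b.F2_unit by (auto simp: ip_distrib)
  have "J 1 2 0 *\<^sub>R pd 2 F' 0 = 0"
    using A.F1_zero pdF[OF zero_in_W, of 1] by (simp add: \<tau>_zero b.F1_zero)
  with F2 have J12: "J 1 2 0 = 0" by simp
  show J22: "(J 2 2 0)\<^sup>2 = 1"
    using A.F2_unit unfolding pdF[OF zero_in_W]
    by (simp add: \<tau>_zero b.F1_zero F_eq[OF zero_in_W] ip_distrib b.F2_unit power2_eq_square)
  \<comment> \<open>The coefficients of \<open>sf_change\<close>. At 0 both \<open>?f2\<close> and
    \<open>?f3\<close> vanish; the former multiplies \<open>sf 1 2\<close>, which vanishes too, and
    the latter is a square, so neither contributes to the derivative.\<close>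
  let ?f1 = "\<lambda>z. J 1 1 z * J 1 1 z" and ?f2 = "\<lambda>z. J 1 1 z * J 1 2 z + J 1 2 z * J 1 1 z"
    and ?f3 = "\<lambda>z. J 1 2 z * J 1 2 z"
  have sm: "smooth_on W ?f1" "smooth_on W ?f2" "smooth_on W ?f3"
    by (intro smooth_on_add smooth_on_mult smooth_J a.open_W)+
  have sb: "smooth_on W (\<lambda>z. b.sf i j (\<tau> z))" for i j by (rule smooth_compose_\<tau>[OF b.smooth_sf])
  note smp = smooth_on_mult[OF a.open_W sm(1) sb] smooth_on_mult[OF a.open_W sm(2) sb]
    smooth_on_mult[OF a.open_W sm(3) sb]
  have "pd 2 (a.sf 1 1) 0 = pd 2 (\<lambda>z. ?f1 z * b.sf 1 1 (\<tau> z) + ?f2 z * b.sf 1 2 (\<tau> z) + ?f3 z * b.sf 2 2 (\<tau> z)) 0"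
    by (rule pd_cong[OF a.open_W zero_in_W sf_change])
  also have "\<dots> = pd 2 (\<lambda>z. ?f1 z * b.sf 1 1 (\<tau> z)) 0 + pd 2 (\<lambda>z. ?f2 z * b.sf 1 2 (\<tau> z)) 0
      + pd 2 (\<lambda>z. ?f3 z * b.sf 2 2 (\<tau> z)) 0"
    by (simp only: pd_add[OF df0[OF smooth_on_add[OF a.open_W smp(1,2)]] df0[OF smp(3)]]
        pd_add[OF df0[OF smp(1)] df0[OF smp(2)]])
  also have "pd 2 (\<lambda>z. ?f3 z * b.sf 2 2 (\<tau> z)) 0 = 0"
    by (simp add: pd_mult[OF df0[OF sm(3)] df0[OF sb]] pd_mult[OF df0[OF smooth_J] df0[OF smooth_J]] J12)
  finally have "pd 2 (a.sf 1 1) 0 = (J 1 1 0)\<^sup>2 * J 2 2 0 * pd 2 (b.sf 1 1) 0"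
    unfolding pd_pullback_zero[OF sm(1) b.smooth_sf b.sf_zero(1)]
      pd_pullback_zero[OF sm(2) b.smooth_sf b.sf_zero(2)]
    by (simp add: b.pd1_sf11 J12 power2_eq_square)
  moreover have "pd 2 a.lam 0 = J 1 1 0 * pd 2 b.lam 0"
    using J22 by (simp add: pd_a_lam detJ_def J12 power2_eq_square)
  ultimately show "pd 2 (a.sf 1 1) 0 / (pd 2 a.lam 0)\<^sup>2 = J 2 2 0 * (pd 2 (b.sf 1 1) 0 / (pd 2 b.lam 0)\<^sup>2)"
    using A.pd2_lam by (simp add: power_mult_distrib)
qed

end

section \<open>Isometric frontals\<close>

lemma gauss_curvature_cong:
  assumes "open V" "z \<in> V" "\<And>y. y \<in> V \<Longrightarrow> h y = h' y"
  shows "gauss_curvature h z = gauss_curvature h' z"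
proof -
  have "pd i (\<lambda>y. h y $ j $ k) y = pd i (\<lambda>y. h' y $ j $ k) y" if "y \<in> V" for i j k y
    by (rule pd_cong[OF assms(1) that]) (simp add: assms(3))
  then have c: "christoffel h y k i j = christoffel h' y k i j" if "y \<in> V" for y k i j
    using that by (simp add: christoffel_def assms(3))
  have "pd m (\<lambda>y. christoffel h y k i j) z = pd m (\<lambda>y. christoffel h' y k i j) z" for m k i j
    by (rule pd_cong[OF assms(1,2) c])
  then show ?thesis
    using assms(2,3) by (simp add: gauss_curvature_def c)
qed

text \<open>Division by s^2 on the axis and the limit s -> 0 compare the squared derivatives,
  whatever the signs of \<phi> and \<psi> at each point.\<close>

lemma pd_square_eq:
  fixes \<phi> \<psi> :: "real^'n \<Rightarrow> real"
  assumes "open W" "0 \<in> W" "\<phi> differentiable (at 0)" "\<psi> differentiable (at 0)" "\<phi> 0 = 0" "\<psi> 0 = 0"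
    and eq: "\<And>z. z \<in> W \<Longrightarrow> (\<phi> z)\<^sup>2 = (\<psi> z)\<^sup>2"
  shows "(pd i \<phi> 0)\<^sup>2 = (pd i \<psi> 0)\<^sup>2"
proof -
  have lim: "((\<lambda>s. (f (s *\<^sub>R axis i 1) / s)\<^sup>2) \<longlongrightarrow> (pd i f 0)\<^sup>2) (at 0)"
    if "f differentiable (at 0)" "f 0 = 0" for f :: "real^'n \<Rightarrow> real"
    using DERIV_pd_line[of f 0 0 i] that
    by (intro tendsto_power) (simp add: has_field_derivative_iff)
  have "eventually (\<lambda>s::real. s *\<^sub>R axis i 1 \<in> W) (at 0)"
  proof -
    have "((\<lambda>s::real. s *\<^sub>R axis i (1::real)) \<longlongrightarrow> 0 *\<^sub>R axis i 1) (at 0)"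
      by (intro tendsto_intros)
    then show ?thesis using assms(1,2) topological_tendstoD by fastforce
  qed
  then have "eventually (\<lambda>s. (\<phi> (s *\<^sub>R axis i 1) / s)\<^sup>2 = (\<psi> (s *\<^sub>R axis i 1) / s)\<^sup>2) (at (0::real))"
    by eventually_elim (simp add: power_divide eq)
  from tendsto_cong[OF this] lim[OF assms(3,5)] lim[OF assms(4,6)]
  show ?thesis using tendsto_unique[OF at_neq_bot] by blast
qed

context adapted_frontal
begin

text \<open>The identity is a change to adapted coordinates whose Jacobian is the unit
  matrix.\<close>

lemma Q_jet: "Q 0 = 0" "pd 2 Q 0 = sf 2 2 0 * pd 2 (sf 1 1) 0"
proof -
  interpret I: change_to_adapted Y g W F \<nu> W F \<nu> "\<lambda>z. z"
    by unfold_locales (auto intro: smooth_on_bounded_linear bounded_linear_ident open_W zero_W)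
  have "pd i (\<lambda>z. z) (0::real^2) = axis i 1" for i
    by (rule pd_eqI) (rule has_derivative_ident)
  then have J: "I.J i k 0 = axis i 1 $ k" for i k by (simp add: I.J_def)
  show "Q 0 = 0" by (rule I.Q_zero)
  show "pd 2 Q 0 = sf 2 2 0 * pd 2 (sf 1 1) 0"
    using I.pd_Q[of 2] by (simp add: I.detJ_def J axis_def)
qed

end

text \<open>Adaptedness is assumed for the first frontal; for the second it is derived from the
  common first fundamental form.\<close>

locale isometric_frontals = a: adapted_frontal Y g W F \<nu> + b: local_frontal Y' g' W F' \<nu>'
  for Y g W F \<nu> Y' g' F' \<nu>' +
  assumes ff_eq: "z \<in> W \<Longrightarrow> a.ff z = b.ff z"
begin

lemma lam_square_eq: "z \<in> W \<Longrightarrow> (a.lam z)\<^sup>2 = (b.lam z)\<^sup>2"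
  by (simp add: a.lam_square b.lam_square ff_eq)

lemma pd_lam_square_eq: "(pd 2 a.lam 0)\<^sup>2 = (pd 2 b.lam 0)\<^sup>2"
  using lam_square_eq[OF a.zero_W] a.lam_zero
  by (intro pd_square_eq[OF a.open_W a.zero_W _ _ _ _ lam_square_eq]
      smooth_on_differentiable[OF a.smooth_lam] smooth_on_differentiable[OF b.smooth_lam] a.zero_W) auto

lemma adapted: "adapted_frontal Y' g' W F' \<nu>'"
proof
  have ff0: "a.gip 0 (pd i F 0) (pd j F 0) = b.gip 0 (pd i F' 0) (pd j F' 0)" for i j
    using arg_cong[OF ff_eq[OF a.zero_W], of "\<lambda>M. M $ i $ j"] by (simp add: a.ff_def b.ff_def)
  show "0 \<in> W" by (rule a.zero_W)
  have "b.gip 0 (pd 1 F' 0) (pd 1 F' 0) = 0"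
    using ff0[of 1 1] by (simp add: a.F1_zero ip_distrib)
  then show "pd 1 F' 0 = 0"
    using b.pos_g[OF b.FY[OF a.zero_W], of "pd 1 F' 0"] by auto
  show "b.gip 0 (pd 2 F' 0) (pd 2 F' 0) = 1" using ff0[of 2 2] a.F2_unit by simp
  show "b.lam z = 0 \<longleftrightarrow> z $ 2 = 0" if "z \<in> W" for z
    using lam_square_eq[OF that] a.lam_axis[OF that] by auto
  show "pd 2 b.lam 0 \<noteq> 0" using pd_lam_square_eq a.pd2_lam by auto
qed

sublocale b: adapted_frontal Y' g' W F' \<nu>' by (rule adapted)

text \<open>The Gauss equation identifies the two functions Q off the singular axis. On the line in
  direction v this covers every point but 0, where both are zero, so the v-derivatives
  agree.\<close>

lemma product_eq:
  "b.sf 2 2 0 * (pd 2 (b.sf 1 1) 0 / (pd 2 b.lam 0)\<^sup>2) = a.sf 2 2 0 * (pd 2 (a.sf 1 1) 0 / (pd 2 a.lam 0)\<^sup>2)"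
proof -
  have eq: "a.Q z = b.Q z" if "z \<in> W" "z $ 2 \<noteq> 0" for z
    using a.gauss_equation[OF that(1)] b.gauss_equation[OF that(1)] that lam_square_eq[OF that(1)]
      a.lam_axis b.lam_axis gauss_curvature_cong[OF a.open_W that(1) ff_eq] by simp
  have "pd 2 (\<lambda>z. a.Q z - b.Q z) 0 = 0"
  proof (rule pd_zero_on_axis[OF a.open_W a.zero_W])
    show "(\<lambda>z. a.Q z - b.Q z) differentiable (at 0)"
      by (rule a.df0[OF smooth_on_diff[OF a.open_W a.smooth_Q b.smooth_Q]])
    show "a.Q (s *\<^sub>R axis 2 1) - b.Q (s *\<^sub>R axis 2 1) = 0" if "s *\<^sub>R axis 2 1 \<in> W" for s
      using eq[OF that] a.Q_jet(1) b.Q_jet(1) by (cases "s = 0") (auto simp: axis_def)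
  qed
  then have "pd 2 a.Q 0 = pd 2 b.Q 0"
    by (simp add: pd_diff[OF a.df0[OF a.smooth_Q] a.df0[OF b.smooth_Q]])
  then show ?thesis
    using a.Q_jet(2) b.Q_jet(2) pd_lam_square_eq by simp
qed

end

section \<open>Rational boundedness\<close>

lemma minus_one_powi: "(-1 :: real) powi k = (if even k then 1 else -1)"
  by (simp add: power_int_minus_left)

lemma cos_shift_pi: "cos (\<theta> + of_int k * pi) = (-1) powi k * cos \<theta>"
  and sin_shift_pi: "sin (\<theta> + of_int k * pi) = (-1) powi k * sin \<theta>"
  using cos_npi_int[of k] sin_npi_int[of k]
  by (simp_all add: cos_add sin_add mult.commute[of pi] minus_one_powi)

lemma blowup_proj_self: "w \<in> blowup_proj w"
  unfolding blowup_proj_def by (auto intro!: exI[of _ 0] simp: prod_eq_iff)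

lemma blowup_proj_eqE:
  assumes "blowup_proj w = blowup_proj w'"
  obtains k :: int where "w' = ((-1) powi k * fst w, snd w + of_int k * pi)"
  using blowup_proj_self[of w'] assms unfolding blowup_proj_def by blast

lemma blowup_proj_shift: "blowup_proj ((-1) powi k * r, \<theta> + of_int k * pi) = blowup_proj (r, \<theta>)"
proof (intro equalityI subsetI)
  fix w assume "w \<in> blowup_proj ((-1) powi k * r, \<theta> + of_int k * pi)"
  then obtain m :: int where "w = ((-1) powi m * ((-1) powi k * r), \<theta> + of_int k * pi + of_int m * pi)"
    by (auto simp: blowup_proj_def)
  then show "w \<in> blowup_proj (r, \<theta>)"
    unfolding blowup_proj_def by (auto intro!: exI[of _ "m + k"] simp: minus_one_powi algebra_simps)
next
  fix w assume "w \<in> blowup_proj (r, \<theta>)"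
  then obtain m :: int where "w = ((-1) powi m * r, \<theta> + of_int m * pi)"
    by (auto simp: blowup_proj_def)
  then show "w \<in> blowup_proj ((-1) powi k * r, \<theta> + of_int k * pi)"
    unfolding blowup_proj_def by (auto intro!: exI[of _ "m - k"] simp: minus_one_powi algebra_simps)
qed

lemma polar_nth [simp]: "polar w $ 1 = fst w * cos (snd w)" "polar w $ 2 = fst w * sin (snd w)"
  by (simp_all add: polar_def)

lemma norm_polar [simp]: "norm (polar w) = \<bar>fst w\<bar>"
proof -
  have "(fst w * cos (snd w))\<^sup>2 + (fst w * sin (snd w))\<^sup>2 = (fst w)\<^sup>2"
    by (simp add: power_mult_distrib flip: distrib_left)
  then show ?thesis by (simp add: norm_vec_def L2_set_def sum_2)
qed

lemma polar_zero [simp]: "polar w = 0 \<longleftrightarrow> fst w = 0"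
  using norm_polar[of w] by (metis abs_eq_0 norm_eq_zero)

lemma polar_vimage_zero: "polar -` {0} = {0} \<times> UNIV"
  by auto

lemma smooth_on_polar: "open X \<Longrightarrow> smooth_on X polar"
proof -
  assume X: "open X"
  have "smooth_on X (\<lambda>w. \<chi> i::2. if i = 1 then fst w * cos (snd w) else fst w * sin (snd w))"
  proof (intro smooth_on_vec X)
    show "smooth_on X (\<lambda>w. if i = 1 then fst w * cos (snd w) else fst w * sin (snd w))" for i :: 2
      using X by (cases "i = 1")
        (simp_all add: smooth_on_mult smooth_on_cos smooth_on_sin smooth_on_bounded_linear
          bounded_linear_fst bounded_linear_snd)
  qed
  moreover have "polar = (\<lambda>w. \<chi> i::2. if i = 1 then fst w * cos (snd w) else fst w * sin (snd w))"
    by (simp add: fun_eq_iff vec_eq_iff forall_2)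
  ultimately show ?thesis by simp
qed

lemma open_polar_vimage: "open W \<Longrightarrow> open (polar -` W)"
  using smooth_on_continuous[OF smooth_on_polar[OF open_UNIV]] by (simp add: open_vimage)

text \<open>Descends a function of (r, \<theta>) to the classes through an arbitrary representative;
  the value is meaningful for functions invariant under the group.\<close>

definition blowup_lift :: "(real \<times> real \<Rightarrow> real) \<Rightarrow> (real \<times> real) set \<Rightarrow> real" where
  "blowup_lift P q = P (SOME w. blowup_proj w = q)"

lemma blowup_lift:
  assumes "\<And>k r \<theta>. P ((-1) powi k * r, \<theta> + of_int k * pi) = P (r, \<theta>)"
  shows "blowup_lift P (blowup_proj w) = P w"
proof -
  have "blowup_proj (SOME w'. blowup_proj w' = blowup_proj w) = blowup_proj w"
    by (rule someI) (rule refl)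
  then obtain k :: int where "w = ((-1) powi k * fst (SOME w'. blowup_proj w' = blowup_proj w),
      snd (SOME w'. blowup_proj w' = blowup_proj w) + of_int k * pi)"
    by (rule blowup_proj_eqE)
  then show ?thesis unfolding blowup_lift_def using assms by (metis prod.collapse)
qed

lemma finite_if_all_equal: "(\<And>x y. x \<in> S \<Longrightarrow> y \<in> S \<Longrightarrow> x = y) \<Longrightarrow> finite S"
proof (cases "S = {}")
  case False
  assume eq: "\<And>x y. x \<in> S \<Longrightarrow> y \<in> S \<Longrightarrow> x = y"
  obtain x where "x \<in> S" using False by blast
  then have "S \<subseteq> {x}" using eq by blast
  then show ?thesis by (rule finite_subset) simp
qed simp

text \<open>Eliminating one coefficient from the two equations leaves the other times sin(\<theta>'
  - \<theta>).\<close>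

lemma linear_trig_zeros:
  assumes "a * cos \<theta> + b * sin \<theta> = 0" "a * cos \<theta>' + b * sin \<theta>' = 0" "a \<noteq> 0 \<or> b \<noteq> 0"
  obtains k :: int where "\<theta>' = \<theta> + of_int k * pi"
proof -
  have "a * sin (\<theta>' - \<theta>) = (a * cos \<theta> + b * sin \<theta>) * sin \<theta>' - (a * cos \<theta>' + b * sin \<theta>') * sin \<theta>"
    "b * sin (\<theta>' - \<theta>) = (a * cos \<theta>' + b * sin \<theta>') * cos \<theta> - (a * cos \<theta> + b * sin \<theta>) * cos \<theta>'"
    by (simp_all add: sin_diff algebra_simps)
  then have "sin (\<theta>' - \<theta>) = 0" using assms by auto
  then obtain k :: int where "\<theta>' - \<theta> = of_int k * pi" using sin_zero_iff_int2 by blast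
  then show ?thesis by (intro that[of k]) simp
qed

text \<open>The witnesses are the lifts of P^2 for \<rho> and of T for \<psi>. The assumption
  \<open>pd\<mu>\<close> serves twice: on \<open>W\<close> it makes \<open>D\<close> dense, and at 0
  it leaves P at most one zero on the exceptional circle.\<close>

lemma rationally_boundedI:
  fixes \<mu> Q \<phi> :: "real^2 \<Rightarrow> real"
  assumes R: "0 < R" and W: "W = ball 0 R" and D: "D = {z\<in>W. \<mu> z \<noteq> 0}"
    and sm: "smooth_on W \<mu>" "smooth_on W Q"
    and \<mu>0: "\<mu> 0 = 0" and Q0: "Q 0 = 0" and pdQ: "\<And>i. pd i Q 0 = 0"
    and pd\<mu>: "\<And>z. z \<in> W \<Longrightarrow> pd m \<mu> z \<noteq> 0"
    and eq: "\<And>z. z \<in> D \<Longrightarrow> \<phi> z * (\<mu> z)\<^sup>2 = Q z"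
  shows "rationally_bounded W D \<phi>"
proof -
  have oW: "open W" and zW: "0 \<in> W" using R by (simp_all add: W)
  have "D = W \<inter> \<mu> -` (- {0})" by (auto simp: D)
  then have oD: "open D"
    using continuous_open_preimage[OF smooth_on_continuous[OF sm(1)] oW, of "- {0}"] by auto
  have clos: "W \<subseteq> closure D"
  proof
    fix z assume z: "z \<in> W"
    show "z \<in> closure D"
    proof (rule ccontr)
      assume "z \<notin> closure D"
      \<comment> \<open>On the open set \<open>W - closure D\<close> the function \<mu> is
        identically zero, against \<open>pd\<mu>\<close>.\<close>
      then have z': "z \<in> W - closure D" using z by simp
      have "\<mu> y = 0" if "y \<in> W - closure D" for y
        using that closure_subset[of D] by (auto simp: D)
      then have "pd m \<mu> z = pd m (\<lambda>y. 0) z"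
        by (intro pd_cong[OF _ z']) (auto intro: oW open_Diff)
      then show False using pd\<mu>[OF z] by (simp add: pd_const)
    qed
  qed
  have "smooth_on D (\<lambda>z. Q z / (\<mu> z)\<^sup>2)"
    by (intro smooth_on_divide smooth_on_power oD) (use sm D in \<open>auto intro: smooth_on_subset\<close>)
  moreover have "\<phi> z = Q z / (\<mu> z)\<^sup>2" if "z \<in> D" for z
    using eq[OF that] that by (simp add: D field_simps)
  ultimately have sm\<phi>: "smooth_on D \<phi>"
    using smooth_on_cong[OF oD, of \<phi> "\<lambda>z. Q z / (\<mu> z)\<^sup>2"] by blast
  have had: "\<exists>A. (\<forall>i. smooth_on W (A i)) \<and> (\<forall>z\<in>W. X z = (\<Sum>i\<in>UNIV. z $ i * A i z)) \<and>
      (\<forall>i. A i 0 = pd i X 0)" if "smooth_on W X" "X 0 = 0" for X :: "real^2 \<Rightarrow> real"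
    by (rule hadamard[OF that[unfolded W]]) (use R in \<open>auto simp: W\<close>)
  obtain A where A: "\<And>i. smooth_on W (A i)" "\<And>z. z \<in> W \<Longrightarrow> \<mu> z = (\<Sum>i\<in>UNIV. z $ i * A i z)"
    "\<And>i. A i 0 = pd i \<mu> 0"
    using had[OF sm(1) \<mu>0] by blast
  obtain B where B: "\<And>i. smooth_on W (B i)" "\<And>z. z \<in> W \<Longrightarrow> Q z = (\<Sum>i\<in>UNIV. z $ i * B i z)"
    "\<And>i. B i 0 = pd i Q 0"
    using had[OF sm(2) Q0] by blast
  \<comment> \<open>The coefficients \<open>B i\<close> vanish at 0 by \<open>pdQ\<close>, so
    Hadamard's lemma applies to them a second time.\<close>
  have "\<forall>i. \<exists>C. (\<forall>j. smooth_on W (C j)) \<and> (\<forall>z\<in>W. B i z = (\<Sum>j\<in>UNIV. z $ j * C j z))"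
    using had[OF B(1)] B(3) pdQ by fastforce
  from choice[OF this] obtain C where C: "\<And>i j. smooth_on W (C i j)"
    "\<And>i z. z \<in> W \<Longrightarrow> B i z = (\<Sum>j\<in>UNIV. z $ j * C i j z)"
    by blast
  define P where "P w = cos (snd w) * A 1 (polar w) + sin (snd w) * A 2 (polar w)" for w
  define T where "T w = cos (snd w) * (cos (snd w) * C 1 1 (polar w) + sin (snd w) * C 1 2 (polar w))
    + sin (snd w) * (cos (snd w) * C 2 1 (polar w) + sin (snd w) * C 2 2 (polar w))" for w
  have lamP: "\<mu> (polar w) = fst w * P w" if "polar w \<in> W" for w
    using A(2)[OF that] by (simp add: P_def sum_2 algebra_simps)
  have QT: "Q (polar w) = (fst w)\<^sup>2 * T w" if "polar w \<in> W" for w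
    using B(2)[OF that] C(2)[OF that] by (simp add: T_def sum_2 power2_eq_square algebra_simps)
  have polar_shift: "polar ((-1) powi k * r, \<theta> + of_int k * pi) = polar (r, \<theta>)" for k :: int and r \<theta>
    by (simp add: vec_eq_iff forall_2 cos_shift_pi sin_shift_pi minus_one_powi)
  have P_shift: "P ((-1) powi k * r, \<theta> + of_int k * pi) = (-1) powi k * P (r, \<theta>)" for k :: int and r \<theta>
    unfolding P_def polar_shift snd_conv cos_shift_pi sin_shift_pi by (simp add: algebra_simps)
  \<comment> \<open>The sign found in \<open>P_shift\<close> disappears on squaring.\<close>
  have liftP: "blowup_lift (\<lambda>w. (P w)\<^sup>2) (blowup_proj w) = (P w)\<^sup>2" for w
    by (rule blowup_lift) (simp only: P_shift power_mult_distrib, simp add: minus_one_powi)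
  have liftT: "blowup_lift T (blowup_proj w) = T w" for w
    by (rule blowup_lift)
      (unfold T_def polar_shift snd_conv cos_shift_pi sin_shift_pi, simp add: minus_one_powi algebra_simps)
  have oV: "open (polar -` W)" by (rule open_polar_vimage[OF oW])
  have smc: "smooth_on (polar -` W) (\<lambda>w. X (polar w))" if "smooth_on W X" for X :: "real^2 \<Rightarrow> real"
    by (rule smooth_on_compose[OF that smooth_on_polar[OF oV] oV]) auto
  have smt: "smooth_on (polar -` W) (\<lambda>w. cos (snd w))" "smooth_on (polar -` W) (\<lambda>w. sin (snd w))"
    by (intro smooth_on_cos smooth_on_sin oV smooth_on_bounded_linear bounded_linear_snd)+
  have smP: "smooth_on (polar -` W) (\<lambda>w. (P w)\<^sup>2)"
    unfolding P_def by (intro smooth_on_power smooth_on_add smooth_on_mult smt smc A oV)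
  have smT: "smooth_on (polar -` W) T"
    unfolding T_def[abs_def] by (intro smooth_on_add smooth_on_mult smt smc C oV)
  let ?\<rho> = "blowup_lift (\<lambda>w. (P w)\<^sup>2)" and ?\<psi> = "blowup_lift T"
  have fin: "finite ({q. ?\<rho> q = 0} \<inter> blowup_proj ` (polar -` {0}))"
  proof (rule finite_if_all_equal)
    fix q q' assume qq: "q \<in> {q. ?\<rho> q = 0} \<inter> blowup_proj ` (polar -` {0})"
      "q' \<in> {q. ?\<rho> q = 0} \<inter> blowup_proj ` (polar -` {0})"
    obtain \<theta> \<theta>' where q: "q = blowup_proj (0, \<theta>)" "q' = blowup_proj (0, \<theta>')"
      using qq unfolding polar_vimage_zero by auto
    have P0: "P (0, \<theta>) = pd 1 \<mu> 0 * cos \<theta> + pd 2 \<mu> 0 * sin \<theta>" for \<theta>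
      using polar_zero[of "(0, \<theta>)"] by (simp del: polar_zero add: P_def A(3) mult.commute)
    have "(P (0, \<theta>))\<^sup>2 = 0" "(P (0, \<theta>'))\<^sup>2 = 0"
      using qq unfolding q by (simp_all only: Int_iff mem_Collect_eq liftP)
    then have "pd 1 \<mu> 0 * cos \<theta> + pd 2 \<mu> 0 * sin \<theta> = 0" "pd 1 \<mu> 0 * cos \<theta>' + pd 2 \<mu> 0 * sin \<theta>' = 0"
      by (simp_all add: P0)
    moreover have "pd 1 \<mu> 0 \<noteq> 0 \<or> pd 2 \<mu> 0 \<noteq> 0" using pd\<mu>[OF zW] exhaust_2[of m] by auto
    ultimately obtain k :: int where "\<theta>' = \<theta> + of_int k * pi" by (rule linear_trig_zeros)
    then show "q = q'" unfolding q using blowup_proj_shift[of k 0 \<theta>] by simp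
  qed
  have a: "blowup_proj ` (polar -` (D - {0})) = blowup_proj ` (polar -` (W - {0})) \<inter> {q. ?\<rho> q \<noteq> 0}"
  proof (intro equalityI subsetI)
    fix q assume "q \<in> blowup_proj ` (polar -` (D - {0}))"
    then obtain w where w: "q = blowup_proj w" "polar w \<in> D" "polar w \<noteq> 0" by blast
    then have "polar w \<in> W" "P w \<noteq> 0" using lamP[of w] by (auto simp: D)
    then show "q \<in> blowup_proj ` (polar -` (W - {0})) \<inter> {q. ?\<rho> q \<noteq> 0}"
      using w by (intro IntI image_eqI[of _ _ w]) (auto simp: liftP)
  next
    fix q assume "q \<in> blowup_proj ` (polar -` (W - {0})) \<inter> {q. ?\<rho> q \<noteq> 0}"
    then obtain w where w: "q = blowup_proj w" "w \<in> polar -` (W - {0})" "?\<rho> q \<noteq> 0" by blast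
    then have w: "q = blowup_proj w" "polar w \<in> W" "polar w \<noteq> 0" "(P w)\<^sup>2 \<noteq> 0"
      using liftP[of w] by auto
    then have "polar w \<in> D" using lamP[of w] by (auto simp: D)
    then show "q \<in> blowup_proj ` (polar -` (D - {0}))" using w by blast
  qed
  have c: "?\<psi> (blowup_proj w) = ?\<rho> (blowup_proj w) * \<phi> (polar w)" if "w \<in> polar -` D" for w
  proof -
    have w: "polar w \<in> D" "polar w \<in> W" "fst w \<noteq> 0" using that lamP[of w] by (auto simp: D)
    have "(fst w)\<^sup>2 * (\<phi> (polar w) * (P w)\<^sup>2) = (fst w)\<^sup>2 * T w"
      using eq[OF w(1)] lamP[OF w(2)] QT[OF w(2)] by (simp add: power_mult_distrib mult_ac)
    then have "\<phi> (polar w) * (P w)\<^sup>2 = T w" using w(3) by simp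
    then show ?thesis by (simp add: liftP liftT mult.commute)
  qed
  have r: "smooth_on (polar -` W) (?\<rho> \<circ> blowup_proj)" "smooth_on (polar -` W) (?\<psi> \<circ> blowup_proj)"
    using smP smT by (simp_all add: o_def liftP liftT)
  have DW: "D \<subseteq> W" by (auto simp: D)
  show ?thesis
    unfolding rationally_bounded_def
    by (intro conjI oW zW oD DW clos sm\<phi>, rule exI[of _ ?\<rho>], rule exI[of _ ?\<psi>],
        intro conjI ballI r a fin c)
qed

lemma polar_line: "polar (r, \<theta>) = r *\<^sub>R polar (1, \<theta>)"
  by (simp add: vec_eq_iff forall_2)

lemma directional_limit:
  fixes X :: "real^2 \<Rightarrow> real"
  assumes "X differentiable (at 0)" "X 0 = 0"
  shows "((\<lambda>r. X (polar (r, \<theta>)) / r) \<longlongrightarrow> pd 1 X 0 * cos \<theta> + pd 2 X 0 * sin \<theta>) (at 0)"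
proof -
  have X: "(X has_derivative (\<lambda>w. \<Sum>i\<in>UNIV. w $ i *\<^sub>R pd i X 0)) (at ((0::real) *\<^sub>R polar (1, \<theta>)))"
    using pd_has_derivative[OF assms(1)] by simp
  have "((\<lambda>r::real. r *\<^sub>R polar (1, \<theta>)) has_derivative (\<lambda>r. r *\<^sub>R polar (1, \<theta>))) (at 0)"
    by (auto intro!: derivative_eq_intros)
  from has_derivative_compose[OF this X]
  have "((\<lambda>r. X (r *\<^sub>R polar (1, \<theta>))) has_derivative (\<lambda>r. (pd 1 X 0 * cos \<theta> + pd 2 X 0 * sin \<theta>) * r)) (at 0)"
    by (simp add: sum_2 algebra_simps)
  then have "((\<lambda>r. X (polar (r, \<theta>))) has_real_derivative (pd 1 X 0 * cos \<theta> + pd 2 X 0 * sin \<theta>)) (at 0)"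
    unfolding has_field_derivative_def polar_line[symmetric] .
  then show ?thesis
    using assms(2) polar_zero[of "(0, \<theta>)", THEN iffD2] by (simp add: has_field_derivative_iff)
qed

text \<open>If \<open>Q\<close> vanished only to first order, the identity \<open>\<rho> Q = \<psi> \<mu>\<^sup>2\<close> would force \<open>\<rho>\<close> to
  vanish at every point of the exceptional circle whose direction is not in the kernel of \<open>dQ\<close>.\<close>

lemma rationally_boundedD:
  fixes \<mu> Q \<phi> :: "real^2 \<Rightarrow> real"
  assumes rb: "rationally_bounded W D \<phi>"
    and V: "open V" "0 \<in> V" and sm: "smooth_on V \<mu>" "smooth_on V Q"
    and D: "\<And>z. z \<in> V \<Longrightarrow> z \<in> W \<Longrightarrow> z \<in> D \<longleftrightarrow> \<mu> z \<noteq> 0"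
    and \<mu>0: "\<mu> 0 = 0" and Q0: "Q 0 = 0" and pdQ: "\<And>i. pd i Q 0 = c * pd i \<mu> 0"
    and eq: "\<And>z. z \<in> V \<Longrightarrow> z \<in> D \<Longrightarrow> \<phi> z * (\<mu> z)\<^sup>2 = Q z"
  shows "pd i Q 0 = 0"
proof (rule ccontr)
  assume nz: "pd i Q 0 \<noteq> 0"
  have W: "open W" "0 \<in> W" using rb by (simp_all add: rationally_bounded_def)
  obtain \<rho> \<psi> :: "(real \<times> real) set \<Rightarrow> real" where
    smr: "smooth_on (polar -` W) (\<rho> \<circ> blowup_proj)" "smooth_on (polar -` W) (\<psi> \<circ> blowup_proj)"
    and "blowup_proj ` (polar -` (D - {0})) = blowup_proj ` (polar -` (W - {0})) \<inter> {q. \<rho> q \<noteq> 0}"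
    and fin: "finite ({q. \<rho> q = 0} \<inter> blowup_proj ` (polar -` {0}))"
    and \<psi>: "\<forall>w \<in> polar -` D. \<psi> (blowup_proj w) = \<rho> (blowup_proj w) * \<phi> (polar w)"
    using rb unfolding rationally_bounded_def by (elim conjE exE) (rule that)
  let ?dQ = "\<lambda>\<theta>. pd 1 Q 0 * cos \<theta> + pd 2 Q 0 * sin \<theta>"
  let ?d\<mu> = "\<lambda>\<theta>. pd 1 \<mu> 0 * cos \<theta> + pd 2 \<mu> 0 * sin \<theta>"
  have zero: "\<rho> (blowup_proj (0, \<theta>)) = 0" if \<theta>: "?dQ \<theta> \<noteq> 0" for \<theta>
  proof -
    have limc: "((\<lambda>r. X (blowup_proj (r, \<theta>))) \<longlongrightarrow> X (blowup_proj (0, \<theta>))) (at 0)"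
      if "smooth_on (polar -` W) (X \<circ> blowup_proj)" for X :: "(real \<times> real) set \<Rightarrow> real"
    proof -
      have "(0, \<theta>) \<in> polar -` W" using W(2) polar_zero[of "(0, \<theta>)"] by (simp del: polar_zero)
      then have "isCont (X \<circ> blowup_proj) (0, \<theta>)"
        using smooth_on_continuous[OF that] continuous_on_eq_continuous_at[OF open_polar_vimage[OF W(1)]]
        by blast
      moreover have "((\<lambda>r. (r, \<theta>)) \<longlongrightarrow> (0, \<theta>)) (at 0)" by (intro tendsto_intros)
      ultimately have "((\<lambda>r. (X \<circ> blowup_proj) (r, \<theta>)) \<longlongrightarrow> (X \<circ> blowup_proj) (0, \<theta>)) (at 0)"
        by (rule isCont_tendsto_compose)
      then show ?thesis by simp
    qed
    note lQ = directional_limit[OF smooth_on_differentiable[OF sm(2) V(2)] Q0, of \<theta>]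
    note l\<mu> = directional_limit[OF smooth_on_differentiable[OF sm(1) V(2)] \<mu>0, of \<theta>]
    have ev: "eventually (\<lambda>r. polar (r, \<theta>) \<in> V \<inter> W) (at 0)"
    proof -
      have "((\<lambda>r. r *\<^sub>R polar (1, \<theta>)) \<longlongrightarrow> 0 *\<^sub>R polar (1, \<theta>)) (at 0)"
        by (intro tendsto_intros)
      moreover have "(\<lambda>r. r *\<^sub>R polar (1, \<theta>)) = (\<lambda>r. polar (r, \<theta>))"
        by (rule ext) (rule polar_line[symmetric])
      ultimately have "((\<lambda>r. polar (r, \<theta>)) \<longlongrightarrow> 0) (at 0)" by (simp only: scaleR_zero_left)
      then show ?thesis
        by (rule topological_tendstoD) (use V W in auto)
    qed
    \<comment> \<open>The identity \<rho> Q = \<psi> \<mu>^2 is divided by r. The left side tends to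
      \<rho> times dQ in direction \<theta>; the right side keeps a factor r and tends to 0.\<close>
    have l1: "((\<lambda>r. \<rho> (blowup_proj (r, \<theta>)) * (Q (polar (r, \<theta>)) / r)) \<longlongrightarrow> \<rho> (blowup_proj (0, \<theta>)) * ?dQ \<theta>) (at 0)"
      by (intro tendsto_mult limc smr lQ)
    have l2: "((\<lambda>r. \<psi> (blowup_proj (r, \<theta>)) * (r * (\<mu> (polar (r, \<theta>)) / r)\<^sup>2)) \<longlongrightarrow>
        \<psi> (blowup_proj (0, \<theta>)) * (0 * (?d\<mu> \<theta>)\<^sup>2)) (at 0)"
      by (intro tendsto_mult tendsto_power limc smr l\<mu> tendsto_ident_at)
    have e: "eventually (\<lambda>r. \<rho> (blowup_proj (r, \<theta>)) * (Q (polar (r, \<theta>)) / r) =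
        \<psi> (blowup_proj (r, \<theta>)) * (r * (\<mu> (polar (r, \<theta>)) / r)\<^sup>2)) (at 0)"
    proof -
      \<comment> \<open>A direction outside the kernel of dQ is outside the kernel of d\<mu>, so the
        punctured ray lies in \<open>D\<close> near 0, where \<psi> is tied to \<phi>.\<close>
      have "?dQ \<theta> = c * ?d\<mu> \<theta>" by (simp add: pdQ algebra_simps)
      then have "?d\<mu> \<theta> \<noteq> 0" using \<theta> by auto
      from tendsto_imp_eventually_ne[OF l\<mu> this] ev show ?thesis
      proof eventually_elim
        case (elim r)
        then have r: "r \<noteq> 0" "\<mu> (polar (r, \<theta>)) \<noteq> 0" by auto
        have d: "polar (r, \<theta>) \<in> D" using D[of "polar (r, \<theta>)"] elim r by simp
        have "\<psi> (blowup_proj (r, \<theta>)) * (\<mu> (polar (r, \<theta>)))\<^sup>2 = \<rho> (blowup_proj (r, \<theta>)) * Q (polar (r, \<theta>))"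
          using \<psi>[rule_format, of "(r, \<theta>)"] eq[of "polar (r, \<theta>)"] d elim by simp
        then have "\<rho> (blowup_proj (r, \<theta>)) * (Q (polar (r, \<theta>)) / r) = \<psi> (blowup_proj (r, \<theta>)) * (\<mu> (polar (r, \<theta>)))\<^sup>2 / r"
          by (simp only: times_divide_eq_right)
        also have "\<dots> = \<psi> (blowup_proj (r, \<theta>)) * (r * (\<mu> (polar (r, \<theta>)) / r)\<^sup>2)"
          using r by (simp add: power2_eq_square)
        finally show ?case .
      qed
    qed
    have "\<rho> (blowup_proj (0, \<theta>)) * ?dQ \<theta> = \<psi> (blowup_proj (0, \<theta>)) * (0 * (?d\<mu> \<theta>)\<^sup>2)"
      by (rule tendsto_unique[OF at_neq_bot l1]) (use tendsto_cong[OF e] l2 in \<open>simp only:\<close>)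
    then show ?thesis using \<theta> by simp
  qed
  \<comment> \<open>At r = 0 two angles give the same class only if they differ by a multiple of
    pi.\<close>
  have inj: "inj_on (\<lambda>\<theta>. blowup_proj (0, \<theta>)) {0..<pi}"
  proof (rule inj_onI)
    fix \<theta> \<theta>' assume th: "\<theta> \<in> {0..<pi}" "\<theta>' \<in> {0..<pi}" "blowup_proj (0, \<theta>) = blowup_proj (0, \<theta>')"
    obtain k :: int where "(0, \<theta>') = ((-1) powi k * fst (0::real, \<theta>), snd (0::real, \<theta>) + of_int k * pi)"
      by (rule blowup_proj_eqE[OF th(3)])
    then have k: "\<theta>' = \<theta> + of_int k * pi" by simp
    then have "\<bar>of_int k * pi\<bar> < pi" using th by auto
    then have "\<bar>k\<bar> < 1" by (simp add: abs_mult flip: of_int_abs)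
    then show "\<theta> = \<theta>'" using k by simp
  qed
  \<comment> \<open>A nonzero dQ annihilates at most one direction in the interval, so infinitely
    many directions remain, each giving a zero of \<rho>.\<close>
  let ?G = "{\<theta> \<in> {0..<pi}. ?dQ \<theta> \<noteq> 0}" and ?B = "{\<theta> \<in> {0..<pi}. ?dQ \<theta> = 0}"
  have "finite ?B"
  proof (rule finite_if_all_equal)
    fix \<theta> \<theta>' assume B: "\<theta> \<in> ?B" "\<theta>' \<in> ?B"
    have "pd 1 Q 0 \<noteq> 0 \<or> pd 2 Q 0 \<noteq> 0" using nz exhaust_2[of i] by auto
    moreover have "?dQ \<theta> = 0" "?dQ \<theta>' = 0" using B by auto
    ultimately obtain k :: int where k: "\<theta>' = \<theta> + of_int k * pi"
      using linear_trig_zeros[of "pd 1 Q 0" \<theta> "pd 2 Q 0" \<theta>'] by blast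
    then have "\<bar>of_int k * pi\<bar> < pi" using B by auto
    then have "\<bar>k\<bar> < 1" by (simp add: abs_mult flip: of_int_abs)
    then show "\<theta> = \<theta>'" using k by simp
  qed
  moreover have "infinite {0..<pi}" using pi_gt_zero by (simp add: infinite_Ico)
  moreover have "{0..<pi} = ?G \<union> ?B" by auto
  ultimately have "infinite ?G" using finite_UnI[of ?G ?B] by argo
  then have "infinite ((\<lambda>\<theta>. blowup_proj (0, \<theta>)) ` ?G)"
    using finite_imageD inj_on_subset[OF inj, of ?G] by blast
  moreover have "(\<lambda>\<theta>. blowup_proj (0, \<theta>)) ` ?G \<subseteq> {q. \<rho> q = 0} \<inter> blowup_proj ` (polar -` {0})"
    using zero by auto
  ultimately show False using fin finite_subset by blast
qed

section \<open>Frontals in charts\<close>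

text \<open>If \<open>lam\<close> is nonzero, \<open>ff\<close> is invertible and annihilates every
  kernel vector; if it is zero, the factor of proportionality of F_1 and F_2 yields a kernel
  vector.\<close>

lemma inj_frechet_iff_lam:
  assumes "local_frontal Y g W F \<nu>" "z \<in> W"
  shows "inj (frechet_derivative F (at z)) \<longleftrightarrow> local_frontal.lam g F \<nu> z \<noteq> 0"
proof -
  interpret local_frontal Y g W F \<nu> by fact
  have dF: "frechet_derivative F (at z) w = w $ 1 *\<^sub>R pd 1 F z + w $ 2 *\<^sub>R pd 2 F z" for w
    using frechet_derivative_pd[OF smooth_on_differentiable[OF smooth_F assms(2)]] by (simp add: sum_2)
  have lin: "linear (frechet_derivative F (at z))"
    using smooth_on_has_derivative[OF smooth_F assms(2)] has_derivative_linear by blast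
  have "inj (frechet_derivative F (at z))" if l: "lam z \<noteq> 0"
    unfolding linear_injective_0[OF lin]
  proof (intro allI impI)
    fix w assume w: "frechet_derivative F (at z) w = 0"
    have "gip z (pd k F z) (w $ 1 *\<^sub>R pd 1 F z + w $ 2 *\<^sub>R pd 2 F z) = 0" for k
      using w by (simp add: dF ip_distrib(8))
    then have "w $ 1 * gip z (pd k F z) (pd 1 F z) + w $ 2 * gip z (pd k F z) (pd 2 F z) = 0" for k
      by (simp only: ip_distrib)
    then have "ff z *v w = 0"
      by (simp add: vec_eq_iff matrix_vector_mult_def sum_2 ff_def mult.commute)
    moreover have "det (ff z) \<noteq> 0" using lam_square[OF assms(2)] l by auto
    ultimately show "w = 0"
      using invertible_det_nz inj_matrix_vector_mult[of "ff z"] matrix_vector_mult_0_right[of "ff z"]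
      by (metis injD)
  qed
  moreover have "\<not> inj (frechet_derivative F (at z))" if l: "lam z = 0"
  proof -
    have "\<exists>w. w \<noteq> 0 \<and> frechet_derivative F (at z) w = 0"
      using dependent_if_lam_zero[OF assms(2) l]
    proof (elim disjE exE)
      fix r assume "pd 1 F z = r *\<^sub>R pd 2 F z"
      then have "frechet_derivative F (at z) (vector [1, - r]) = 0" by (simp add: dF)
      moreover have "vector [1, - r] \<noteq> (0 :: real^2)" by (simp add: vec_eq_iff forall_2)
      ultimately show ?thesis by blast
    next
      fix r assume "pd 2 F z = r *\<^sub>R pd 1 F z"
      then have "frechet_derivative F (at z) (vector [- r, 1]) = 0" by (simp add: dF)
      moreover have "vector [- r, 1] \<noteq> (0 :: real^2)" by (simp add: vec_eq_iff forall_2)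
      ultimately show ?thesis by blast
    qed
    then show ?thesis unfolding linear_injective_0[OF lin] by blast
  qed
  ultimately show ?thesis by blast
qed

lemma local_frontal_subset:
  assumes "local_frontal Y g W F \<nu>" "open W'" "W' \<subseteq> W"
  shows "local_frontal Y g W' F \<nu>"
proof -
  interpret local_frontal Y g W F \<nu> by fact
  show ?thesis
    by unfold_locales (use assms smooth_F F_into smooth_\<nu> \<nu>_unit \<nu>_orth in \<open>auto intro: smooth_on_subset\<close>)
qed

lemma adapted_frontal_subset:
  assumes "adapted_frontal Y g W F \<nu>" "open W'" "W' \<subseteq> W" "0 \<in> W'"
  shows "adapted_frontal Y g W' F \<nu>"
proof -
  interpret a: adapted_frontal Y g W F \<nu> by fact
  interpret b: local_frontal Y g W' F \<nu>
    using local_frontal_subset assms a.local_frontal_axioms by blast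
  show ?thesis
    by unfold_locales (use assms a.F1_zero a.F2_unit a.lam_axis a.pd2_lam in auto)
qed

section \<open>Charts and transition maps\<close>

lemma chart_inv_snd: "is_chart x \<Longrightarrow> q \<in> fst x \<Longrightarrow> chart_inv x (snd x q) = q"
  by (auto simp: is_chart_def homeomorphism_def)

lemma open_chart_image: "is_chart x \<Longrightarrow> open A \<Longrightarrow> open (snd x ` (fst x \<inter> A))"
proof -
  assume x: "is_chart x" and A: "open A"
  have h: "homeomorphism (fst x) (chart_image x) (snd x) (chart_inv x)" and o: "open (chart_image x)"
    using x by (auto simp: is_chart_def)
  have "openin (top_of_set (fst x)) (fst x \<inter> A)" using A by (rule openin_open_Int)
  from homeomorphism_imp_open_map[OF h this] show ?thesis using o openin_open_trans by blast
qed

lemma transition_eq: "is_chart x \<Longrightarrow> q \<in> fst x \<Longrightarrow> transition x y (snd x q) = snd y q"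
  by (simp add: transition_def chart_inv_snd)

locale smooth_atlas =
  fixes S :: "('s::topological_space, real^'n::finite) chart set"
  assumes cover: "(\<Union>x\<in>S. fst x) = UNIV" and compatible: "S \<subseteq> coordinate_systems S"
begin

lemma is_chart: "x \<in> coordinate_systems S \<Longrightarrow> is_chart x"
  by (simp add: coordinate_systems_def)

lemma chart_at: obtains s where "s \<in> S" "q \<in> fst s"
  using cover by blast

lemma smooth_to_atlas:
  "x \<in> coordinate_systems S \<Longrightarrow> s \<in> S \<Longrightarrow> smooth_on (snd x ` (fst x \<inter> fst s)) (transition x s)"
  "x \<in> coordinate_systems S \<Longrightarrow> s \<in> S \<Longrightarrow> smooth_on (snd s ` (fst x \<inter> fst s)) (transition s x)"
  by (auto simp: coordinate_systems_def smoothly_compatible_def)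

text \<open>Smoothness is given in atlas charts; near each point the transition from
  \<open>x\<close> to such a chart carries it over.\<close>

lemma smooth_function_in_coordinates:
  fixes H :: "'s \<Rightarrow> 'b::real_normed_vector"
  assumes x: "x \<in> coordinate_systems S" and "open A"
    and H: "\<And>s. s \<in> S \<Longrightarrow> smooth_on (snd s ` (fst s \<inter> A)) (H \<circ> chart_inv s)"
  shows "smooth_on (snd x ` (fst x \<inter> A)) (H \<circ> chart_inv x)"
proof (rule smooth_on_local)
  fix z assume "z \<in> snd x ` (fst x \<inter> A)"
  then obtain q where q: "q \<in> fst x" "q \<in> A" "z = snd x q" by blast
  obtain s where s: "s \<in> S" "q \<in> fst s" by (rule chart_at)
  have cx: "is_chart x" using is_chart[OF x] .
  have cs: "is_chart s" using is_chart s(1) compatible by blast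
  let ?V = "snd x ` (fst x \<inter> (fst s \<inter> A))"
  have op: "open ?V" using open_chart_image[OF cx] cs \<open>open A\<close> by (simp add: is_chart_def open_Int)
  have "smooth_on ?V (\<lambda>z. (H \<circ> chart_inv s) (transition x s z))"
  proof (rule smooth_on_compose[OF H[OF s(1)] _ op])
    show "smooth_on ?V (transition x s)"
      by (rule smooth_on_subset[OF smooth_to_atlas(1)[OF x s(1)]]) auto
    show "transition x s ` ?V \<subseteq> snd s ` (fst s \<inter> A)"
      by (auto simp: transition_eq[OF cx])
  qed
  moreover have "(H \<circ> chart_inv s) (transition x s z) = (H \<circ> chart_inv x) z" if "z \<in> ?V" for z
    using that by (auto simp: transition_eq[OF cx] chart_inv_snd[OF cx] chart_inv_snd[OF cs])
  ultimately have "smooth_on ?V (H \<circ> chart_inv x)"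
    using smooth_on_cong[OF op, of "\<lambda>z. (H \<circ> chart_inv s) (transition x s z)" "H \<circ> chart_inv x"] by blast
  then show "\<exists>V. open V \<and> z \<in> V \<and> smooth_on V (H \<circ> chart_inv x)"
    using op q s by blast
qed

lemma smooth_transition:
  assumes "x \<in> coordinate_systems S" "y \<in> coordinate_systems S"
  shows "smooth_on (snd x ` (fst x \<inter> fst y)) (transition x y)"
  unfolding transition_def
  using smooth_function_in_coordinates[OF assms(1), of "fst y" "snd y"] smooth_to_atlas(2)[OF assms(2)]
    is_chart[OF assms(2)] by (simp add: is_chart_def transition_def Int_commute)

lemma transition_derivative_inverse:
  assumes "x \<in> coordinate_systems S" "y \<in> coordinate_systems S" "q \<in> fst x" "q \<in> fst y"
  shows "frechet_derivative (transition y x) (at (snd y q)) (frechet_derivative (transition x y) (at (snd x q)) w) = w"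
proof -
  let ?V = "snd x ` (fst x \<inter> fst y)"
  have cx: "is_chart x" and cy: "is_chart y" using is_chart assms by auto
  have op: "open ?V" using open_chart_image[OF cx] cy by (simp add: is_chart_def)
  have "(transition x y has_derivative frechet_derivative (transition x y) (at (snd x q))) (at (snd x q))"
    by (rule smooth_on_has_derivative[OF smooth_transition[OF assms(1,2)]]) (use assms in auto)
  moreover have "(transition y x has_derivative frechet_derivative (transition y x) (at (snd y q))) (at (transition x y (snd x q)))"
    unfolding transition_eq[OF cx assms(3)]
    by (rule smooth_on_has_derivative[OF smooth_transition[OF assms(2,1)]]) (use assms in auto)
  ultimately have A: "((\<lambda>z. transition y x (transition x y z)) has_derivative
     (\<lambda>w. frechet_derivative (transition y x) (at (snd y q)) (frechet_derivative (transition x y) (at (snd x q)) w))) (at (snd x q))"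
    by (rule has_derivative_compose)
  have B: "((\<lambda>z. transition y x (transition x y z)) has_derivative (\<lambda>w. w)) (at (snd x q))"
  proof (rule has_derivative_transform_within_open[OF has_derivative_ident op])
    show "snd x q \<in> ?V" using assms by blast
    show "z = transition y x (transition x y z)" if "z \<in> ?V" for z
      using that by (auto simp: transition_eq[OF cx] transition_eq[OF cy])
  qed
  from fun_cong[OF has_derivative_unique[OF A B], of w] show ?thesis .
qed

lemma inj_transition_derivative:
  assumes "x \<in> coordinate_systems S" "y \<in> coordinate_systems S" "q \<in> fst x" "q \<in> fst y"
  shows "inj (frechet_derivative (transition x y) (at (snd x q)))"
  by (rule inj_on_inverseI) (rule transition_derivative_inverse[OF assms])

end

text \<open>The determinant times that of the reverse transition is 1, since the two Jacobian
  matrices are inverse to each other.\<close>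

lemma jacobian_nonzero:
  fixes S :: "('s::topological_space, real^2) chart set"
  assumes "smooth_atlas S" "x \<in> coordinate_systems S" "y \<in> coordinate_systems S" "q \<in> fst x" "q \<in> fst y"
  defines "J \<equiv> \<lambda>i k. pd i (transition x y) (snd x q) $ k"
  shows "J 1 1 * J 2 2 - J 1 2 * J 2 1 \<noteq> 0"
proof -
  interpret smooth_atlas S by fact
  let ?K = "\<lambda>k l. pd k (transition y x) (snd y q) $ l"
  have "transition y x differentiable (at (snd y q))"
    by (rule smooth_on_differentiable[OF smooth_transition[OF assms(3,2)]]) (use assms in auto)
  note d = frechet_derivative_pd[OF this]
  have "frechet_derivative (transition y x) (at (snd y q)) (pd i (transition x y) (snd x q)) = axis i 1" for i
    unfolding pd_def by (rule transition_derivative_inverse[OF assms(2-5)])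
  then have "(\<Sum>k\<in>UNIV. pd i (transition x y) (snd x q) $ k *\<^sub>R pd k (transition y x) (snd y q)) = axis i 1" for i
    by (simp only: d)
  then have "(\<Sum>k\<in>UNIV. pd i (transition x y) (snd x q) $ k *\<^sub>R pd k (transition y x) (snd y q)) $ l = axis i 1 $ l" for i l
    by simp
  then have JK: "J i 1 * ?K 1 l + J i 2 * ?K 2 l = (if l = i then 1 else 0)" for i l
    by (simp add: sum_2 J_def axis_def)
  have "(J 1 1 * J 2 2 - J 1 2 * J 2 1) * (?K 1 1 * ?K 2 2 - ?K 1 2 * ?K 2 1) =
    (J 1 1 * ?K 1 1 + J 1 2 * ?K 2 1) * (J 2 1 * ?K 1 2 + J 2 2 * ?K 2 2)
    - (J 1 1 * ?K 1 2 + J 1 2 * ?K 2 2) * (J 2 1 * ?K 1 1 + J 2 2 * ?K 2 1)"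
    by (simp add: algebra_simps)
  also have "\<dots> = 1" unfolding JK by simp
  finally show ?thesis by auto
qed

section \<open>A frontal read in charts\<close>

locale frontal_in_chart = S: smooth_atlas S + M: smooth_atlas M
  for S :: "('s::{t2_space,second_countable_topology}, real^2) chart set"
    and M :: "('m::{t2_space,second_countable_topology}, real^3) chart set" +
  fixes g :: "('m, 3) metric" and f :: "'s \<Rightarrow> 'm"
    and c :: "('m, real^3) chart" and U :: "'s set" and N :: "'s \<Rightarrow> real^3"
  assumes metric: "riemannian_metric M g" and smooth_f: "smooth_map S M f"
    and c: "c \<in> M" and normal: "unit_normal S g f c U N"
begin

abbreviation "rep \<equiv> local_rep c f"
abbreviation "nu x \<equiv> N \<circ> chart_inv x"
abbreviation "region x \<equiv> snd x ` (fst x \<inter> U)"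

lemma open_U: "open U" and fU: "f ` U \<subseteq> fst c"
  using normal by (auto simp: unit_normal_def)

lemma chart_c: "is_chart c" using c M.is_chart M.compatible by blast

lemma metric_c: "metric_field (chart_image c) (g c)"
  using metric c chart_c by unfold_locales (auto simp: riemannian_metric_def is_chart_def)

lemma rep_eq: "is_chart x \<Longrightarrow> q \<in> fst x \<Longrightarrow> rep x (snd x q) = snd c (f q)"
  by (simp add: local_rep_def chart_inv_snd)

lemma smooth_local_rep:
  assumes "x \<in> coordinate_systems S" "c' \<in> M"
  shows "smooth_on (snd x ` (fst x \<inter> f -` fst c')) (local_rep c' f x)"
proof -
  have "open (fst c')" using M.is_chart[of c'] M.compatible assms(2) by (auto simp: is_chart_def)
  moreover have "continuous_on UNIV f" using smooth_f by (simp add: smooth_map_def)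
  ultimately have "open (f -` fst c')" by (rule open_vimage)
  from S.smooth_function_in_coordinates[OF assms(1) this, of "snd c' \<circ> f"]
  show ?thesis using smooth_f assms(2) by (simp add: smooth_map_def local_rep_def)
qed

lemma smooth_rep: "x \<in> coordinate_systems S \<Longrightarrow> smooth_on (region x) (rep x)"
  by (rule smooth_on_subset[OF smooth_local_rep[OF _ c]]) (use fU in auto)

lemma smooth_nu: "x \<in> coordinate_systems S \<Longrightarrow> smooth_on (region x) (nu x)"
  using S.smooth_function_in_coordinates[OF _ open_U, of x N] normal
  by (simp add: unit_normal_def smooth_function_on_def)

text \<open>\<open>unit_normal\<close> states orthogonality in the charts of the atlas; the chain
  rule transports it to every coordinate system.\<close>

lemma local_frontal: "x \<in> coordinate_systems S \<Longrightarrow> local_frontal (chart_image c) (g c) (region x) (rep x) (nu x)"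
proof -
  assume x: "x \<in> coordinate_systems S"
  have cx: "is_chart x" using S.is_chart[OF x] .
  interpret metric_field "chart_image c" "g c" by (rule metric_c)
  show ?thesis
  proof unfold_locales
    show "open (region x)" by (rule open_chart_image[OF cx open_U])
    show "smooth_on (region x) (rep x)" by (rule smooth_rep[OF x])
    show "smooth_on (region x) (nu x)" by (rule smooth_nu[OF x])
    show "rep x ` region x \<subseteq> chart_image c" using fU by (auto simp: rep_eq[OF cx])
  next
    fix z assume "z \<in> region x"
    then obtain q where q: "q \<in> fst x" "q \<in> U" "z = snd x q" by blast
    show "ip (g c (rep x z)) (nu x z) (nu x z) = 1"
    proof -
      have "gnorm (g c (snd c (f q))) (N q) = 1" using normal q by (simp add: unit_normal_def)
      then show ?thesis using q by (simp add: rep_eq[OF cx] chart_inv_snd[OF cx] gnorm_def)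
    qed
    fix i
    show "ip (g c (rep x z)) (nu x z) (pd i (rep x) z) = 0"
    proof -
      obtain s where s: "s \<in> S" "q \<in> fst s" by (rule S.chart_at)
      have s': "s \<in> coordinate_systems S" using s S.compatible by blast
      then have cs: "is_chart s" by (rule S.is_chart)
      let ?V = "snd x ` (fst x \<inter> (fst s \<inter> U))"
      have op: "open ?V" using open_chart_image[OF cx] cs open_U by (simp add: is_chart_def open_Int)
      have "pd i (rep x) z = pd i (\<lambda>z. rep s (transition x s z)) z"
        by (rule pd_cong[OF op]) (use q s in \<open>auto simp: transition_eq[OF cx] rep_eq[OF cx] rep_eq[OF cs]\<close>)
      also have "\<dots> = frechet_derivative (rep s) (at (snd s q)) (pd i (transition x s) z)"
      proof -
        have t: "transition x s differentiable (at z)"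
          by (rule smooth_on_differentiable[OF S.smooth_transition[OF x s']]) (use q s in auto)
        have "rep s differentiable (at (transition x s z))"
          by (rule smooth_on_differentiable[OF smooth_rep[OF s']]) (use q s in \<open>auto simp: transition_eq[OF cx]\<close>)
        from pd_eqI[OF has_derivative_compose[OF t[unfolded frechet_derivative_works] this[unfolded frechet_derivative_works]]]
        show ?thesis using q by (simp add: pd_def transition_eq[OF cx])
      qed
      finally show ?thesis
        using normal q s by (simp add: unit_normal_def rep_eq[OF cx] chart_inv_snd[OF cx])
    qed
  qed
qed

lemma frontal_change:
  assumes x: "x \<in> coordinate_systems S" and y: "y \<in> coordinate_systems S"
    and W: "open W" "W \<subseteq> snd x ` (fst x \<inter> fst y \<inter> U)" and b: "local_frontal (chart_image c) (g c) W' (rep y) (nu y)"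
    and W': "transition x y ` W \<subseteq> W'"
  shows "frontal_change (chart_image c) (g c) W (rep x) (nu x) W' (rep y) (nu y) (transition x y)"
proof -
  have cx: "is_chart x" and cy: "is_chart y" using S.is_chart x y by auto
  interpret a: local_frontal "chart_image c" "g c" W "rep x" "nu x"
    by (rule local_frontal_subset[OF local_frontal[OF x] W(1)]) (use W in blast)
  interpret b: local_frontal "chart_image c" "g c" W' "rep y" "nu y" by (rule b)
  show ?thesis
  proof unfold_locales
    show "smooth_on W (transition x y)"
      by (rule smooth_on_subset[OF S.smooth_transition[OF x y]]) (use W in blast)
    show "transition x y ` W \<subseteq> W'" by (rule W')
    fix z assume "z \<in> W"
    then obtain q where "q \<in> fst x" "q \<in> fst y" "z = snd x q" using W(2) by blast
    then show "rep x z = rep y (transition x y z)" "nu x z = nu y (transition x y z)"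
      by (simp_all add: transition_eq[OF cx] rep_eq[OF cx] rep_eq[OF cy] chart_inv_snd[OF cx] chart_inv_snd[OF cy])
  qed
qed

text \<open>Two local representatives differ by transition maps on both sides, whose derivatives are
  injective.\<close>

lemma inj_local_rep:
  assumes x: "x \<in> coordinate_systems S" "x' \<in> coordinate_systems S" and d: "d \<in> M" "d' \<in> M"
    and q: "q \<in> fst x" "q \<in> fst x'" "f q \<in> fst d" "f q \<in> fst d'"
    and inj: "inj (frechet_derivative (local_rep d f x) (at (snd x q)))"
  shows "inj (frechet_derivative (local_rep d' f x') (at (snd x' q)))"
proof -
  have cx: "is_chart x" "is_chart x'" using S.is_chart x by auto
  have d': "d \<in> coordinate_systems M" "d' \<in> coordinate_systems M" using d M.compatible by auto
  then have cd: "is_chart d" "is_chart d'" using M.is_chart by auto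
  let ?\<tau> = "transition x' x" and ?\<sigma> = "transition d d'" and ?F = "local_rep d f x"
  let ?A = "f -` fst d \<inter> f -` fst d'"
  have "open ?A"
    using smooth_f cd by (auto simp: smooth_map_def is_chart_def intro!: open_vimage open_Int)
  then have op: "open (snd x' ` (fst x' \<inter> (fst x \<inter> ?A)))"
    using open_chart_image[OF cx(2)] cx by (simp add: is_chart_def open_Int)
  have eq: "local_rep d' f x' z = ?\<sigma> (?F (?\<tau> z))" if "z \<in> snd x' ` (fst x' \<inter> (fst x \<inter> ?A))" for z
    using that by (auto simp: transition_eq[OF cx(2)] local_rep_def chart_inv_snd cx transition_eq[OF cd(1)])
  have \<tau>q: "?\<tau> (snd x' q) = snd x q" using q cx by (simp add: transition_eq)
  have Fq: "?F (snd x q) = snd d (f q)" using q cx by (simp add: local_rep_def chart_inv_snd)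
  have 1: "(?\<tau> has_derivative frechet_derivative ?\<tau> (at (snd x' q))) (at (snd x' q))"
    by (rule smooth_on_has_derivative[OF S.smooth_transition[OF x(2,1)]]) (use q in auto)
  have 2: "(?F has_derivative frechet_derivative ?F (at (snd x q))) (at (?\<tau> (snd x' q)))"
    unfolding \<tau>q by (rule smooth_on_has_derivative[OF smooth_local_rep[OF x(1) d(1)]]) (use q in auto)
  have 3: "(?\<sigma> has_derivative frechet_derivative ?\<sigma> (at (snd d (f q)))) (at (?F (?\<tau> (snd x' q))))"
    unfolding \<tau>q Fq by (rule smooth_on_has_derivative[OF M.smooth_transition[OF d']]) (use q in auto)
  have "frechet_derivative (local_rep d' f x') (at (snd x' q)) = frechet_derivative (\<lambda>z. ?\<sigma> (?F (?\<tau> z))) (at (snd x' q))"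
    by (rule frechet_derivative_cong_open[OF op _ eq]) (use q in auto)
  also have "\<dots> = (\<lambda>w. frechet_derivative ?\<sigma> (at (snd d (f q))) (frechet_derivative ?F (at (snd x q)) (frechet_derivative ?\<tau> (at (snd x' q)) w)))"
    by (rule frechet_derivative_at[symmetric, OF has_derivative_compose[OF has_derivative_compose[OF 1 2] 3]])
  also have "\<dots> = frechet_derivative ?\<sigma> (at (snd d (f q))) \<circ> (frechet_derivative ?F (at (snd x q)) \<circ> frechet_derivative ?\<tau> (at (snd x' q)))"
    by (simp add: fun_eq_iff)
  finally show ?thesis
    using inj_compose[OF M.inj_transition_derivative[OF d' q(3,4)]
        inj_compose[OF inj S.inj_transition_derivative[OF x(2,1) q(2,1)]]] by simp
qed

abbreviation "lam_at x \<equiv> local_frontal.lam (g c) (rep x) (nu x)"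

lemma singular_iff:
  assumes x: "x \<in> coordinate_systems S" and q: "q \<in> fst x" "q \<in> U"
  shows "singular_point S M f q \<longleftrightarrow> lam_at x (snd x q) = 0"
proof -
  have fq: "f q \<in> fst c" using q fU by blast
  have i: "inj (frechet_derivative (rep x) (at (snd x q))) \<longleftrightarrow> lam_at x (snd x q) \<noteq> 0"
    by (rule inj_frechet_iff_lam[OF local_frontal[OF x]]) (use q in blast)
  have S: "s \<in> S \<Longrightarrow> s \<in> coordinate_systems S" for s using S.compatible by blast
  obtain s where s: "s \<in> S" "q \<in> fst s" by (rule S.chart_at)
  show ?thesis
  proof
    assume "singular_point S M f q"
    then obtain s' d where "s' \<in> S" "d \<in> M" "q \<in> fst s'" "f q \<in> fst d"
      "\<not> inj (frechet_derivative (local_rep d f s') (at (snd s' q)))"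
      unfolding singular_point_def by blast
    then show "lam_at x (snd x q) = 0"
      using inj_local_rep[OF x S c, of s' d q] q fq i by blast
  next
    assume "lam_at x (snd x q) = 0"
    then have "\<not> inj (frechet_derivative (rep s) (at (snd s q)))"
      using inj_local_rep[OF S[OF s(1)] x c c s(2) q(1) fq fq] i by blast
    then show "singular_point S M f q"
      unfolding singular_point_def using s c fq by blast
  qed
qed

lemma signed_area_density_eq:
  assumes "x \<in> coordinate_systems S"
  shows "signed_area_density g f c N x = lam_at x"
  unfolding local_frontal.lam_def[OF local_frontal[OF assms], abs_def] signed_area_density_def[abs_def]
  by (simp add: Let_def)

lemma first_form_eq:
  assumes "x \<in> coordinate_systems S"
  shows "first_form g f c x = map_into_metric.ff (g c) (rep x)"
proof -
  interpret local_frontal "chart_image c" "g c" "region x" "rep x" "nu x" by (rule local_frontal[OF assms])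
  show ?thesis by (simp add: fun_eq_iff first_form_def ff_def Let_def)
qed

end

context frontal_in_chart
begin

lemma transition_zero:
  "\<lbrakk>x \<in> coordinate_systems S; p \<in> fst x; snd y p = 0\<rbrakk> \<Longrightarrow> transition x y (snd x p) = 0"
  using transition_eq[OF S.is_chart] by simp

lemma rep_zero: "x \<in> coordinate_systems S \<Longrightarrow> p \<in> fst x \<Longrightarrow> snd x p = 0 \<Longrightarrow> rep x 0 = snd c (f p)"
  using rep_eq[OF S.is_chart, of x p] by simp

lemma nu_zero: "x \<in> coordinate_systems S \<Longrightarrow> p \<in> fst x \<Longrightarrow> snd x p = 0 \<Longrightarrow> nu x 0 = N p"
  using chart_inv_snd[OF S.is_chart, of x p] by simp

text \<open>The point is \<open>pd 2 lam 0 \<noteq> 0\<close>. Otherwise both partial derivatives of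
  \<open>lam\<close> would vanish at 0, hence also those in the atlas chart that witnesses
  non-degeneracy.\<close>

lemma adapted_frontal:
  assumes uv: "uv \<in> adapted_coordinates S M g f c p" and p: "p \<in> U"
    and nd: "nondegenerate_singular_point S M g f c N p"
  shows "adapted_frontal (chart_image c) (g c) (region uv) (rep uv) (nu uv)"
proof -
  have u: "uv \<in> coordinate_systems S" "p \<in> fst uv" "snd uv p = 0" "pd 1 (rep uv) 0 = 0"
    and sing: "\<And>q. q \<in> fst uv \<Longrightarrow> singular_point S M f q \<longleftrightarrow> snd uv q $ 2 = 0"
    and unit: "gnorm (g c (snd c (f p))) (pd 2 (rep uv) 0) = 1"
    using uv by (auto simp: adapted_coordinates_def positive_coordinate_systems_def)
  have cu: "is_chart uv" by (rule S.is_chart[OF u(1)])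
  interpret b: local_frontal "chart_image c" "g c" "region uv" "rep uv" "nu uv"
    by (rule local_frontal[OF u(1)])
  have zero: "0 \<in> region uv" using u p by (metis IntI image_eqI)
  have axis: "b.lam z = 0 \<longleftrightarrow> z $ 2 = 0" if "z \<in> region uv" for z
    using that sing singular_iff[OF u(1)] by auto
  have lam0: "b.lam 0 = 0" using axis[OF zero] by simp
  have pd1: "pd 1 b.lam 0 = 0"
    by (rule pd_zero_on_axis[OF b.open_W zero smooth_on_differentiable[OF b.smooth_lam zero]])
      (simp add: axis axis_def)
  have "pd 2 b.lam 0 \<noteq> 0"
  proof
    assume pd2: "pd 2 b.lam 0 = 0"
    obtain x where x: "x \<in> S" "p \<in> fst x"
      and nz: "frechet_derivative (signed_area_density g f c N x) (at (snd x p)) \<noteq> (\<lambda>a. 0)"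
      using nd unfolding nondegenerate_singular_point_def by blast
    have x': "x \<in> coordinate_systems S" using x S.compatible by blast
    have cx: "is_chart x" by (rule S.is_chart[OF x'])
    let ?W = "snd x ` (fst x \<inter> (fst uv \<inter> U))"
    interpret ch: frontal_change "chart_image c" "g c" ?W "rep x" "nu x" "region uv" "rep uv" "nu uv" "transition x uv"
    proof (rule frontal_change[OF x' u(1) _ _ b.local_frontal_axioms])
      show "open ?W" using open_chart_image[OF cx] cu open_U by (simp add: is_chart_def open_Int)
    qed (auto simp: transition_eq[OF cx])
    have z: "snd x p \<in> ?W" using x u p by blast
    have t0: "transition x uv (snd x p) = 0" by (rule transition_zero[OF x' x(2) u(3)])
    have "pd i ch.a.lam (snd x p) = 0" for i
      using ch.pd_lam_change[OF z, of i] t0 lam0 pd1 pd2 by simp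
    then have "frechet_derivative ch.a.lam (at (snd x p)) w = 0" for w
      using frechet_derivative_pd[OF smooth_on_differentiable[OF ch.a.smooth_lam z]] by simp
    then show False using nz unfolding signed_area_density_eq[OF x'] by blast
  qed
  moreover have "b.gip 0 (pd 2 (rep uv) 0) (pd 2 (rep uv) 0) = 1"
    using unit rep_zero[OF u(1-3)] by (simp add: gnorm_def)
  ultimately show ?thesis
    by unfold_locales (use zero axis u in auto)
qed

text \<open>The set \<open>W\<close> is a parameter because for a second frontal with the same first fundamental form
  the coordinates are only known to be adapted near the point.\<close>

lemma limiting_normal_curvature_eq:
  assumes A: "adapted_frontal (chart_image c) (g c) W (rep uv) (nu uv)" and W: "W \<subseteq> region uv"
    and uv: "uv \<in> coordinate_systems S" "p \<in> fst uv" "snd uv p = 0" and p: "p \<in> U"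
    and xy: "xy \<in> kappa_coordinates S f c p"
  shows "limiting_normal_curvature g f c N xy p = local_frontal.sf (g c) (rep uv) (nu uv) 2 2 0"
proof -
  have x: "xy \<in> coordinate_systems S" "p \<in> fst xy" "snd xy p = 0" "pd 2 (rep xy) 0 = 0"
    using xy by (auto simp: kappa_coordinates_def positive_coordinate_systems_def)
  have cx: "is_chart xy" by (rule S.is_chart[OF x(1)])
  interpret b: adapted_frontal "chart_image c" "g c" W "rep uv" "nu uv" by (rule A)
  have cu: "is_chart uv" by (rule S.is_chart[OF uv(1)])
  \<comment> \<open>The part of the surface that \<open>uv\<close> maps into \<open>W\<close>, where
    the change of coordinates from \<open>xy\<close> is defined.\<close>
  have "open (fst uv \<inter> U \<inter> snd uv -` W)"
    using cu b.open_W open_U W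
      continuous_open_preimage[of "fst uv" "snd uv" W]
    by (simp add: is_chart_def homeomorphism_def open_Int Int_assoc Int_commute Int_left_commute)
  let ?W = "snd xy ` (fst xy \<inter> (fst uv \<inter> U \<inter> snd uv -` W))"
  interpret ch: frontal_change "chart_image c" "g c" ?W "rep xy" "nu xy" W "rep uv" "nu uv" "transition xy uv"
    by (rule frontal_change[OF x(1) uv(1) open_chart_image[OF cx \<open>open (fst uv \<inter> U \<inter> snd uv -` W)\<close>] _ b.local_frontal_axioms])
      (auto simp: transition_eq[OF cx])
  have z: "0 \<in> ?W" using x uv p b.zero_W by (intro image_eqI[of _ _ p]) auto
  interpret ch: change_to_adapted "chart_image c" "g c" ?W "rep xy" "nu xy" W "rep uv" "nu uv" "transition xy uv"
    using z transition_zero[OF x(1,2) uv(3)] x(3) by unfold_locales auto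
  have "ch.detJ 0 \<noteq> 0"
    using jacobian_nonzero[OF S.smooth_atlas_axioms x(1) uv(1) x(2) uv(2)] x(3)
    by (simp add: ch.detJ_def ch.J_def)
  from ch.limiting_curvature_jet[OF x(4) this] show ?thesis
    by (simp only: limiting_normal_curvature_def Let_def rep_zero[OF x(1-3), symmetric]
        nu_zero[OF x(1-3), symmetric])
qed

lemma cuspidal_curvature_eq:
  assumes "adapted_frontal (chart_image c) (g c) W (rep uv) (nu uv)"
    and uv: "uv \<in> coordinate_systems S" "p \<in> fst uv" "snd uv p = 0"
  shows "cuspidal_curvature g f c N uv p = pd 2 (local_frontal.sf (g c) (rep uv) (nu uv) 1 1) 0
    / (pd 2 (lam_at uv) 0)\<^sup>2"
proof -
  interpret b: adapted_frontal "chart_image c" "g c" W "rep uv" "nu uv" by fact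
  show ?thesis
    unfolding cuspidal_curvature_def Let_def rep_zero[OF uv, symmetric] by (rule b.cuspidal_jet)
qed

lemma product_curvature_eq:
  assumes "adapted_frontal (chart_image c) (g c) W (rep uv) (nu uv)" "W \<subseteq> region uv"
    "uv \<in> coordinate_systems S" "p \<in> fst uv" "snd uv p = 0" "p \<in> U" "xy \<in> kappa_coordinates S f c p"
  shows "product_curvature g f c N xy uv p = local_frontal.sf (g c) (rep uv) (nu uv) 2 2 0 *
    (pd 2 (local_frontal.sf (g c) (rep uv) (nu uv) 1 1) 0 / (pd 2 (lam_at uv) 0)\<^sup>2)"
  unfolding product_curvature_def limiting_normal_curvature_eq[OF assms] cuspidal_curvature_eq[OF assms(1,3-5)] ..

lemma change_to_adapted:
  assumes A: "adapted_frontal (chart_image c) (g c) (region uv) (rep uv) (nu uv)"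
    and uv: "uv \<in> coordinate_systems S" "p \<in> fst uv" "snd uv p = 0" and p: "p \<in> U"
    and x: "x \<in> coordinate_systems S" "p \<in> fst x" "snd x p = 0"
  shows "change_to_adapted (chart_image c) (g c) (snd x ` (fst x \<inter> (fst uv \<inter> U))) (rep x) (nu x)
    (region uv) (rep uv) (nu uv) (transition x uv)"
proof -
  have cx: "is_chart x" and cu: "is_chart uv" using S.is_chart x uv by auto
  let ?W = "snd x ` (fst x \<inter> (fst uv \<inter> U))"
  interpret b: adapted_frontal "chart_image c" "g c" "region uv" "rep uv" "nu uv" by (rule A)
  interpret ch: frontal_change "chart_image c" "g c" ?W "rep x" "nu x" "region uv" "rep uv" "nu uv" "transition x uv"
  proof (rule frontal_change[OF x(1) uv(1) _ _ b.local_frontal_axioms])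
    show "open ?W" using open_chart_image[OF cx] cu open_U by (simp add: is_chart_def open_Int)
  qed (auto simp: transition_eq[OF cx])
  have "0 \<in> ?W" using x uv p by (intro image_eqI[of _ _ p]) auto
  then show ?thesis
    using transition_zero[OF x(1,2) uv(3)] x(3) by unfold_locales auto
qed

text \<open>The limiting normal curvature is \<open>sf 2 2\<close> at 0 in either adapted system,
  and the cuspidal factor changes by \<open>J 2 2 0\<close>, which is 1 or -1 and so equals its
  sign.\<close>

lemma product_curvature_change:
  assumes nd: "nondegenerate_singular_point S M g f c N p" and p: "p \<in> U"
    and uv: "uv \<in> adapted_coordinates S M g f c p" and uv': "uv' \<in> adapted_coordinates S M g f c p"
    and xy: "xy \<in> kappa_coordinates S f c p" and xy': "xy' \<in> kappa_coordinates S f c p"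
  shows "side_sign uv uv' \<in> {-1, 1}"
    "product_curvature g f c N xy' uv' p = side_sign uv uv' * product_curvature g f c N xy uv p"
proof -
  have u: "uv \<in> coordinate_systems S" "p \<in> fst uv" "snd uv p = 0"
    and u': "uv' \<in> coordinate_systems S" "p \<in> fst uv'" "snd uv' p = 0"
    using uv uv' by (auto simp: adapted_coordinates_def positive_coordinate_systems_def)
  note A = adapted_frontal[OF uv p nd] and B = adapted_frontal[OF uv' p nd]
  interpret ch: change_to_adapted "chart_image c" "g c" "snd uv ` (fst uv \<inter> (fst uv' \<inter> U))" "rep uv" "nu uv"
    "region uv'" "rep uv'" "nu uv'" "transition uv uv'"
    by (rule change_to_adapted[OF B u' p u])
  have "adapted_frontal (chart_image c) (g c) (snd uv ` (fst uv \<inter> (fst uv' \<inter> U))) (rep uv) (nu uv)"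
    by (rule adapted_frontal_subset[OF A ch.a.open_W _ ch.zero_in_W]) blast
  note J = ch.adapted_change[OF this]
  have "side_sign uv uv' = sgn (ch.J 2 2 0)"
    unfolding side_sign_def ch.J_def
    using pd_nth[OF ch.df0[OF ch.smooth_\<tau>]] by metis
  moreover have "ch.J 2 2 0 = 1 \<or> ch.J 2 2 0 = -1" using J(1) by (simp add: power2_eq_1_iff)
  ultimately have s: "side_sign uv uv' = ch.J 2 2 0" "ch.J 2 2 0 \<in> {-1, 1}" by auto
  then show "side_sign uv uv' \<in> {-1, 1}" by simp
  have sf: "ch.a.sf 2 2 0 = ch.b.sf 2 2 0"
    using limiting_normal_curvature_eq[OF A subset_refl u p xy]
      limiting_normal_curvature_eq[OF B subset_refl u' p xy] by simp
  \<comment> \<open>\<open>adapted_change\<close> expresses the invariant in \<open>uv\<close>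
    through the one in \<open>uv'\<close>; since the sign squares to 1, the relation can be
    reversed.\<close>
  have "side_sign uv uv' * (ch.b.sf 2 2 0 * (ch.J 2 2 0 * q)) = ch.b.sf 2 2 0 * q" for q
    using s by auto
  then show "product_curvature g f c N xy' uv' p = side_sign uv uv' * product_curvature g f c N xy uv p"
    unfolding product_curvature_eq[OF A subset_refl u p xy] product_curvature_eq[OF B subset_refl u' p xy']
      J(2) sf by simp
qed

text \<open>In any coordinates centred at \<open>p\<close>, dQ and d\<lambda> are multiples of the
  differential of the adapted coordinate v. This supplies the proportionality needed in one
  direction and d\<lambda> \<noteq> 0 in the other.\<close>

lemma rationally_bounded_iff:
  assumes nd: "nondegenerate_singular_point S M g f c N p" and p: "p \<in> U"
    and uv: "uv \<in> adapted_coordinates S M g f c p" and xy: "xy \<in> kappa_coordinates S f c p"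
    and x: "x \<in> coordinate_systems S" "p \<in> fst x" "snd x p = 0"
  shows "gauss_curvature_rationally_bounded S M g f c x \<longleftrightarrow> product_curvature g f c N xy uv p = 0"
proof -
  have u: "uv \<in> coordinate_systems S" "p \<in> fst uv" "snd uv p = 0"
    using uv by (auto simp: adapted_coordinates_def positive_coordinate_systems_def)
  have cx: "is_chart x" by (rule S.is_chart[OF x(1)])
  note A = adapted_frontal[OF uv p nd]
  let ?V = "snd x ` (fst x \<inter> (fst uv \<inter> U))"
  interpret ch: change_to_adapted "chart_image c" "g c" ?V "rep x" "nu x"
    "region uv" "rep uv" "nu uv" "transition x uv"
    by (rule change_to_adapted[OF A u p x])
  let ?s = "ch.b.sf 2 2 0 * pd 2 (ch.b.sf 1 1) 0"
  have prod: "product_curvature g f c N xy uv p = 0 \<longleftrightarrow> ?s = 0"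
    unfolding product_curvature_eq[OF A subset_refl u p xy] using ch.b.pd2_lam by simp
  have "ch.detJ 0 \<noteq> 0"
    using jacobian_nonzero[OF S.smooth_atlas_axioms x(1) u(1) x(2) u(2)] x(3)
    by (simp add: ch.detJ_def ch.J_def)
  then have det: "ch.detJ 0 \<noteq> 0" and "ch.J 1 2 0 \<noteq> 0 \<or> ch.J 2 2 0 \<noteq> 0" by (auto simp: ch.detJ_def)
  then obtain m where m: "ch.J m 2 0 \<noteq> 0" by blast
  have reg: "\<not> singular_point S M f (chart_inv x z) \<longleftrightarrow> ch.a.lam z \<noteq> 0" if "z \<in> ?V" for z
    using that singular_iff[OF x(1)] by (auto simp: chart_inv_snd[OF cx])
  have gauss: "gauss_curvature (first_form g f c x) z * (ch.a.lam z)\<^sup>2 = ch.a.Q z"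
    if "z \<in> ?V" "ch.a.lam z \<noteq> 0" for z
    using ch.a.gauss_equation[OF that] by (simp only: first_form_eq[OF x(1)])
  have "?s = 0" if gb: "gauss_curvature_rationally_bounded S M g f c x"
  proof -
    obtain W where rb: "rationally_bounded W {z\<in>W. \<not> singular_point S M f (chart_inv x z)}
        (gauss_curvature (first_form g f c x))"
      using gb unfolding gauss_curvature_rationally_bounded_def by blast
    have "pd m ch.a.Q 0 = 0"
    proof (rule rationally_boundedD[OF rb ch.a.open_W ch.zero_in_W ch.a.smooth_lam ch.a.smooth_Q])
      show "ch.a.lam 0 = 0" by (rule ch.a_lam_zero)
      show "ch.a.Q 0 = 0" by (rule ch.Q_zero)
      \<comment> \<open>The constant is the quotient of \<open>pd_Q\<close> by
        \<open>pd_a_lam\<close>: the common \<open>J i 2 0\<close> and one factor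
        \<open>detJ 0\<close> cancel.\<close>
      show "pd i ch.a.Q 0 = (ch.detJ 0 * ?s / pd 2 ch.b.lam 0) * pd i ch.a.lam 0" for i
        unfolding ch.pd_Q ch.pd_a_lam using ch.b.pd2_lam by (simp add: power2_eq_square)
    qed (use reg gauss in auto)
    then show ?thesis using det m unfolding ch.pd_Q by simp
  qed
  moreover have "gauss_curvature_rationally_bounded S M g f c x" if s: "?s = 0"
  proof -
    have "pd m ch.a.lam 0 \<noteq> 0" unfolding ch.pd_a_lam using det m ch.b.pd2_lam by simp
    moreover have "isCont (pd m ch.a.lam) 0"
      using smooth_on_continuous[OF smooth_on_pd[OF ch.a.smooth_lam]] ch.zero_in_W
        continuous_on_eq_continuous_at[OF ch.a.open_W] by blast
    \<comment> \<open>\<open>rationally_boundedI\<close> asks for a nonvanishing derivative on the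
      whole ball; continuity provides a radius.\<close>
    ultimately obtain r where r: "r > 0" "\<And>z. dist 0 z < r \<Longrightarrow> pd m ch.a.lam z \<noteq> 0"
      using continuous_at_avoid[of 0 "pd m ch.a.lam" 0] by blast
    obtain e where e: "e > 0" "ball 0 e \<subseteq> ?V"
      using ch.a.open_W ch.zero_in_W openE by blast
    let ?W = "ball (0::real^2) (min r e)"
    have WV: "?W \<subseteq> ?V" using e by auto
    have "rationally_bounded ?W {z\<in>?W. \<not> singular_point S M f (chart_inv x z)}
        (gauss_curvature (first_form g f c x))"
    proof (rule rationally_boundedI[OF _ refl])
      show "0 < min r e" using r e by simp
      show "{z\<in>?W. \<not> singular_point S M f (chart_inv x z)} = {z\<in>?W. ch.a.lam z \<noteq> 0}"
        using reg WV by blast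
      show "smooth_on ?W ch.a.lam" "smooth_on ?W ch.a.Q"
        using smooth_on_subset WV ch.a.smooth_lam ch.a.smooth_Q by blast+
      show "ch.a.lam 0 = 0" by (rule ch.a_lam_zero)
      show "ch.a.Q 0 = 0" by (rule ch.Q_zero)
      show "pd i ch.a.Q 0 = 0" for i unfolding ch.pd_Q s by simp
      show "pd m ch.a.lam z \<noteq> 0" if "z \<in> ?W" for z using r(2)[of z] that by simp
      show "gauss_curvature (first_form g f c x) z * (ch.a.lam z)\<^sup>2 = ch.a.Q z"
        if "z \<in> {z\<in>?W. \<not> singular_point S M f (chart_inv x z)}" for z
        using that reg gauss WV by blast
    qed
    moreover have "?W \<subseteq> snd x ` (fst x \<inter> f -` fst c)" using WV fU by blast
    ultimately show ?thesis unfolding gauss_curvature_rationally_bounded_def by blast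
  qed
  ultimately show ?thesis using prod by blast
qed

end

text \<open>The first fundamental forms are compared in atlas charts. The tensor law
  \<open>ff_change\<close>, with the same Jacobian for both frontals, carries the equality to
  \<open>uv\<close>, on a neighbourhood where both normals are defined.\<close>

lemma product_curvature_intrinsic:
  assumes F: "frontal_in_chart S M g f c U N" and F': "frontal_in_chart S M' g' f' c' U' N'"
    and nd: "nondegenerate_singular_point S M g f c N p" and p: "p \<in> U" "p \<in> U'"
    and same: "same_first_form_near S M g f M' g' f' p"
    and uv: "uv \<in> adapted_coordinates S M g f c p"
    and xy: "xy \<in> kappa_coordinates S f c p" and xy': "xy' \<in> kappa_coordinates S f' c' p"
  shows "product_curvature g' f' c' N' xy' uv p = product_curvature g f c N xy uv p"
proof -
  interpret A: frontal_in_chart S M g f c U N by fact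
  interpret B: frontal_in_chart S M' g' f' c' U' N' by fact
  have u: "uv \<in> coordinate_systems S" "p \<in> fst uv" "snd uv p = 0"
    using uv by (auto simp: adapted_coordinates_def positive_coordinate_systems_def)
  have cu: "is_chart uv" by (rule A.S.is_chart[OF u(1)])
  obtain V where V: "open V" "p \<in> V" and eq: "\<And>q x d d'. \<lbrakk>q \<in> V; x \<in> S; d \<in> M; d' \<in> M';
      q \<in> fst x; f q \<in> fst d; f' q \<in> fst d'\<rbrakk> \<Longrightarrow>
      first_form g f d x (snd x q) = first_form g' f' d' x (snd x q)"
    using same unfolding same_first_form_near_def by blast
  let ?W = "snd uv ` (fst uv \<inter> (U \<inter> U' \<inter> V))"
  have opW: "open ?W" by (rule open_chart_image[OF cu]) (intro open_Int A.open_U B.open_U V)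
  have zW: "0 \<in> ?W" using u p V by (intro image_eqI[of _ _ p]) auto
  have AF: "adapted_frontal (chart_image c) (g c) ?W (A.rep uv) (A.nu uv)"
    by (rule adapted_frontal_subset[OF A.adapted_frontal[OF uv p(1) nd] opW _ zW]) blast
  have BF: "local_frontal (chart_image c') (g' c') ?W (B.rep uv) (B.nu uv)"
    by (rule local_frontal_subset[OF B.local_frontal[OF u(1)] opW]) blast
  interpret a: adapted_frontal "chart_image c" "g c" ?W "A.rep uv" "A.nu uv" by (rule AF)
  interpret b: local_frontal "chart_image c'" "g' c'" ?W "B.rep uv" "B.nu uv" by (rule BF)
  interpret iso: isometric_frontals "chart_image c" "g c" ?W "A.rep uv" "A.nu uv"
    "chart_image c'" "g' c'" "B.rep uv" "B.nu uv"
  proof unfold_locales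
    fix z assume "z \<in> ?W"
    then obtain q where q: "q \<in> fst uv" "q \<in> U" "q \<in> U'" "q \<in> V" "z = snd uv q" by blast
    obtain x where x: "x \<in> S" "q \<in> fst x" by (rule A.S.chart_at)
    have x': "x \<in> coordinate_systems S" using x A.S.compatible by blast
    have cx: "is_chart x" by (rule A.S.is_chart[OF x'])
    let ?X = "snd uv ` (fst uv \<inter> (fst x \<inter> U \<inter> U'))"
    have opX: "open ?X"
      by (rule open_chart_image[OF cu]) (use cx in \<open>auto simp: is_chart_def intro!: open_Int A.open_U B.open_U\<close>)
    interpret ca: frontal_change "chart_image c" "g c" ?X "A.rep uv" "A.nu uv" "A.region x" "A.rep x" "A.nu x" "transition uv x"
      by (rule A.frontal_change[OF u(1) x' opX _ A.local_frontal[OF x']]) (auto simp: transition_eq[OF cu])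
    interpret cb: frontal_change "chart_image c'" "g' c'" ?X "B.rep uv" "B.nu uv" "B.region x" "B.rep x" "B.nu x" "transition uv x"
      by (rule B.frontal_change[OF u(1) x' opX _ B.local_frontal[OF x']]) (auto simp: transition_eq[OF cu])
    have z: "z \<in> ?X" using q x by blast
    have "first_form g f c x (snd x q) = first_form g' f' c' x (snd x q)"
      using eq[OF q(4) x(1) A.c B.c x(2)] q A.fU B.fU by blast
    then have "ca.b.ff (transition uv x z) = cb.b.ff (transition uv x z)"
      unfolding A.first_form_eq[OF x'] B.first_form_eq[OF x'] q(5) transition_eq[OF cu q(1)] .
    then show "a.ff z = b.ff z"
      by (simp add: vec_eq_iff ca.ff_change[OF z] cb.ff_change[OF z] ca.J_def cb.J_def)
  qed
  have "?W \<subseteq> A.region uv" "?W \<subseteq> B.region uv" by blast+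
  note A.product_curvature_eq[OF AF this(1) u p(1) xy]
    and B.product_curvature_eq[OF iso.adapted this(2) u p(2) xy']
  then show ?thesis using iso.product_eq by simp
qed

lemma oriented_smooth_atlas: "oriented_manifold A \<Longrightarrow> smooth_atlas A"
  by unfold_locales (auto simp: oriented_manifold_def positive_coordinate_systems_def)

lemma frontal_in_chartI:
  assumes "oriented_manifold S" "oriented_manifold M" "riemannian_metric M g" "frontal S M g f"
    "c \<in> M" "unit_normal S g f c U N"
  shows "frontal_in_chart S M g f c U N"
  using assms
  by (auto simp: frontal_in_chart_def frontal_in_chart_axioms_def oriented_smooth_atlas frontal_def)

text \<open>A sign does not affect vanishing, so the criterion for the Gaussian curvature can be
  stated with any adapted coordinates.\<close>

theorem proposition3p3:
  fixes S :: "('s::{t2_space,second_countable_topology}, real^2) chart set"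
    and M :: "('m::{t2_space,second_countable_topology}, real^3) chart set"
    and g :: "('m, 3) metric" and f :: "'s \<Rightarrow> 'm" and p :: 's
    and c :: "('m, real^3) chart" and U :: "'s set" and N :: "'s \<Rightarrow> real^3"
  assumes "oriented_manifold S" and "oriented_manifold M" and "riemannian_metric M g"
    and "frontal S M g f"
    and "c \<in> M" and "p \<in> U" and "unit_normal S g f c U N"
    and "nondegenerate_singular_point S M g f c N p" and "of_second_kind S M f p"
  shows
    \<comment> \<open>independence of the coordinate systems, up to the sign for reversing the side \<open>v > 0\<close>\<close>
    "(\<forall>uv \<in> adapted_coordinates S M g f c p. \<forall>uv' \<in> adapted_coordinates S M g f c p.
      \<forall>xy \<in> kappa_coordinates S f c p. \<forall>xy' \<in> kappa_coordinates S f c p.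
        side_sign uv uv' \<in> {-1, 1} \<and>
        product_curvature g f c N xy' uv' p =
          side_sign uv uv' * product_curvature g f c N xy uv p)
    \<and>
    \<comment> \<open>in given adapted coordinates, dependence on the first fundamental form alone\<close>
    (\<forall>(M' :: ('n::{t2_space,second_countable_topology}, real^3) chart set) g' f' c' U' N'.
        oriented_manifold M' \<and> riemannian_metric M' g' \<and> frontal S M' g' f' \<and>
        c' \<in> M' \<and> p \<in> U' \<and> unit_normal S g' f' c' U' N' \<and>
        same_first_form_near S M g f M' g' f' p \<longrightarrow>
        (\<forall>uv \<in> adapted_coordinates S M g f c p.
         \<forall>xy \<in> kappa_coordinates S f c p. \<forall>xy' \<in> kappa_coordinates S f' c' p.
           product_curvature g' f' c' N' xy' uv p = product_curvature g f c N xy uv p))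
    \<and>
    (\<forall>uv \<in> adapted_coordinates S M g f c p. \<forall>xy \<in> kappa_coordinates S f c p.
     \<forall>x \<in> coordinate_systems S. p \<in> fst x \<and> snd x p = 0 \<longrightarrow>
        (gauss_curvature_rationally_bounded S M g f c x \<longleftrightarrow>
         product_curvature g f c N xy uv p = 0))"
proof -
  have F: "frontal_in_chart S M g f c U N"
    by (rule frontal_in_chartI[OF assms(1-5,7)])
  then interpret frontal_in_chart S M g f c U N .
  show ?thesis
  proof (intro conjI ballI allI impI)
    fix uv uv' xy xy'
    assume "uv \<in> adapted_coordinates S M g f c p" "uv' \<in> adapted_coordinates S M g f c p"
      "xy \<in> kappa_coordinates S f c p" "xy' \<in> kappa_coordinates S f c p"
    note change = product_curvature_change[OF assms(8,6) this]
    show "side_sign uv uv' \<in> {-1, 1}" by (rule change(1))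
    show "product_curvature g f c N xy' uv' p = side_sign uv uv' * product_curvature g f c N xy uv p"
      by (rule change(2))
  next
    fix M' :: "('n::{t2_space,second_countable_topology}, real^3) chart set" and g' f' c' U' N' uv xy xy'
    assume h: "oriented_manifold M' \<and> riemannian_metric M' g' \<and> frontal S M' g' f' \<and>
        c' \<in> M' \<and> p \<in> U' \<and> unit_normal S g' f' c' U' N' \<and> same_first_form_near S M g f M' g' f' p"
      and uv: "uv \<in> adapted_coordinates S M g f c p"
      and xy: "xy \<in> kappa_coordinates S f c p" "xy' \<in> kappa_coordinates S f' c' p"
    have "frontal_in_chart S M' g' f' c' U' N'"
      by (rule frontal_in_chartI) (use assms(1) h in blast)+
    then show "product_curvature g' f' c' N' xy' uv p = product_curvature g f c N xy uv p"
      by (rule product_curvature_intrinsic[OF F _ assms(8,6) _ _ uv xy]) (use h in blast)+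
  next
    fix uv xy x
    assume "uv \<in> adapted_coordinates S M g f c p" "xy \<in> kappa_coordinates S f c p"
      "x \<in> coordinate_systems S" "p \<in> fst x \<and> snd x p = 0"
    then show "gauss_curvature_rationally_bounded S M g f c x \<longleftrightarrow> product_curvature g f c N xy uv p = 0"
      using rationally_bounded_iff[OF assms(8,6)] by blast
  qed
qed

end
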